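(* Let $\varepsilon \in (0,1)$ be a fixed constant and let $\Delta_0$ be sufficiently large as a function of $\varepsilon$. There is a randomized fully dynamic algorithm that, for any fully dynamic $n$-vertex triangle-free graph of maximum degree $\Delta \geq \Delta_0$ undergoing edge insertions and deletions, maintains after every update a proper coloring of the current graph using at most $(1+\varepsilon)\cdot \Delta/\ln\Delta$ colors. With high probability, its amortized update time is $O(\Delta^2 \log n)$ against an adaptive adversary and $O(\Delta^2)$ against an oblivious adversary.
   Context: Fully dynamic model: the vertex set is fixed, $V=\{1,\dots,n\}$; the graph starts empty and each update inserts or deletes a single edge. The value $\Delta$ is known to the algorithm in advance, and every vertex has degree at most $\Delta$ in every graph of the update sequence; every graph in the sequence is triangle-free. The number of updates is assumed to be at least $n$ (at least $\Omega(n)$). A proper coloring assigns colors to vertices so that no edge has both endpoints of the same color. An oblivious adversary fixes the whole update sequence in advance; an adaptive adversary may choose each update based on the algorithm's outputs and all of its random coin tosses so far. Amortized update time means total running time over the first $T$ updates divided by $T$; "with high probability" refers to probability tending to $1$ as $n$ grows (at least $1-1/\mathrm{poly}(n)$). *)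

theory Defs
  imports "HOL-Probability.Probability" "HOL-Library.Log_Nat"
begin

section \<open>Fully dynamic triangle-free graphs of bounded degree\<close>

text \<open>The vertex set is \<open>{1..n}\<close>; a graph is its set of edges, each edge being a two-element set.\<close>

datatype update = Insert nat nat | Delete nat nat

fun apply_update :: "update \<Rightarrow> nat set set \<Rightarrow> nat set set" where
  "apply_update (Insert u v) E = E \<union> {{u, v}}"
| "apply_update (Delete u v) E = E - {{u, v}}"

definition graph_after :: "update list \<Rightarrow> nat set set" where
  "graph_after us = fold apply_update us {}"

definition degree :: "nat set set \<Rightarrow> nat \<Rightarrow> nat" where
  "degree E v = card {e \<in> E. v \<in> e}"

definition triangle_free :: "nat set set \<Rightarrow> bool" where
  "triangle_free E \<longleftrightarrow>
     \<not> (\<exists>x y z. distinct [x, y, z] \<and> {x, y} \<in> E \<and> {y, z} \<in> E \<and> {x, z} \<in> E)"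

fun changes_one_edge :: "nat \<Rightarrow> nat set set \<Rightarrow> update \<Rightarrow> bool" where
  "changes_one_edge n E (Insert u v) \<longleftrightarrow>
     u \<in> {1..n} \<and> v \<in> {1..n} \<and> u \<noteq> v \<and> {u, v} \<notin> E"
| "changes_one_edge n E (Delete u v) \<longleftrightarrow> {u, v} \<in> E"

definition valid_update :: "nat \<Rightarrow> nat \<Rightarrow> nat set set \<Rightarrow> update \<Rightarrow> bool" where
  "valid_update n \<Delta> E x \<longleftrightarrow>
     changes_one_edge n E x \<and> triangle_free (apply_update x E) \<and>
     (\<forall>v\<in>{1..n}. degree (apply_update x E) v \<le> \<Delta>)"

definition valid_updates :: "nat \<Rightarrow> nat \<Rightarrow> update list \<Rightarrow> bool" where
  "valid_updates n \<Delta> us \<longleftrightarrow>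
     (\<forall>i<length us. valid_update n \<Delta> (graph_after (take i us)) (us ! i))"

definition proper_coloring :: "nat set set \<Rightarrow> (nat \<Rightarrow> nat) \<Rightarrow> bool" where
  "proper_coloring E c \<longleftrightarrow> (\<forall>u v. {u, v} \<in> E \<longrightarrow> c u \<noteq> c v)"


section \<open>A randomized word RAM\<close>

text \<open>
  Programs are structured rather than using jumps.  All machine words are below \<open>2 ^ w\<close>; every
  elementary command and every test of a condition costs one time unit.  A program mentions only
  finitely many registers; the memory is an array addressed by words.
\<close>

datatype binop =
  Plus | Minus | Times | Divide | Modulo | BitAnd | BitOr | BitXor | ShiftL | ShiftR | Less | Equal

fun word_op :: "nat \<Rightarrow> binop \<Rightarrow> nat \<Rightarrow> nat \<Rightarrow> nat" where
  "word_op w Plus x y = (x + y) mod 2 ^ w"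
| "word_op w Minus x y = (x + 2 ^ w - y) mod 2 ^ w"
| "word_op w Times x y = (x * y) mod 2 ^ w"
| "word_op w Divide x y = x div y"
| "word_op w Modulo x y = x mod y"
| "word_op w BitAnd x y = Bit_Operations.and x y"
| "word_op w BitOr x y = Bit_Operations.or x y"
| "word_op w BitXor x y = Bit_Operations.xor x y"
| "word_op w ShiftL x y = (x * 2 ^ y) mod 2 ^ w"
| "word_op w ShiftR x y = x div 2 ^ y"
| "word_op w Less x y = of_bool (x < y)"
| "word_op w Equal x y = of_bool (x = y)"

datatype com =
  Const nat nat                 \<comment> \<open>\<open>Const r k\<close>: \<open>r := k\<close>\<close>
| Op binop nat nat nat          \<comment> \<open>\<open>Op f r a b\<close>: \<open>r := f a b\<close>, all three being registers\<close>
| Load nat nat                  \<comment> \<open>\<open>Load r a\<close>: \<open>r := mem[a]\<close>\<close>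
| Store nat nat                 \<comment> \<open>\<open>Store a r\<close>: \<open>mem[a] := r\<close>\<close>
| Rand nat                      \<comment> \<open>\<open>Rand r\<close>: \<open>r :=\<close> a fresh uniformly random word\<close>
| Cond nat "com list" "com list"
| Loop nat "com list"           \<comment> \<open>\<open>Loop r p\<close>: run \<open>p\<close> as long as register \<open>r\<close> is nonzero\<close>

record machine =
  todo :: "com list"
  regs :: "nat \<Rightarrow> nat"
  mem :: "nat \<Rightarrow> nat"
  drawn :: nat                  \<comment> \<open>number of random words drawn so far\<close>

text \<open>The random words are the entries of \<open>\<omega>\<close>, used in order of their index.\<close>

fun exec_com :: "nat \<Rightarrow> (nat \<Rightarrow> nat) \<Rightarrow> com \<Rightarrow> machine \<Rightarrow> machine" where
  "exec_com w \<omega> (Const r k) s = s\<lparr>regs := (regs s)(r := k mod 2 ^ w)\<rparr>"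
| "exec_com w \<omega> (Op f r a b) s = s\<lparr>regs := (regs s)(r := word_op w f (regs s a) (regs s b))\<rparr>"
| "exec_com w \<omega> (Load r a) s = s\<lparr>regs := (regs s)(r := mem s (regs s a))\<rparr>"
| "exec_com w \<omega> (Store a r) s = s\<lparr>mem := (mem s)(regs s a := regs s r)\<rparr>"
| "exec_com w \<omega> (Rand r) s = s\<lparr>regs := (regs s)(r := \<omega> (drawn s)), drawn := Suc (drawn s)\<rparr>"
| "exec_com w \<omega> (Cond r p q) s = s\<lparr>todo := (if regs s r \<noteq> 0 then p else q) @ todo s\<rparr>"
| "exec_com w \<omega> (Loop r p) s =
     s\<lparr>todo := (if regs s r \<noteq> 0 then p @ Loop r p # todo s else todo s)\<rparr>"

definition step :: "nat \<Rightarrow> (nat \<Rightarrow> nat) \<Rightarrow> machine \<Rightarrow> machine" where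
  "step w \<omega> s = (case todo s of [] \<Rightarrow> s | c # cs \<Rightarrow> exec_com w \<omega> c (s\<lparr>todo := cs\<rparr>))"

text \<open>The final machine state together with the number of steps taken, if the program halts.\<close>

definition execute :: "nat \<Rightarrow> (nat \<Rightarrow> nat) \<Rightarrow> machine \<Rightarrow> (machine \<times> nat) option" where
  "execute w \<omega> s =
     (if \<exists>k. todo ((step w \<omega> ^^ k) s) = []
      then let k = LEAST k. todo ((step w \<omega> ^^ k) s) = [] in Some ((step w \<omega> ^^ k) s, k)
      else None)"

definition random_words :: "nat \<Rightarrow> (nat \<Rightarrow> nat) measure" where
  "random_words w = (\<Pi>\<^sub>M i\<in>UNIV. uniform_count_measure {..<2 ^ w})"


section \<open>Dynamic algorithms and adversaries\<close>

text \<open>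
  An algorithm consists of an initialization program, started on all-zero memory with \<open>n\<close> and
  \<open>\<Delta>\<close> in registers 0 and 1, and a program run for each update, which receives 1 (insertion) or
  0 (deletion) in register 0 and the endpoints of the edge in registers 1 and 2.  Only the memory
  persists between runs.  The output is explicit: after each run, memory cell \<open>v\<close> holds the
  color of vertex \<open>v\<close>.  The field \<open>word_factor\<close> is the constant factor in the word length of
  \<open>O(log n)\<close> bits.
\<close>

record algorithm =
  init_prog :: "com list"
  update_prog :: "com list"
  word_factor :: nat

text \<open>For \<open>\<Delta> < n\<close> this is \<open>\<Theta>(log n)\<close>; \<open>\<Delta>\<close> is included so that it always fits in a word.\<close>

definition word_size :: "algorithm \<Rightarrow> nat \<Rightarrow> nat \<Rightarrow> nat" where
  "word_size alg n \<Delta> = word_factor alg * ceillog2 (n + \<Delta> + 1)"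

fun input_of :: "update \<Rightarrow> nat list" where
  "input_of (Insert u v) = [1, u, v]"
| "input_of (Delete u v) = [0, u, v]"

definition start :: "com list \<Rightarrow> nat list \<Rightarrow> (nat \<Rightarrow> nat) \<Rightarrow> nat \<Rightarrow> machine" where
  "start p xs m d =
     \<lparr>todo = p, regs = (\<lambda>r. if r < length xs then xs ! r else 0), mem = m, drawn = d\<rparr>"

text \<open>
  An adversary chooses the next update from the colorings output after the previous updates and
  from all random words drawn so far.
\<close>

type_synonym adversary = "(nat \<Rightarrow> nat) list \<Rightarrow> nat list \<Rightarrow> update"

definition oblivious :: "update list \<Rightarrow> adversary" where
  "oblivious us = (\<lambda>outs coins. us ! length outs)"

record snapshot =
  memory :: "nat \<Rightarrow> nat"
  words_drawn :: nat
  updates :: "update list"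
  outputs :: "(nat \<Rightarrow> nat) list"
  total_time :: nat             \<comment> \<open>including initialization\<close>

definition next_update :: "adversary \<Rightarrow> (nat \<Rightarrow> nat) \<Rightarrow> snapshot \<Rightarrow> update" where
  "next_update adv \<omega> X = adv (outputs X) (map \<omega> [0..<words_drawn X])"

definition coloring_of :: "nat \<Rightarrow> (nat \<Rightarrow> nat) \<Rightarrow> nat \<Rightarrow> nat" where
  "coloring_of n m = restrict m {1..n}"

text \<open>The situation after \<open>t\<close> updates; \<open>None\<close> if some program run has not terminated.\<close>

fun run :: "algorithm \<Rightarrow> nat \<Rightarrow> nat \<Rightarrow> adversary \<Rightarrow> (nat \<Rightarrow> nat) \<Rightarrow> nat \<Rightarrow> snapshot option" where
  "run alg n \<Delta> adv \<omega> 0 =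
     (case execute (word_size alg n \<Delta>) \<omega> (start (init_prog alg) [n, \<Delta>] (\<lambda>_. 0) 0) of
        None \<Rightarrow> None
      | Some (s, k) \<Rightarrow>
          Some \<lparr>memory = mem s, words_drawn = drawn s, updates = [], outputs = [],
                total_time = k\<rparr>)"
| "run alg n \<Delta> adv \<omega> (Suc t) =
     (case run alg n \<Delta> adv \<omega> t of
        None \<Rightarrow> None
      | Some X \<Rightarrow>
          (let x = next_update adv \<omega> X in
           case execute (word_size alg n \<Delta>) \<omega>
                  (start (update_prog alg) (input_of x) (memory X) (words_drawn X)) of
             None \<Rightarrow> None
           | Some (s, k) \<Rightarrow>
               Some \<lparr>memory = mem s, words_drawn = drawn s, updates = updates X @ [x],
                     outputs = outputs X @ [coloring_of n (mem s)],
                     total_time = total_time X + k\<rparr>))"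

abbreviation coin_space :: "algorithm \<Rightarrow> nat \<Rightarrow> nat \<Rightarrow> (nat \<Rightarrow> nat) measure" where
  "coin_space alg n \<Delta> \<equiv> random_words (word_size alg n \<Delta>)"

text \<open>Each of the first \<open>T\<close> updates is valid at the time at which the adversary issues it.\<close>

definition legal_adversary :: "algorithm \<Rightarrow> nat \<Rightarrow> nat \<Rightarrow> adversary \<Rightarrow> nat \<Rightarrow> bool" where
  "legal_adversary alg n \<Delta> adv T \<longleftrightarrow>
     (\<forall>\<omega>\<in>space (coin_space alg n \<Delta>). \<forall>t<T. \<forall>X.
        run alg n \<Delta> adv \<omega> t = Some X \<longrightarrow>
        valid_updates n \<Delta> (updates X @ [next_update adv \<omega> X]))"

text \<open>
  Las Vegas correctness: with probability 1, each of the first \<open>T\<close> updates is completed and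
  leaves a proper coloring with at most \<open>K\<close> colors.
\<close>

definition maintains_coloring ::
    "algorithm \<Rightarrow> nat \<Rightarrow> nat \<Rightarrow> adversary \<Rightarrow> nat \<Rightarrow> real \<Rightarrow> bool" where
  "maintains_coloring alg n \<Delta> adv T K \<longleftrightarrow>
     (AE \<omega> in coin_space alg n \<Delta>. \<forall>t\<in>{1..T}. \<exists>X.
        run alg n \<Delta> adv \<omega> t = Some X \<and>
        proper_coloring (graph_after (updates X)) (coloring_of n (memory X)) \<and>
        real (card (coloring_of n (memory X) ` {1..n})) \<le> K)"

definition prob_amortized_time_le ::
    "algorithm \<Rightarrow> nat \<Rightarrow> nat \<Rightarrow> adversary \<Rightarrow> nat \<Rightarrow> real \<Rightarrow> real" where
  "prob_amortized_time_le alg n \<Delta> adv T B =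
     measure (coin_space alg n \<Delta>)
       {\<omega> \<in> space (coin_space alg n \<Delta>). \<exists>X.
          run alg n \<Delta> adv \<omega> T = Some X \<and> real (total_time X) / real T \<le> B}"

end

theory Submission
  imports Defs "HOL-Real_Asymp.Real_Asymp"
begin

text \<open>
  The algorithm maintains a proper partial coloring with \<open>q \<approx> (1 + \<epsilon>/2) \<Delta> / ln \<Delta>\<close> primary colors;
  blank vertices receive a color from a separate palette of \<open>r \<approx> (\<epsilon>/4) \<Delta> / ln \<Delta>\<close> colors, which
  is possible greedily as long as a blank vertex has fewer than \<open>r\<close> blank neighbors.  If a blank
  vertex \<open>v\<close> violates this, all neighbors of \<open>x\<close> are recolored independently and uniformly with one of
  their available primary colors or blank, where \<open>x\<close> is a neighbor of \<open>v\<close> with fewer than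
  \<open>l = \<Theta>(ln \<Delta>)\<close> available colors or, if there is none, \<open>v\<close> itself.  As the graph is triangle-free, the
  neighbors of \<open>x\<close> are independent and their lists of available colors do not change.  By negative
  correlation and Jensen's inequality, at least \<open>l\<close> primary colors stay available at \<open>x\<close>, and fewer than
  \<open>r\<close> neighbors with long lists become blank, except with probability smaller than any power of
  \<open>1 / \<Delta>\<close>, whatever the colors outside the neighborhood of \<open>x\<close> are.

  In place of an entropy compression argument, the probability of at least \<open>s\<close> recolorings is summed over
  all initial colorings: since a recoloring step is reversible for the counting measure, one such step
  multiplies this sum by the (tiny) fraction of flawed configurations around \<open>x\<close> only.
  This gives the bound \<open>(q + 1)\<^sup>n * \<rho>\<^sup>s * 4\<^sup>T\<close> for a fixed sequence of \<open>T\<close> updates, and a union bound over all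
  \<open>(2 * n\<^sup>2)\<^sup>T\<close> sequences covers adaptive adversaries, who are thus handled with \<open>O(T * ln n)\<close> recolorings.
\<close>

section \<open>Random words\<close>

text \<open>A vertex with few available colors becomes blank with large probability, so the number
  of blank neighbors of \<open>v\<close> cannot be controlled directly. \<open>flawed\<close>
  therefore counts only blank neighbors with long lists and treats a short list as a flaw of the
  vertex that has it; this is why the recolored neighborhood may belong to a vertex other than
  \<open>v\<close>.

  Given the history, the current coloring is far from uniform; the sum over all initial colorings
  replaces any invariant about its distribution. A step from \<sigma> to \<tau> has probability
  about 1 over the product of the list sizes around \<open>x\<close>. These sizes agree in \<sigma>
  and \<tau>, and the number of flawed \<sigma> leading to \<tau> is a tiny multiple of the same
  product, so the product cancels.

  The process may run forever on some random words. Hence the analysis uses \<open>reach\<close>,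
  which is decided after \<open>s\<close> recolorings, and the program is proved correct under the
  assumption that \<open>reach\<close> fails for some \<open>s\<close>. The analysis also treats all
  blank vertices alike (\<open>proj\<close>): with secondary colors, a recolored state would have
  many more predecessors.\<close>

lemma
  fixes Q :: "nat \<Rightarrow> (nat \<Rightarrow> nat) \<Rightarrow> bool"
  assumes Q: "\<And>a. a < 2 ^ w \<Longrightarrow> Measurable.pred (random_words w) (Q a)"
  shows pred_random_words_first:
      "Measurable.pred (random_words w) (\<lambda>\<omega>. Q (\<omega> 0) (\<lambda>i. \<omega> (Suc i)))"
    and measure_random_words_first:
      "measure (random_words w) {\<omega> \<in> space (random_words w). Q (\<omega> 0) (\<lambda>i. \<omega> (Suc i))} =
       (\<Sum>a<2 ^ w. measure (random_words w) {\<omega> \<in> space (random_words w). Q a \<omega>}) / 2 ^ w" (is "?L = ?R")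
proof -
  let ?M = "uniform_count_measure {..<2 ^ w :: nat}"
  let ?S = "random_words w"
  have M: "prob_space ?M" by (intro prob_space_uniform_count_measure) (auto simp: lessThan_empty_iff)
  interpret M: prob_space ?M by (rule M)
  interpret sequence_space ?M by unfold_locales
  have S: "?S = (\<Pi>\<^sub>M i\<in>UNIV. ?M)" by (simp add: random_words_def)
  interpret S: prob_space ?S unfolding S by unfold_locales
  have sp: "\<omega> i < 2 ^ w" if "\<omega> \<in> space ?S" for \<omega> i
    using that by (auto simp: S space_PiM PiE_iff space_uniform_count_measure)
  have shift: "(\<lambda>\<omega> i. \<omega> (Suc i)) \<in> measurable ?S ?S"
    unfolding S by (rule measurable_PiM_single') (auto simp: space_PiM PiE_iff)
  have comp: "(\<lambda>\<omega>. \<omega> 0) \<in> measurable ?S ?M" unfolding S by measurable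
  \<comment> \<open>The first word takes finitely many values, so fixing it splits the event into
    finitely many pieces, each an intersection of two preimages.\<close>
  have "{\<omega> \<in> space ?S. Q (\<omega> 0) (\<lambda>i. \<omega> (Suc i))} =
      (\<Union>a<2 ^ w. ((\<lambda>\<omega>. \<omega> 0) -` {a} \<inter> space ?S) \<inter>
         ((\<lambda>\<omega> i. \<omega> (Suc i)) -` {\<omega> \<in> space ?S. Q a \<omega>} \<inter> space ?S))"
    using sp measurable_space[OF shift] by auto
  also have "\<dots> \<in> sets ?S"
    by (intro sets.finite_UN sets.Int measurable_sets[OF comp] measurable_sets[OF shift])
       (use Q in \<open>auto simp: pred_def sets_uniform_count_measure\<close>)
  finally have A: "{\<omega> \<in> space ?S. Q (\<omega> 0) (\<lambda>i. \<omega> (Suc i))} \<in> sets ?S" .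
  then show "Measurable.pred (random_words w) (\<lambda>\<omega>. Q (\<omega> 0) (\<lambda>i. \<omega> (Suc i)))" by (simp add: pred_def)
  let ?A = "{\<omega> \<in> space ?S. Q (\<omega> 0) (\<lambda>i. \<omega> (Suc i))}"
  have cn: "(\<lambda>(s, \<omega>). case_nat s \<omega>) \<in> measurable (?M \<Otimes>\<^sub>M ?S) ?S"
    unfolding S by measurable
  \<comment> \<open>By \<open>PiM_iter\<close>, prepending an independent uniform word to a random
    sequence reproduces the sequence measure. Fubini's theorem for this product then averages over
    the first word.\<close>
  have "emeasure ?S ?A = emeasure (distr (?M \<Otimes>\<^sub>M ?S) ?S (\<lambda>(s, \<omega>). case_nat s \<omega>)) ?A"
    using PiM_iter by (simp add: S)
  also have "\<dots> = emeasure (?M \<Otimes>\<^sub>M ?S) ((\<lambda>(s, \<omega>). case_nat s \<omega>) -` ?A \<inter> space (?M \<Otimes>\<^sub>M ?S))"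
    by (rule emeasure_distr[OF cn A])
  also have "\<dots> = (\<integral>\<^sup>+a. emeasure ?S (Pair a -` ((\<lambda>(s, \<omega>). case_nat s \<omega>) -` ?A \<inter> space (?M \<Otimes>\<^sub>M ?S))) \<partial>?M)"
    by (rule S.emeasure_pair_measure_alt[OF measurable_sets[OF cn A]])
  also have "\<dots> = (\<integral>\<^sup>+a. emeasure ?S {\<omega> \<in> space ?S. Q a \<omega>} \<partial>?M)"
  proof (rule nn_integral_cong)
    fix a assume "a \<in> space ?M"
    then have a: "a < 2 ^ w" by (simp add: space_uniform_count_measure)
    have "case_nat a \<omega> \<in> space ?S" if "\<omega> \<in> space ?S" for \<omega>
      using that a by (auto simp: S space_PiM PiE_iff space_uniform_count_measure split: nat.split)
    then have "Pair a -` ((\<lambda>(s, \<omega>). case_nat s \<omega>) -` ?A \<inter> space (?M \<Otimes>\<^sub>M ?S)) = {\<omega> \<in> space ?S. Q a \<omega>}"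
      using a by (auto simp: space_pair_measure space_uniform_count_measure)
    then show "emeasure ?S (Pair a -` ((\<lambda>(s, \<omega>). case_nat s \<omega>) -` ?A \<inter> space (?M \<Otimes>\<^sub>M ?S))) = emeasure ?S {\<omega> \<in> space ?S. Q a \<omega>}"
      by simp
  qed
  also have "\<dots> = (\<Sum>a<2 ^ w. ennreal (1 / 2 ^ w) * emeasure ?S {\<omega> \<in> space ?S. Q a \<omega>})"
    unfolding uniform_count_measure_def by (subst nn_integral_point_measure_finite) (auto simp: mult.commute)
  also have "\<dots> = (\<Sum>a<2 ^ w. ennreal (measure ?S {\<omega> \<in> space ?S. Q a \<omega>} / 2 ^ w))"
    by (intro sum.cong refl) (simp add: S.emeasure_eq_measure ennreal_mult' [symmetric])
  also have "\<dots> = ennreal (\<Sum>a<2 ^ w. measure ?S {\<omega> \<in> space ?S. Q a \<omega>} / 2 ^ w)"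
    by (rule sum_ennreal) auto
  finally show "?L = ?R"
    by (simp add: S.emeasure_eq_measure sum_nonneg sum_divide_distrib)
qed

section \<open>Independent random choices from lists of colors\<close>

lemma sum_PiE_insert:
  fixes f :: "('a \<Rightarrow> 'b) \<Rightarrow> 'c::comm_monoid_add"
  assumes "x \<notin> X"
  shows "(\<Sum>\<tau>\<in>Pi\<^sub>E (insert x X) T. f \<tau>) = (\<Sum>y\<in>T x. \<Sum>\<tau>\<in>Pi\<^sub>E X T. f (\<tau>(x := y)))"
  using inj_combinator[OF assms, of T]
  by (simp add: PiE_insert_eq sum.reindex sum.cartesian_product case_prod_unfold)

text \<open>The probability that no vertex of \<open>X\<close> takes \<open>c\<close> when each
  \<open>w\<close> chooses uniformly from \<open>L w\<close> and one extra value for blank; the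
  extra value causes the \<open>+ 1\<close> in the denominator.\<close>

definition survival :: "'a set \<Rightarrow> ('a \<Rightarrow> 'b set) \<Rightarrow> 'b \<Rightarrow> real" where
  "survival X L c = (\<Prod>w\<in>{w\<in>X. c \<in> L w}. real (card (L w)) / (real (card (L w)) + 1))"

lemma survival_bounds: "0 \<le> survival X L c" "survival X L c \<le> 1"
  unfolding survival_def by (auto intro!: prod_nonneg prod_le_1)

lemma survival_insert:
  assumes "finite X" "x \<notin> X"
  shows "survival (insert x X) L c =
    (if c \<in> L x then real (card (L x)) / (real (card (L x)) + 1) else 1) * survival X L c"
proof -
  have "{w \<in> insert x X. c \<in> L w} = (if c \<in> L x then insert x {w\<in>X. c \<in> L w} else {w\<in>X. c \<in> L w})"
    by auto
  then show ?thesis using assms by (simp add: survival_def)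
qed

lemma one_plus_sum_le_prod:
  fixes x :: "'a \<Rightarrow> real"
  assumes "finite S" "\<And>i. i \<in> S \<Longrightarrow> 0 \<le> x i"
  shows "1 + (\<Sum>i\<in>S. x i) \<le> (\<Prod>i\<in>S. 1 + x i)"
  using assms
proof (induction S rule: finite_induct)
  case (insert i S)
  have nn: "0 \<le> sum x S" using insert by (intro sum_nonneg) auto
  have "1 + sum x (insert i S) \<le> (1 + x i) * (1 + sum x S)"
    using insert nn by (simp add: algebra_simps)
  also have "\<dots> \<le> (1 + x i) * (\<Prod>i\<in>S. 1 + x i)"
    using insert by (intro mult_left_mono) auto
  finally show ?case using insert by simp
qed simp

text \<open>Negative correlation as a generating function: the mean of \<open>(1 / 2) ^ k\<close>,
  with \<open>k\<close> the number of untaken colors of \<open>S\<close>, is at most what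
  independence of the colors would give. \<open>S\<close> is arbitrary in the induction, since the
  choice of a new vertex removes its color from the set to be considered for the others.\<close>

lemma sum_half_power_untaken_le:
  fixes L :: "'a \<Rightarrow> 'b set"
  assumes "finite X" "finite S" and L: "\<And>w. w \<in> X \<Longrightarrow> finite (L w) \<and> b \<notin> L w" and "b \<notin> S"
  shows "(\<Sum>\<tau>\<in>Pi\<^sub>E X (\<lambda>w. insert b (L w)). (1 / 2 :: real) ^ card (S - \<tau> ` X))
    \<le> (\<Prod>w\<in>X. real (card (L w)) + 1) * (\<Prod>c\<in>S. 1 - survival X L c / 2)"
  using assms(1,2,3,4)
proof (induction X arbitrary: S rule: finite_induct)
  case empty
  have "(\<Prod>c\<in>S. 1 - survival {} L c / 2) = (1/2) ^ card S"
    by (simp add: survival_def)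
  then show ?case by simp
next
  case (insert x X)
  define m where "m = real (card (L x))"
  define h where "h c = 1 - survival X L c / 2" for c
  define P where "P = (\<Prod>w\<in>X. real (card (L w)) + 1)"
  define T where "T = (\<lambda>w. insert b (L w))"
  have fin: "finite (L x)" "b \<notin> L x" using insert.prems by auto
  have h: "1/2 \<le> h c" "h c \<le> 1" for c
    using survival_bounds[of X L c] by (auto simp: h_def)
  have h0: "0 < h c" "h c \<noteq> 0" for c using h(1)[of c] by auto
  have P: "0 \<le> P" by (auto simp: P_def intro!: prod_nonneg)
  have IH: "(\<Sum>\<tau>\<in>Pi\<^sub>E X T. (1 / 2 :: real) ^ card (S' - \<tau> ` X)) \<le> P * prod h S'"
    if "finite S'" "b \<notin> S'" for S'
    using insert.IH[of S'] insert.prems that by (simp add: P_def h_def T_def)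
  have "(\<Sum>\<tau>\<in>Pi\<^sub>E (insert x X) T. (1 / 2 :: real) ^ card (S - \<tau> ` insert x X)) =
      (\<Sum>y\<in>T x. \<Sum>\<tau>\<in>Pi\<^sub>E X T. (1 / 2) ^ card (S - (\<tau>(x := y)) ` insert x X))"
    using insert.hyps by (simp add: sum_PiE_insert)
  also have "\<dots> = (\<Sum>y\<in>T x. \<Sum>\<tau>\<in>Pi\<^sub>E X T. (1 / 2) ^ card ((S - {y}) - \<tau> ` X))"
  proof (intro sum.cong refl)
    fix y \<tau>
    have "S - (\<tau>(x := y)) ` insert x X = (S - {y}) - \<tau> ` X"
      using insert.hyps by auto
    then show "(1 / 2 :: real) ^ card (S - (\<tau>(x := y)) ` insert x X) = (1 / 2) ^ card ((S - {y}) - \<tau> ` X)"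
      by simp
  qed
  also have "\<dots> \<le> (\<Sum>y\<in>T x. P * prod h (S - {y}))"
    using insert.prems by (intro sum_mono IH) auto
  also have "\<dots> = (\<Sum>y\<in>T x. P * prod h S * (if y \<in> S then 1 / h y else 1))"
  proof (intro sum.cong refl)
    fix y
    show "P * prod h (S - {y}) = P * prod h S * (if y \<in> S then 1 / h y else 1)"
      using insert.prems h0 by (auto simp: prod_diff1)
  qed
  also have "\<dots> = P * prod h S * (\<Sum>y\<in>T x. 1 + (if y \<in> S then 1 / h y - 1 else 0))"
    unfolding sum_distrib_left by (intro sum.cong) auto
  also have "(\<Sum>y\<in>T x. 1 + (if y \<in> S then 1 / h y - 1 else 0)) = m + 1 + (\<Sum>y\<in>L x \<inter> S. 1 / h y - 1)"
    using fin insert.prems by (simp add: T_def sum.distrib m_def sum.inter_restrict)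
  also have "P * prod h S * (m + 1 + (\<Sum>y\<in>L x \<inter> S. 1 / h y - 1)) =
      P * (m + 1) * prod h S * (1 + (\<Sum>y\<in>L x \<inter> S. (1 / h y - 1) / (m + 1)))"
    unfolding sum_divide_distrib[symmetric] by (simp add: field_simps m_def add_nonneg_eq_0_iff)
  \<comment> \<open>The sum over the choices of \<open>x\<close> is relaxed to a product over
    colors; this is the only loss, and it is where correlation turns into independence.\<close>
  also have "\<dots> \<le> P * (m + 1) * prod h S * (\<Prod>y\<in>L x \<inter> S. 1 + (1 / h y - 1) / (m + 1))"
  proof (intro mult_left_mono one_plus_sum_le_prod)
    show "0 \<le> (1 / h i - 1) / (m + 1)" for i
      using h(1)[of i] h(2)[of i] h0(1)[of i] by (auto simp: m_def field_simps)
    show "0 \<le> P * (m + 1) * prod h S"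
      using P h0 by (auto simp: m_def less_imp_le intro!: mult_nonneg_nonneg prod_nonneg)
  qed (use fin in auto)
  also have "\<dots> = P * (m + 1) * (\<Prod>c\<in>S. h c * (if c \<in> L x then 1 + (1 / h c - 1) / (m + 1) else 1))"
    using insert.prems by (simp add: prod.distrib prod.inter_restrict Int_commute)
  also have "(\<Prod>c\<in>S. h c * (if c \<in> L x then 1 + (1 / h c - 1) / (m + 1) else 1)) =
      (\<Prod>c\<in>S. 1 - survival (insert x X) L c / 2)"
  proof (intro prod.cong refl)
    fix c
    have m: "m + 1 > 0" by (simp add: m_def)
    \<comment> \<open>Merging each new factor with its \<open>h c\<close> gives exactly the factor
      for \<open>insert x X\<close>, so the bound reproduces itself.\<close>
    have "h c * (1 + (1 / h c - 1) / (m + 1)) = h c + (1 - h c) / (m + 1)"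
    proof -
      have "h c * (1 / h c - 1) = 1 - h c" using h0[of c] by (simp add: right_diff_distrib)
      then show ?thesis by (simp add: distrib_left)
    qed
    also have "\<dots> = 1 - (m / (m + 1)) * survival X L c / 2"
      using m by (simp add: h_def field_simps)
    finally show "h c * (if c \<in> L x then 1 + (1 / h c - 1) / (m + 1) else 1) =
      1 - survival (insert x X) L c / 2"
      using insert.hyps by (simp add: survival_insert m_def h_def)
  qed
  also have "P * (m + 1) = (\<Prod>w\<in>insert x X. real (card (L w)) + 1)"
    using insert.hyps by (simp add: P_def m_def)
  finally show ?case by (simp add: T_def)
qed

text \<open>\<open>m / (m + 1)\<close> is the inverse of \<open>1 + 1 / m\<close>, which is at most
  \<open>exp (1 / m)\<close>.\<close>

lemma survival_ge:
  assumes "finite X" "\<And>w. w \<in> X \<Longrightarrow> finite (L w)"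
  shows "exp (- (\<Sum>w\<in>{w\<in>X. c \<in> L w}. 1 / real (card (L w)))) \<le> survival X L c"
proof -
  have "exp (- (\<Sum>w\<in>{w\<in>X. c \<in> L w}. 1 / real (card (L w)))) =
      (\<Prod>w\<in>{w\<in>X. c \<in> L w}. exp (- (1 / real (card (L w)))))"
    using assms by (simp add: exp_sum sum_negf[symmetric])
  also have "\<dots> \<le> survival X L c"
    unfolding survival_def
  proof (intro prod_mono conjI)
    fix w assume w: "w \<in> {w\<in>X. c \<in> L w}"
    then have m: "real (card (L w)) > 0" using assms by (auto simp: card_gt_0_iff)
    have "1 + 1 / real (card (L w)) \<le> exp (1 / real (card (L w)))"
      by (rule exp_ge_add_one_self)
    then show "exp (- (1 / real (card (L w)))) \<le> real (card (L w)) / (real (card (L w)) + 1)"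
      using m by (simp add: exp_minus field_simps)
  qed auto
  finally show ?thesis .
qed

text \<open>Jensen's inequality for the exponential. Double counting shows that the exponents
  \<open>a c\<close> sum to at most \<open>d\<close>, since each vertex spreads a total weight of at
  most 1 over its list. Their mean is at most \<open>m\<close>, and the tangent of
  \<open>exp (- t)\<close> at \<open>m\<close> is the lower bound needed.\<close>

lemma sum_survival_ge:
  assumes "finite X" "finite C" "C \<noteq> {}" and L: "\<And>w. w \<in> X \<Longrightarrow> L w \<subseteq> C" and d: "real (card X) \<le> d"
  shows "real (card C) * exp (- d / real (card C)) \<le> (\<Sum>c\<in>C. survival X L c)"
proof -
  define a where "a c = (\<Sum>w\<in>{w\<in>X. c \<in> L w}. 1 / real (card (L w)))" for c
  define m where "m = d / real (card C)"
  have q: "real (card C) > 0" using assms by (auto simp: card_gt_0_iff)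
  have "(\<Sum>c\<in>C. a c) = (\<Sum>w\<in>X. \<Sum>c\<in>{c\<in>C. c \<in> L w}. 1 / real (card (L w)))"
    unfolding a_def by (rule sum.swap_restrict) (use assms in auto)
  also have "\<dots> \<le> (\<Sum>w\<in>X. 1)"
  proof (rule sum_mono)
    fix w assume "w \<in> X"
    then have "{c\<in>C. c \<in> L w} = L w" using L by auto
    then show "(\<Sum>c\<in>{c\<in>C. c \<in> L w}. 1 / real (card (L w))) \<le> 1" by simp
  qed
  finally have sa: "(\<Sum>c\<in>C. a c) \<le> d" using d by simp
  have "real (card C) * exp (- m) \<le> exp (- m) * (real (card C) + (real (card C) * m - (\<Sum>c\<in>C. a c)))"
    using sa q by (simp add: m_def algebra_simps)
  also have "\<dots> = (\<Sum>c\<in>C. exp (- m) * (1 + (m - a c)))"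
    by (simp add: sum_distrib_left[symmetric] sum.distrib sum_subtractf)
  also have "\<dots> \<le> (\<Sum>c\<in>C. exp (- a c))"
  proof (rule sum_mono)
    fix c
    have "exp (- m) * (1 + (m - a c)) \<le> exp (- m) * exp (m - a c)"
      by (intro mult_left_mono exp_ge_add_one_self) auto
    then show "exp (- m) * (1 + (m - a c)) \<le> exp (- a c)"
      by (simp add: exp_add[symmetric])
  qed
  also have "\<dots> \<le> (\<Sum>c\<in>C. survival X L c)"
    unfolding a_def using assms(1) finite_subset[OF L assms(2)] by (intro sum_mono survival_ge) auto
  finally show ?thesis by (simp add: m_def)
qed

text \<open>Markov's inequality for the generating function at 1/2. Counts replace probabilities;
  the product of the \<open>card (L w) + 1\<close> is the number of all choices.\<close>

lemma card_few_untaken_le: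
  assumes "finite X" "finite C" "C \<noteq> {}" and L: "\<And>w. w \<in> X \<Longrightarrow> L w \<subseteq> C" and "b \<notin> C"
    and d: "real (card X) \<le> d"
  shows "real (card {\<tau> \<in> Pi\<^sub>E X (\<lambda>w. insert b (L w)). card (C - \<tau> ` X) < l}) \<le>
    2 ^ l * exp (- (real (card C) * exp (- d / real (card C))) / 2) * (\<Prod>w\<in>X. real (card (L w)) + 1)"
proof -
  let ?T = "Pi\<^sub>E X (\<lambda>w. insert b (L w))"
  let ?P = "\<Prod>w\<in>X. real (card (L w)) + 1"
  have fL: "finite (L w)" if "w \<in> X" for w by (rule finite_subset[OF L[OF that] assms(2)])
  have fT: "finite ?T" using assms fL by (intro finite_PiE) auto
  have P: "0 \<le> ?P" by (auto intro!: prod_nonneg)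
  have "real (card {\<tau> \<in> ?T. card (C - \<tau> ` X) < l}) = (\<Sum>\<tau>\<in>{\<tau> \<in> ?T. card (C - \<tau> ` X) < l}. 1)"
    by simp
  also have "\<dots> \<le> (\<Sum>\<tau>\<in>{\<tau> \<in> ?T. card (C - \<tau> ` X) < l}. 2 ^ l * (1 / 2) ^ card (C - \<tau> ` X))"
  proof (rule sum_mono)
    fix \<tau> assume "\<tau> \<in> {\<tau> \<in> ?T. card (C - \<tau> ` X) < l}"
    then have "(2::real) ^ card (C - \<tau> ` X) \<le> 2 ^ l" by (intro power_increasing) auto
    then show "(1::real) \<le> 2 ^ l * (1 / 2) ^ card (C - \<tau> ` X)"
      by (simp add: power_one_over field_simps)
  qed
  also have "\<dots> \<le> (\<Sum>\<tau>\<in>?T. 2 ^ l * (1 / 2) ^ card (C - \<tau> ` X))"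
    using fT by (intro sum_mono2) auto
  also have "\<dots> \<le> 2 ^ l * (?P * (\<Prod>c\<in>C. 1 - survival X L c / 2))"
    unfolding sum_distrib_left[symmetric] using assms fL
    by (intro mult_left_mono sum_half_power_untaken_le) auto
  finally have A: "real (card {\<tau> \<in> ?T. card (C - \<tau> ` X) < l}) \<le> 2 ^ l * (?P * (\<Prod>c\<in>C. 1 - survival X L c / 2))" .
  have "(\<Prod>c\<in>C. 1 - survival X L c / 2) \<le> (\<Prod>c\<in>C. exp (- (survival X L c / 2)))"
  proof (intro prod_mono conjI)
    fix c
    show "0 \<le> 1 - survival X L c / 2" using survival_bounds[of X L c] by auto
    show "1 - survival X L c / 2 \<le> exp (- (survival X L c / 2))"
      using exp_ge_add_one_self[of "- (survival X L c / 2)"] by simp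
  qed
  also have "\<dots> = exp (- (\<Sum>c\<in>C. survival X L c) / 2)"
    using assms by (simp add: exp_sum[symmetric] sum_negf sum_divide_distrib)
  also have "\<dots> \<le> exp (- (real (card C) * exp (- d / real (card C))) / 2)"
    using sum_survival_ge[OF assms(1-4) d] by simp
  finally have "2 ^ l * (?P * (\<Prod>c\<in>C. 1 - survival X L c / 2)) \<le>
      2 ^ l * (?P * exp (- (real (card C) * exp (- d / real (card C))) / 2))"
    using P by (intro mult_left_mono) auto
  from order_trans[OF A this] show ?thesis by (simp only: mult_ac)
qed

text \<open>Markov's inequality for 2 to the number of blank vertices with long lists. The choices
  are independent, so the mean factorizes. A long list contributes a factor of at most
  \<open>1 + 1 / (l + 1)\<close>; a short one could contribute up to 2 and has to be left
  out.\<close>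

lemma card_many_blank_le:
  assumes "finite X" and L: "\<And>w. w \<in> X \<Longrightarrow> finite (L w) \<and> b \<notin> L w" and d: "card X \<le> d"
  shows "real (card {\<tau> \<in> Pi\<^sub>E X (\<lambda>w. insert b (L w)). k \<le> card {w\<in>X. \<tau> w = b \<and> l \<le> card (L w)}}) \<le>
    (1 / 2) ^ k * exp (real d / (real l + 1)) * (\<Prod>w\<in>X. real (card (L w)) + 1)"
proof -
  let ?T = "Pi\<^sub>E X (\<lambda>w. insert b (L w))"
  let ?P = "\<Prod>w\<in>X. real (card (L w)) + 1"
  let ?n = "\<lambda>\<tau>. card {w\<in>X. \<tau> w = b \<and> l \<le> card (L w)}"
  have fT: "finite ?T" using assms by (intro finite_PiE) auto
  have P: "0 \<le> ?P" by (auto intro!: prod_nonneg)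
  have "real (card {\<tau> \<in> ?T. k \<le> ?n \<tau>}) = (\<Sum>\<tau>\<in>{\<tau> \<in> ?T. k \<le> ?n \<tau>}. 1)"
    by simp
  also have "\<dots> \<le> (\<Sum>\<tau>\<in>{\<tau> \<in> ?T. k \<le> ?n \<tau>}. (1 / 2) ^ k * 2 ^ ?n \<tau>)"
  proof (rule sum_mono)
    fix \<tau> assume "\<tau> \<in> {\<tau> \<in> ?T. k \<le> ?n \<tau>}"
    then have "(2::real) ^ k \<le> 2 ^ ?n \<tau>" by (intro power_increasing) auto
    then show "(1::real) \<le> (1 / 2) ^ k * 2 ^ ?n \<tau>"
      by (simp add: power_one_over field_simps)
  qed
  also have "\<dots> \<le> (\<Sum>\<tau>\<in>?T. (1 / 2) ^ k * 2 ^ ?n \<tau>)"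
    using fT by (intro sum_mono2) auto
  also have "\<dots> = (1 / 2) ^ k * (\<Sum>\<tau>\<in>?T. \<Prod>w\<in>X. if \<tau> w = b \<and> l \<le> card (L w) then 2 else 1)"
    unfolding sum_distrib_left[symmetric] using assms(1)
    by (simp add: prod.If_cases Int_def conj_commute)
  also have "(\<Sum>\<tau>\<in>?T. \<Prod>w\<in>X. if \<tau> w = b \<and> l \<le> card (L w) then 2 else (1::real)) =
      (\<Prod>w\<in>X. \<Sum>y\<in>insert b (L w). if y = b \<and> l \<le> card (L w) then 2 else (1::real))"
    using assms by (intro prod_sum_PiE[symmetric]) auto
  also have "\<dots> \<le> (\<Prod>w\<in>X. (real (card (L w)) + 1) * exp (1 / (real l + 1)))"
  proof (intro prod_mono conjI)
    fix w assume w: "w \<in> X"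
    have "(\<Sum>y\<in>insert b (L w). if y = b \<and> l \<le> card (L w) then 2 else (1::real)) =
      (if l \<le> card (L w) then 2 else 1) + (\<Sum>y\<in>L w. 1)"
    proof -
      have "(\<Sum>y\<in>L w. if y = b \<and> l \<le> card (L w) then 2 else (1::real)) = (\<Sum>y\<in>L w. 1)"
        using L[OF w] by (intro sum.cong) auto
      then show ?thesis using L[OF w] by (subst sum.insert) auto
    qed
    also have "\<dots> \<le> (real (card (L w)) + 1) * (1 + 1 / (real l + 1))"
      by (auto simp: field_simps)
    also have "\<dots> \<le> (real (card (L w)) + 1) * exp (1 / (real l + 1))"
      by (intro mult_left_mono exp_ge_add_one_self) auto
    finally show "(\<Sum>y\<in>insert b (L w). if y = b \<and> l \<le> card (L w) then 2 else (1::real)) \<le>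
      (real (card (L w)) + 1) * exp (1 / (real l + 1))" .
  qed (auto intro!: sum_nonneg)
  also have "\<dots> = ?P * exp (real (card X) / (real l + 1))"
    by (simp add: prod.distrib exp_of_nat_mult[symmetric])
  also have "\<dots> \<le> ?P * exp (real d / (real l + 1))"
    using P d by (intro mult_left_mono) (auto simp: divide_right_mono)
  finally show ?thesis by (simp add: mult_left_mono mult.assoc mult.left_commute mult.commute)
qed

section \<open>The recoloring process\<close>

text \<open>Residues of a uniform word are in general not exactly uniform. The excess of 1 here
  becomes the term \<open>1 / 2 ^ w\<close> in the transition probabilities.\<close>

lemma card_mod_eq_le:
  fixes m :: nat assumes "0 < m"
  shows "card {a \<in> {..<N}. a mod m = j} \<le> N div m + 1"
proof -
  have "inj_on (\<lambda>a. a div m) {a \<in> {..<N}. a mod m = j}"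
  proof (rule inj_onI)
    fix a b assume "a \<in> {a \<in> {..<N}. a mod m = j}" "b \<in> {a \<in> {..<N}. a mod m = j}" "a div m = b div m"
    then show "a = b" using div_mult_mod_eq[of a m] div_mult_mod_eq[of b m] by simp
  qed
  moreover have "(\<lambda>a. a div m) ` {a \<in> {..<N}. a mod m = j} \<subseteq> {..N div m}"
    by (auto intro!: div_le_mono)
  ultimately have "card {a \<in> {..<N}. a mod m = j} \<le> card {..N div m}"
    by (intro card_inj_on_le) auto
  then show ?thesis by simp
qed

section \<open>Abstract model of the algorithm\<close>

type_synonym adjacency = "nat \<Rightarrow> nat list"

text \<open>Deletion from an array in place: the last entry fills the gap, then the array is
  shortened.\<close>

definition remove_swap :: "nat \<Rightarrow> nat list \<Rightarrow> nat list" where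
  "remove_swap v xs = butlast (map (\<lambda>y. if y = v then last xs else y) xs)"

fun update_adj :: "update \<Rightarrow> adjacency \<Rightarrow> adjacency" where
  "update_adj (Insert u v) A = A(u := A u @ [v], v := A v @ [u])"
| "update_adj (Delete u v) A = A(u := remove_swap v (A u), v := remove_swap u (A v))"

text \<open>The first endpoint is queued even without a conflict. The analysis forgets secondary
  colors and cannot see whether two blank endpoints clash; the worklist must not depend on
  that.\<close>

fun update_work :: "update \<Rightarrow> nat list" where
  "update_work (Insert u v) = [u]"
| "update_work (Delete u v) = []"

fun endpoints_ok :: "nat \<Rightarrow> update \<Rightarrow> bool" where
  "endpoints_ok n (Insert u v) \<longleftrightarrow> u \<noteq> v \<and> u \<in> {1..n} \<and> v \<in> {1..n}"
| "endpoints_ok n (Delete u v) \<longleftrightarrow> u \<noteq> v \<and> u \<in> {1..n} \<and> v \<in> {1..n}"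

definition push :: "nat \<Rightarrow> nat list \<Rightarrow> nat list" where
  "push v W = (if v \<in> set W then W else v # W)"

text \<open>The index just past the list stands for the default, so that a uniform index below
  \<open>Suc (length xs)\<close> chooses the default with the same weight as each entry.\<close>

definition pick :: "nat \<Rightarrow> nat list \<Rightarrow> nat \<Rightarrow> nat" where
  "pick d xs j = (if j < length xs then xs ! j else d)"

lemma length_fold_push: "length (fold push xs W) \<le> length W + length xs"
proof (induction xs arbitrary: W)
  case (Cons x xs)
  show ?case using Cons[of "push x W"] by (simp add: push_def split: if_splits)
qed simp

lemma set_fold_push: "set (fold push xs W) = set xs \<union> set W"
  by (induction xs arbitrary: W) (auto simp: push_def)

lemma distinct_fold_push: "distinct W \<Longrightarrow> distinct (fold push xs W)"
  by (induction xs arbitrary: W) (auto simp: push_def)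

lemma bij_betw_pick:
  assumes "distinct xs" "d \<notin> set xs"
  shows "bij_betw (pick d xs) {..<Suc (length xs)} (insert d (set xs))"
  unfolding bij_betw_def
proof
  show "inj_on (pick d xs) {..<Suc (length xs)}"
  proof (rule inj_onI)
    fix i j assume "i \<in> {..<Suc (length xs)}" "j \<in> {..<Suc (length xs)}" "pick d xs i = pick d xs j"
    moreover have "xs ! i \<noteq> d" if "i < length xs" for i using that assms nth_mem by metis
    ultimately show "i = j"
      using nth_eq_iff_index_eq[OF assms(1), of i j]
      by (cases "i < length xs"; cases "j < length xs") (auto simp: pick_def)
  qed
  show "pick d xs ` {..<Suc (length xs)} = insert d (set xs)"
  proof (intro equalityI subsetI)
    fix y assume "y \<in> insert d (set xs)"
    then consider "y = d" | i where "i < length xs" "y = xs ! i" by (auto simp: in_set_conv_nth)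
    then show "y \<in> pick d xs ` {..<Suc (length xs)}"
    proof cases
      case 1
      then show ?thesis by (intro image_eqI[of _ _ "length xs"]) (auto simp: pick_def)
    next
      case 2
      then show ?thesis by (intro image_eqI[of _ _ i]) (auto simp: pick_def)
    qed
  qed (auto simp: pick_def)
qed

locale recolor =
  fixes n \<Delta> q r l w :: nat
begin

text \<open>
  Colors above \<open>r\<close> are primary.  The value \<open>r\<close> marks a blank vertex that has no color yet; colors
  below \<open>r\<close> form the secondary palette, used for blank vertices only.
\<close>

definition avail :: "adjacency \<Rightarrow> (nat \<Rightarrow> nat) \<Rightarrow> nat \<Rightarrow> nat list" where
  "avail A \<sigma> v = filter (\<lambda>c. c \<notin> \<sigma> ` set (A v)) (rev [Suc r..<Suc r + q])"

fun resample :: "adjacency \<Rightarrow> (nat \<Rightarrow> nat) \<Rightarrow> (nat \<Rightarrow> nat) \<Rightarrow> nat list \<Rightarrow> nat \<Rightarrow> nat" where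
  "resample A \<sigma> \<omega> [] = \<sigma>"
| "resample A \<sigma> \<omega> (v # vs) =
     resample A (\<sigma>(v := pick r (avail A \<sigma> v) (\<omega> 0 mod Suc (length (avail A \<sigma> v)))))
       (\<lambda>i. \<omega> (Suc i)) vs"

definition blank_deg :: "adjacency \<Rightarrow> (nat \<Rightarrow> nat) \<Rightarrow> nat \<Rightarrow> nat" where
  "blank_deg A \<sigma> v = length (filter (\<lambda>y. \<sigma> y \<le> r) (A v))"

definition settled :: "adjacency \<Rightarrow> (nat \<Rightarrow> nat) \<Rightarrow> nat \<Rightarrow> bool" where
  "settled A \<sigma> v \<longleftrightarrow> r < \<sigma> v \<or> blank_deg A \<sigma> v < r"

text \<open>Depends only on the colors in the neighborhood of \<open>x\<close> and on the lists
  there. In a triangle-free graph those lists are determined by colors outside the neighborhood, so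
  given the outside this is an event about independent choices.\<close>

definition flawed :: "adjacency \<Rightarrow> (nat \<Rightarrow> nat) \<Rightarrow> nat \<Rightarrow> bool" where
  "flawed A \<sigma> x \<longleftrightarrow> length (avail A \<sigma> x) < l \<or>
     r \<le> length (filter (\<lambda>y. \<sigma> y \<le> r \<and> l \<le> length (avail A \<sigma> y)) (A x))"

definition culprit :: "adjacency \<Rightarrow> (nat \<Rightarrow> nat) \<Rightarrow> nat \<Rightarrow> nat" where
  "culprit A \<sigma> v = (case filter (\<lambda>y. length (avail A \<sigma> y) < l) (A v) of [] \<Rightarrow> v | x # xs \<Rightarrow> x)"

fun update_col :: "update \<Rightarrow> (nat \<Rightarrow> nat) \<Rightarrow> nat \<Rightarrow> nat" where
  "update_col (Insert u v) \<sigma> = (if \<sigma> u = \<sigma> v then \<sigma>(u := r) else \<sigma>)"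
| "update_col (Delete u v) \<sigma> = \<sigma>"

text \<open>
  \<open>reach s us A \<sigma> W \<omega>\<close>: at least \<open>s\<close> resamplings happen when the worklist \<open>W\<close> and then the
  updates \<open>us\<close> are processed with random words \<open>\<omega>\<close>.
\<close>

function reach :: "nat \<Rightarrow> update list \<Rightarrow> adjacency \<Rightarrow> (nat \<Rightarrow> nat) \<Rightarrow> nat list \<Rightarrow> (nat \<Rightarrow> nat) \<Rightarrow> bool" where
  "reach 0 us A \<sigma> W \<omega> = True"
| "reach (Suc s) [] A \<sigma> [] \<omega> = False"
| "reach (Suc s) (u # us) A \<sigma> [] \<omega> =
     reach (Suc s) us (update_adj u A) (update_col u \<sigma>) (update_work u) \<omega>"
| "reach (Suc s) us A \<sigma> (v # W) \<omega> =
     (if settled A \<sigma> v then reach (Suc s) us A \<sigma> W \<omega>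
      else reach s us A (resample A \<sigma> \<omega> (rev (A (culprit A \<sigma> v))))
        (fold push (rev (A (culprit A \<sigma> v))) (v # W)) (\<lambda>i. \<omega> (i + length (A (culprit A \<sigma> v)))))"
  by pat_completeness auto
text \<open>Only a recoloring can enlarge the worklist within an update, and it lowers
  \<open>s\<close>; every other rule consumes an update or a worklist entry.\<close>

termination
  by (relation "inv_image (less_than <*lex*> less_than <*lex*> less_than)
      (\<lambda>(s, us, A, \<sigma>, W, \<omega>). (s, length us, length W))") auto

text \<open>Absence of triangles appears as disjointness of the neighborhoods of adjacent vertices,
  the form in which it shows that recoloring a neighborhood leaves the lists there
  unchanged.\<close>

definition valid_adj :: "adjacency \<Rightarrow> bool" where
  "valid_adj A \<longleftrightarrow> (\<forall>v\<in>{1..n}. set (A v) \<subseteq> {1..n} \<and> distinct (A v) \<and> length (A v) \<le> \<Delta> \<and>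
     v \<notin> set (A v) \<and> (\<forall>u\<in>set (A v). v \<in> set (A u) \<and> set (A u) \<inter> set (A v) = {}))"

fun valid_adjs :: "adjacency \<Rightarrow> update list \<Rightarrow> bool" where
  "valid_adjs A [] \<longleftrightarrow> valid_adj A"
| "valid_adjs A (u # us) \<longleftrightarrow> valid_adj A \<and> endpoints_ok n u \<and> valid_adjs (update_adj u A) us"

text \<open>The states of the analysis. Secondary colors do not occur: \<open>r\<close> stands for
  every blank vertex, and only blank vertices may agree with a neighbor.\<close>

definition colorings :: "adjacency \<Rightarrow> (nat \<Rightarrow> nat) set" where
  "colorings A = {\<sigma> \<in> {1..n} \<rightarrow>\<^sub>E {r..r + q}. \<forall>v\<in>{1..n}. \<forall>y\<in>set (A v). \<sigma> v \<noteq> \<sigma> y \<or> \<sigma> v = r}"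

definition prob_of :: "((nat \<Rightarrow> nat) \<Rightarrow> bool) \<Rightarrow> real" where
  "prob_of B = measure (random_words w) {\<omega> \<in> space (random_words w). B \<omega>}"

text \<open>The two tail estimates, per choice: too few untaken colors at \<open>x\<close>, and too
  many blank neighbors with long lists.\<close>

definition flaw_bound :: real where
  "flaw_bound = 2 ^ l * exp (- (real q * exp (- real \<Delta> / real q)) / 2) +
     (1 / 2) ^ r * exp (real \<Delta> / (real l + 1))"

lemma valid_adjs_imp: "valid_adjs A us \<Longrightarrow> valid_adj A"
  by (cases us) auto

lemma avail_facts:
  "distinct (avail A \<sigma> v)" "r \<notin> set (avail A \<sigma> v)" "set (avail A \<sigma> v) \<subseteq> {Suc r..<Suc r + q}"
  "length (avail A \<sigma> v) \<le> q"
proof -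
  show "length (avail A \<sigma> v) \<le> q"
    unfolding avail_def by (rule order_trans[OF length_filter_le]) simp
qed (auto simp: avail_def)

lemma set_avail: "set (avail A \<sigma> v) = {Suc r..<Suc r + q} - \<sigma> ` set (A v)"
  by (auto simp: avail_def)

lemma length_avail: "length (avail A \<sigma> v) = card (set (avail A \<sigma> v))"
  using avail_facts(1) by (simp add: distinct_card)

lemma avail_cong: "(\<And>y. y \<in> set (A v) \<Longrightarrow> \<sigma> y = \<tau> y) \<Longrightarrow> avail A \<sigma> v = avail A \<tau> v"
  unfolding avail_def by (intro filter_cong) (auto simp: image_iff)

lemma prob_of_nonneg [simp]: "0 \<le> prob_of B"
  by (simp add: prob_of_def)

lemma prob_of_le_1: "prob_of B \<le> 1"
proof -
  interpret prob_space "random_words w"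
    unfolding random_words_def
    by (intro prob_space_PiM prob_space_uniform_count_measure) (auto simp: lessThan_empty_iff)
  show ?thesis by (simp add: prob_of_def)
qed

section \<open>Measurability of the event that many recolorings happen\<close>

lemma pred_resample:
  assumes "\<And>\<tau>. Measurable.pred (random_words w) (B \<tau>)"
  shows "Measurable.pred (random_words w)
    (\<lambda>\<omega>. B (resample A \<sigma> \<omega> vs) (\<lambda>i. \<omega> (i + length vs)))"
proof (induction vs arbitrary: \<sigma>)
  case Nil
  then show ?case using assms by simp
next
  case (Cons v vs)
  have "Measurable.pred (random_words w)
     (\<lambda>\<omega>. (\<lambda>a \<omega>. B (resample A (\<sigma>(v := pick r (avail A \<sigma> v) (a mod Suc (length (avail A \<sigma> v))))) \<omega> vs)
        (\<lambda>i. \<omega> (i + length vs))) (\<omega> 0) (\<lambda>i. \<omega> (Suc i)))"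
    by (rule pred_random_words_first) (rule Cons.IH)
  then show ?case by simp
qed

lemma pred_reach_step:
  assumes "Measurable.pred (random_words w) (reach (Suc s) us A \<sigma> W)"
    and "\<And>\<tau> W'. Measurable.pred (random_words w) (reach s us A \<tau> W')"
  shows "Measurable.pred (random_words w) (reach (Suc s) us A \<sigma> (v # W))"
proof (cases "settled A \<sigma> v")
  case True
  then have "reach (Suc s) us A \<sigma> (v # W) = reach (Suc s) us A \<sigma> W" by (simp add: fun_eq_iff)
  then show ?thesis using assms(1) by simp
next
  case False
  let ?vs = "rev (A (culprit A \<sigma> v))"
  have "reach (Suc s) us A \<sigma> (v # W) =
    (\<lambda>\<omega>. (\<lambda>\<tau>. reach s us A \<tau> (fold push ?vs (v # W))) (resample A \<sigma> \<omega> ?vs) (\<lambda>i. \<omega> (i + length ?vs)))"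
    using False by (simp add: fun_eq_iff)
  also have "Measurable.pred (random_words w) \<dots>"
    by (rule pred_resample) (rule assms(2))
  finally show ?thesis .
qed

lemma pred_reach: "Measurable.pred (random_words w) (reach s us A \<sigma> W)"
proof (induction s arbitrary: us A \<sigma> W)
  case 0
  have "reach 0 us A \<sigma> W = (\<lambda>_. True)" by (simp add: fun_eq_iff)
  then show ?case by simp
next
  case (Suc s)
  show ?case
  proof (induction us arbitrary: A \<sigma> W)
    case Nil
    show ?case
    proof (induction W)
      case Nil
      have "reach (Suc s) [] A \<sigma> [] = (\<lambda>_. False)" by (simp add: fun_eq_iff)
      then show ?case by simp
    next
      case (Cons v W)
      then show ?case using pred_reach_step[OF Cons.IH Suc.IH] by blast
    qed
  next
    case (Cons u us)
    note IHu = Cons.IH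
    show ?case
    proof (induction W)
      case Nil
      have "reach (Suc s) (u # us) A \<sigma> [] = reach (Suc s) us (update_adj u A) (update_col u \<sigma>) (update_work u)"
        by (simp add: fun_eq_iff)
      then show ?case using IHu by simp
    next
      case (Cons v W)
      then show ?case using pred_reach_step[OF Cons.IH Suc.IH] by blast
    qed
  qed
qed

section \<open>One recoloring: transition probabilities and predecessors\<close>

definition reachable :: "adjacency \<Rightarrow> nat list \<Rightarrow> (nat \<Rightarrow> nat) \<Rightarrow> (nat \<Rightarrow> nat) set" where
  "reachable A vs \<sigma> = {\<tau>. (\<forall>y. y \<notin> set vs \<longrightarrow> \<tau> y = \<sigma> y) \<and>
     (\<forall>y\<in>set vs. \<tau> y \<in> insert r (set (avail A \<sigma> y)))}"

lemma finite_reachable: "finite (reachable A vs \<sigma>)"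
proof -
  have "reachable A vs \<sigma> \<subseteq> (\<lambda>g y. if y \<in> set vs then g y else \<sigma> y) `
      (Pi\<^sub>E (set vs) (\<lambda>y. insert r (set (avail A \<sigma> y))))"
  proof
    fix \<tau> assume \<tau>: "\<tau> \<in> reachable A vs \<sigma>"
    then have "\<tau> = (\<lambda>y. if y \<in> set vs then restrict \<tau> (set vs) y else \<sigma> y)"
      by (auto simp: reachable_def)
    moreover have "restrict \<tau> (set vs) \<in> Pi\<^sub>E (set vs) (\<lambda>y. insert r (set (avail A \<sigma> y)))"
      using \<tau> by (auto simp: reachable_def)
    ultimately show "\<tau> \<in> (\<lambda>g y. if y \<in> set vs then g y else \<sigma> y) `
      (Pi\<^sub>E (set vs) (\<lambda>y. insert r (set (avail A \<sigma> y))))" by (rule image_eqI)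
  qed
  then show ?thesis by (rule finite_subset) (auto intro!: finite_PiE)
qed

text \<open>As \<open>vs\<close> spans no edge, each vertex still has its list from \<sigma> when
  its turn comes, and every outcome arises from one sequence of choices. Its probability is a
  product over single choices, each too large by at most \<open>1 / 2 ^ w\<close> because of the
  reduction modulo \<open>m\<close>.\<close>

lemma prob_of_resample_le:
  assumes B: "\<And>\<tau>. Measurable.pred (random_words w) (B \<tau>)"
    and "distinct vs" "\<And>v. v \<in> set vs \<Longrightarrow> set (A v) \<inter> set vs = {}"
  shows "prob_of (\<lambda>\<omega>. B (resample A \<sigma> \<omega> vs) (\<lambda>i. \<omega> (i + length vs))) \<le>
    (\<Prod>v\<in>set vs. 1 / (real (length (avail A \<sigma> v)) + 1) + 1 / 2 ^ w) *
    (\<Sum>\<tau>\<in>reachable A vs \<sigma>. prob_of (B \<tau>))"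
  using assms(2,3)
proof (induction vs arbitrary: \<sigma>)
  case Nil
  have "reachable A [] \<sigma> = {\<sigma>}" by (auto simp: reachable_def)
  then show ?case by simp
next
  case (Cons v vs)
  let ?L = "avail A \<sigma> v"
  define m where "m = Suc (length ?L)"
  define \<sigma>' where "\<sigma>' y = \<sigma>(v := y)" for y
  define K where "K = (\<Prod>y\<in>set vs. 1 / (real (length (avail A \<sigma> y)) + 1) + 1 / (2::real) ^ w)"
  define G where "G y = (\<Sum>\<tau>\<in>reachable A vs (\<sigma>' y). prob_of (B \<tau>))" for y
  define f where "f y = prob_of (\<lambda>\<omega>. B (resample A (\<sigma>' y) \<omega> vs) (\<lambda>i. \<omega> (i + length vs)))" for y
  have avail': "avail A (\<sigma>' y) x = avail A \<sigma> x" if "x \<in> set vs" for x y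
    by (rule avail_cong) (use that Cons.prems in \<open>force simp: \<sigma>'_def\<close>)
  have K: "0 \<le> K" unfolding K_def by (intro prod_nonneg) auto
  have G: "0 \<le> G y" for y unfolding G_def by (intro sum_nonneg) auto
  have f: "f y \<le> K * G y" for y
  proof -
    have "f y \<le> (\<Prod>x\<in>set vs. 1 / (real (length (avail A (\<sigma>' y) x)) + 1) + 1 / 2 ^ w) * G y"
      unfolding f_def G_def using Cons.prems by (intro Cons.IH) auto
    then show ?thesis by (simp add: avail' K_def)
  qed
  have "prob_of (\<lambda>\<omega>. B (resample A \<sigma> \<omega> (v # vs)) (\<lambda>i. \<omega> (i + length (v # vs)))) =
      prob_of (\<lambda>\<omega>. (\<lambda>a \<omega>. B (resample A (\<sigma>' (pick r ?L (a mod m))) \<omega> vs) (\<lambda>i. \<omega> (i + length vs)))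
        (\<omega> 0) (\<lambda>i. \<omega> (Suc i)))"
    by (simp add: \<sigma>'_def m_def)
  also have "\<dots> = (\<Sum>a<2 ^ w. f (pick r ?L (a mod m))) / 2 ^ w"
    unfolding prob_of_def f_def
    by (subst measure_random_words_first) (auto intro!: pred_resample B)
  finally have E: "prob_of (\<lambda>\<omega>. B (resample A \<sigma> \<omega> (v # vs)) (\<lambda>i. \<omega> (i + length (v # vs)))) =
      (\<Sum>a<2 ^ w. f (pick r ?L (a mod m))) / 2 ^ w" .
  \<comment> \<open>Words are grouped by residue; \<open>bij_betw_pick\<close> then turns residues
    into colors.\<close>
  have "(\<Sum>a<2 ^ w. f (pick r ?L (a mod m))) =
      (\<Sum>j<m. \<Sum>a\<in>{a\<in>{..<2 ^ w}. a mod m = j}. f (pick r ?L (a mod m)))"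
    by (rule sum.group[symmetric]) (auto simp: m_def)
  also have "\<dots> = (\<Sum>j<m. real (card {a\<in>{..<2 ^ w}. a mod m = j}) * f (pick r ?L j))"
    by (intro sum.cong refl) simp
  also have "\<dots> \<le> (\<Sum>j<m. (2 ^ w / real m + 1) * (K * G (pick r ?L j)))"
  proof (intro sum_mono mult_mono f)
    fix j
    have "real (card {a\<in>{..<2 ^ w}. a mod m = j}) \<le> real (2 ^ w div m + 1)"
      by (rule of_nat_mono[OF card_mod_eq_le]) (simp add: m_def)
    also have "\<dots> \<le> 2 ^ w / real m + 1"
      using of_nat_div_le_of_nat[of "2 ^ w" m, where ?'a = real] by simp
    finally show "real (card {a\<in>{..<2 ^ w}. a mod m = j}) \<le> 2 ^ w / real m + 1" .
  qed (auto simp: f_def)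
  also have "\<dots> = (2 ^ w / real m + 1) * K * (\<Sum>j<m. G (pick r ?L j))"
    by (simp add: sum_distrib_left mult.assoc)
  also have "(\<Sum>j<m. G (pick r ?L j)) = (\<Sum>y\<in>insert r (set ?L). G y)"
    unfolding m_def by (rule sum.reindex_bij_betw[OF bij_betw_pick]) (auto simp: avail_facts)
  \<comment> \<open>Different colors of \<open>v\<close> lead to disjoint sets of outcomes, because
    \<open>v\<close> does not occur again in \<open>vs\<close>.\<close>
  also have "\<dots> = (\<Sum>\<tau>\<in>(\<Union>y\<in>insert r (set ?L). reachable A vs (\<sigma>' y)). prob_of (B \<tau>))"
    unfolding G_def
  proof (rule sum.UNION_disjoint[symmetric])
    show "\<forall>i\<in>insert r (set ?L). \<forall>j\<in>insert r (set ?L). i \<noteq> j \<longrightarrow>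
      reachable A vs (\<sigma>' i) \<inter> reachable A vs (\<sigma>' j) = {}"
    proof (intro ballI impI)
      fix i j :: nat assume "i \<noteq> j"
      have "\<tau> v = y" if "\<tau> \<in> reachable A vs (\<sigma>' y)" for \<tau> y
        using that Cons.prems by (auto simp: reachable_def \<sigma>'_def)
      then show "reachable A vs (\<sigma>' i) \<inter> reachable A vs (\<sigma>' j) = {}" using \<open>i \<noteq> j\<close> by blast
    qed
  qed (auto simp: finite_reachable)
  also have "(\<Union>y\<in>insert r (set ?L). reachable A vs (\<sigma>' y)) = reachable A (v # vs) \<sigma>"
  proof (intro equalityI subsetI)
    fix \<tau> assume "\<tau> \<in> (\<Union>y\<in>insert r (set ?L). reachable A vs (\<sigma>' y))"
    then obtain y where y: "y \<in> insert r (set ?L)" "\<tau> \<in> reachable A vs (\<sigma>' y)" by blast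
    then have "\<tau> v = y" using Cons.prems by (auto simp: reachable_def \<sigma>'_def)
    then show "\<tau> \<in> reachable A (v # vs) \<sigma>"
      using y by (auto simp: reachable_def avail') (auto simp: \<sigma>'_def)
  next
    fix \<tau> assume \<tau>: "\<tau> \<in> reachable A (v # vs) \<sigma>"
    then have "\<tau> \<in> reachable A vs (\<sigma>' (\<tau> v))"
      by (auto simp: reachable_def avail') (auto simp: \<sigma>'_def)
    moreover have "\<tau> v \<in> insert r (set ?L)" using \<tau> by (auto simp: reachable_def)
    ultimately show "\<tau> \<in> (\<Union>y\<in>insert r (set ?L). reachable A vs (\<sigma>' y))" by blast
  qed
  finally have "prob_of (\<lambda>\<omega>. B (resample A \<sigma> \<omega> (v # vs)) (\<lambda>i. \<omega> (i + length (v # vs)))) \<le>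
     (2 ^ w / real m + 1) * K * (\<Sum>\<tau>\<in>reachable A (v # vs) \<sigma>. prob_of (B \<tau>)) / 2 ^ w"
    unfolding E by (rule divide_right_mono) simp
  also have "\<dots> = (1 / real m + 1 / 2 ^ w) * K * (\<Sum>\<tau>\<in>reachable A (v # vs) \<sigma>. prob_of (B \<tau>))"
    by (simp add: field_simps m_def)
  finally show ?case using Cons.prems by (simp add: K_def m_def add.commute)
qed

lemma finite_colorings: "finite (colorings A)"
  unfolding colorings_def by (rule finite_subset[of _ "{1..n} \<rightarrow>\<^sub>E {r..r + q}"]) (auto intro!: finite_PiE)

lemma card_colorings_le: "card (colorings A) \<le> (q + 1) ^ n"
proof -
  have "card (colorings A) \<le> card ({1..n} \<rightarrow>\<^sub>E {r..r + q})"
    unfolding colorings_def by (intro card_mono finite_PiE) auto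
  also have "\<dots> = (q + 1) ^ n" by (simp add: card_PiE)
  finally show ?thesis .
qed

text \<open>If no neighbor has a short list, then all blank neighbors of \<open>v\<close> count for
  \<open>flawed\<close>, and as \<open>v\<close> is not settled there are at least \<open>r\<close>
  of them. Otherwise the culprit itself has a short list.\<close>

lemma culprit_flawed:
  assumes "\<not> settled A \<sigma> v"
  shows "culprit A \<sigma> v \<in> insert v (set (A v))" "flawed A \<sigma> (culprit A \<sigma> v)"
proof -
  let ?f = "filter (\<lambda>y. length (avail A \<sigma> y) < l) (A v)"
  have "culprit A \<sigma> v \<in> insert v (set (A v)) \<and> flawed A \<sigma> (culprit A \<sigma> v)"
  proof (cases ?f)
    case Nil
    then have "\<forall>y\<in>set (A v). l \<le> length (avail A \<sigma> y)" by (auto simp: filter_empty_conv)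
    then have "filter (\<lambda>y. \<sigma> y \<le> r \<and> l \<le> length (avail A \<sigma> y)) (A v) = filter (\<lambda>y. \<sigma> y \<le> r) (A v)"
      by (intro filter_cong) auto
    then show ?thesis using assms Nil by (auto simp: culprit_def flawed_def settled_def blank_deg_def)
  next
    case (Cons x xs)
    have "x \<in> set ?f" unfolding Cons by simp
    then have "x \<in> set (A v)" "length (avail A \<sigma> x) < l" by auto
    then show ?thesis using Cons by (auto simp: culprit_def flawed_def)
  qed
  then show "culprit A \<sigma> v \<in> insert v (set (A v))" "flawed A \<sigma> (culprit A \<sigma> v)" by auto
qed

lemma coloring_in_avail:
  assumes "\<sigma> \<in> colorings A" "y \<in> {1..n}"
  shows "\<sigma> y \<in> insert r (set (avail A \<sigma> y))"
proof -
  have "\<sigma> y \<in> {r..r + q}" using assms by (auto simp: colorings_def)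
  then show ?thesis using assms by (fastforce simp: colorings_def set_avail)
qed

text \<open>By the absence of triangles, the neighbors of a neighbor of \<open>x\<close> lie outside
  the neighborhood of \<open>x\<close>, where nothing has changed.\<close>

lemma avail_off_neighbors:
  assumes "valid_adj A" "x \<in> {1..n}" "\<And>y. y \<notin> set (A x) \<Longrightarrow> \<sigma> y = \<tau> y" "y \<in> set (A x)"
  shows "avail A \<sigma> y = avail A \<tau> y"
proof (rule avail_cong)
  fix z assume "z \<in> set (A y)"
  then have "z \<notin> set (A x)" using assms(1,2,4) by (fastforce simp: valid_adj_def)
  then show "\<sigma> z = \<tau> z" by (rule assms(3))
qed

text \<open>New primary colors are absent from the unchanged surroundings, and no two recolored
  vertices are adjacent.\<close>

lemma reachable_colorings:
  assumes A: "valid_adj A" and x: "x \<in> {1..n}" and \<sigma>: "\<sigma> \<in> colorings A"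
  shows "reachable A (rev (A x)) \<sigma> \<subseteq> colorings A"
proof
  fix \<tau> assume \<tau>: "\<tau> \<in> reachable A (rev (A x)) \<sigma>"
  then have off: "\<tau> y = \<sigma> y" if "y \<notin> set (A x)" for y
    using that by (auto simp: reachable_def)
  have on: "\<tau> y \<in> insert r (set (avail A \<sigma> y))" if "y \<in> set (A x)" for y
    using \<tau> that by (auto simp: reachable_def)
  have X: "set (A x) \<subseteq> {1..n}" using A x by (auto simp: valid_adj_def)
  have "\<tau> y \<in> {r..r + q}" if "y \<in> {1..n}" for y
  proof (cases "y \<in> set (A x)")
    case True
    then show ?thesis using on[OF True] avail_facts(3)[of A \<sigma> y] by auto
  next
    case False
    then show ?thesis using off[OF False] \<sigma> that by (auto simp: colorings_def)
  qed
  moreover have "\<tau> y = undefined" if "y \<notin> {1..n}" for y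
  proof -
    have "y \<notin> set (A x)" "\<sigma> y = undefined"
      using X \<sigma> that by (auto simp: colorings_def PiE_iff extensional_def)
    then show ?thesis using off by simp
  qed
  ultimately have "\<tau> \<in> {1..n} \<rightarrow>\<^sub>E {r..r + q}" by (auto intro!: PiE_I)
  moreover have "\<tau> v \<noteq> \<tau> y \<or> \<tau> v = r" if vy: "v \<in> {1..n}" "y \<in> set (A v)" for v y
  proof (cases "v \<in> set (A x)")
    case True
    then have "y \<notin> set (A x)" using A x vy by (fastforce simp: valid_adj_def)
    then show ?thesis using on[OF True] off[of y] vy by (auto simp: set_avail)
  next
    case v: False
    show ?thesis
    proof (cases "y \<in> set (A x)")
      case True
      have "v \<in> set (A y)" using A vy by (auto simp: valid_adj_def)
      then have "\<sigma> v \<in> \<sigma> ` set (A y)" by (rule imageI)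
      then show ?thesis using on[OF True] off[OF v] by (auto simp: set_avail)
    next
      case False
      then show ?thesis using off[OF v] off[OF False] \<sigma> vy by (auto simp: colorings_def)
    qed
  qed
  ultimately show "\<tau> \<in> colorings A" by (auto simp: colorings_def)
qed

text \<open>A recoloring read backwards: a predecessor of \<tau> agrees with \<tau> off the
  neighborhood of \<open>x\<close> and has the same lists inside. It is thus determined by its
  restriction, a point in the product of these lists, and the flawed ones are counted by the two
  tail estimates.\<close>

lemma card_flawed_predecessors_le:
  assumes A: "valid_adj A" and x: "x \<in> {1..n}" and q: "1 \<le> q"
  shows "real (card {\<sigma> \<in> colorings A. flawed A \<sigma> x \<and> \<tau> \<in> reachable A (rev (A x)) \<sigma>}) \<le>
    flaw_bound * (\<Prod>y\<in>set (A x). real (length (avail A \<tau> y)) + 1)"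
proof -
  define X where "X = set (A x)"
  define L where "L y = set (avail A \<tau> y)" for y
  define C where "C = {Suc r..<Suc r + q}"
  define S where "S = {\<sigma> \<in> colorings A. flawed A \<sigma> x \<and> \<tau> \<in> reachable A (rev (A x)) \<sigma>}"
  define T1 where "T1 = {g \<in> Pi\<^sub>E X (\<lambda>y. insert r (L y)). card (C - g ` X) < l}"
  define T2 where "T2 = {g \<in> Pi\<^sub>E X (\<lambda>y. insert r (L y)). r \<le> card {y\<in>X. g y = r \<and> l \<le> card (L y)}}"
  have X: "X \<subseteq> {1..n}" "card X \<le> \<Delta>" "finite X" "distinct (A x)"
    using A x by (auto simp: valid_adj_def X_def distinct_card)
  have off: "\<sigma> y = \<tau> y" if "\<sigma> \<in> S" "y \<notin> X" for \<sigma> y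
    using that by (auto simp: S_def reachable_def X_def)
  have av: "avail A \<sigma> y = avail A \<tau> y" if "\<sigma> \<in> S" "y \<in> X" for \<sigma> y
  proof (rule avail_off_neighbors[OF A x])
    show "\<sigma> z = \<tau> z" if "z \<notin> set (A x)" for z using off[OF \<open>\<sigma> \<in> S\<close>] that by (simp add: X_def)
    show "y \<in> set (A x)" using that by (simp add: X_def)
  qed
  have fin: "finite (Pi\<^sub>E X (\<lambda>y. insert r (L y)))"
    using X by (auto intro!: finite_PiE simp: L_def)
  have inj: "inj_on (\<lambda>\<sigma>. restrict \<sigma> X) S"
  proof (rule inj_onI)
    fix \<sigma> \<sigma>' assume s: "\<sigma> \<in> S" "\<sigma>' \<in> S" "restrict \<sigma> X = restrict \<sigma>' X"
    show "\<sigma> = \<sigma>'"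
    proof
      fix y show "\<sigma> y = \<sigma>' y"
        using off[OF s(1), of y] off[OF s(2), of y] fun_cong[OF s(3), of y] by (cases "y \<in> X") auto
    qed
  qed
  have img: "(\<lambda>\<sigma>. restrict \<sigma> X) ` S \<subseteq> T1 \<union> T2"
  proof
    fix g assume "g \<in> (\<lambda>\<sigma>. restrict \<sigma> X) ` S"
    then obtain \<sigma> where s: "\<sigma> \<in> S" and g: "g = restrict \<sigma> X" by blast
    have col: "\<sigma> \<in> colorings A" using s by (simp add: S_def)
    have gP: "g \<in> Pi\<^sub>E X (\<lambda>y. insert r (L y))"
      unfolding g
    proof (rule restrict_PiE_iff[THEN iffD2], rule ballI)
      fix y assume y: "y \<in> X"
      then show "\<sigma> y \<in> insert r (L y)"
        using coloring_in_avail[OF col, of y] X av[OF s y] by (auto simp: L_def)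
    qed
    have "length (avail A \<sigma> x) = card (C - g ` X)"
      by (simp add: length_avail set_avail C_def X_def g)
    moreover have "length (filter (\<lambda>y. \<sigma> y \<le> r \<and> l \<le> length (avail A \<sigma> y)) (A x)) =
        card {y\<in>X. g y = r \<and> l \<le> card (L y)}"
    proof -
      have "\<sigma> y \<ge> r" if "y \<in> X" for y using col that X by (auto simp: colorings_def)
      then have eq: "{y\<in>X. g y = r \<and> l \<le> card (L y)} = set (filter (\<lambda>y. \<sigma> y \<le> r \<and> l \<le> length (avail A \<sigma> y)) (A x))"
        using av[OF s] by (force simp: g X_def L_def length_avail)
      show ?thesis unfolding eq by (rule distinct_card[OF distinct_filter[OF X(4)], symmetric])
    qed
    ultimately show "g \<in> T1 \<union> T2"
      using s gP by (auto simp: S_def flawed_def T1_def T2_def)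
  qed
  have "card S = card ((\<lambda>\<sigma>. restrict \<sigma> X) ` S)" using inj by (simp add: card_image)
  also have "\<dots> \<le> card (T1 \<union> T2)" using fin by (intro card_mono img) (auto simp: T1_def T2_def)
  also have "\<dots> \<le> card T1 + card T2" by (rule card_Un_le)
  finally have "real (card S) \<le> real (card T1) + real (card T2)" by linarith
  also have "\<dots> \<le> 2 ^ l * exp (- (real (card C) * exp (- real \<Delta> / real (card C))) / 2) * (\<Prod>y\<in>X. real (card (L y)) + 1) +
      (1 / 2) ^ r * exp (real \<Delta> / (real l + 1)) * (\<Prod>y\<in>X. real (card (L y)) + 1)"
    unfolding T1_def T2_def using X q
    by (intro add_mono card_few_untaken_le card_many_blank_le) (auto simp: C_def L_def avail_facts set_avail)
  also have "\<dots> = flaw_bound * (\<Prod>y\<in>X. real (card (L y)) + 1)"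
    by (simp add: flaw_bound_def C_def algebra_simps)
  finally show ?thesis by (simp add: S_def X_def L_def length_avail)
qed

text \<open>After exchanging the sums, the transition probability \<kappa> may be evaluated at
  \<tau>. It is about 1 over the product of the numbers of choices, and this product cancels against
  the one in the count of flawed predecessors. By \<open>size\<close>, the rounding errors of all
  choices together cost at most a factor \<open>exp 1\<close>.\<close>

lemma sum_flawed_resample_le:
  assumes A: "valid_adj A" and x: "x \<in> {1..n}" and q: "1 \<le> q" and size: "\<Delta> * (q + 1) \<le> 2 ^ w"
    and B: "\<And>\<tau>. Measurable.pred (random_words w) (B \<tau>)"
  shows "(\<Sum>\<sigma>\<in>{\<sigma>\<in>colorings A. flawed A \<sigma> x}.
      prob_of (\<lambda>\<omega>. B (resample A \<sigma> \<omega> (rev (A x))) (\<lambda>i. \<omega> (i + length (A x))))) \<le>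
    exp 1 * flaw_bound * (\<Sum>\<tau>\<in>colorings A. prob_of (B \<tau>))"
proof -
  define X where "X = set (A x)"
  define R where "R \<sigma> = reachable A (rev (A x)) \<sigma>" for \<sigma>
  define F where "F = {\<sigma>\<in>colorings A. flawed A \<sigma> x}"
  define \<kappa> where "\<kappa> \<sigma> = (\<Prod>y\<in>X. 1 / (real (length (avail A \<sigma> y)) + 1) + 1 / 2 ^ w)" for \<sigma>
  have X: "card X \<le> \<Delta>" "finite X"
    using A x by (auto simp: valid_adj_def X_def distinct_card)
  have finF: "finite F" unfolding F_def using finite_colorings by auto
  have \<kappa>0: "0 \<le> \<kappa> \<sigma>" for \<sigma> unfolding \<kappa>_def by (intro prod_nonneg) auto
  have "(\<Sum>\<sigma>\<in>F. prob_of (\<lambda>\<omega>. B (resample A \<sigma> \<omega> (rev (A x))) (\<lambda>i. \<omega> (i + length (A x))))) \<le>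
      (\<Sum>\<sigma>\<in>F. \<kappa> \<sigma> * (\<Sum>\<tau>\<in>R \<sigma>. prob_of (B \<tau>)))"
  proof (rule sum_mono)
    fix \<sigma> assume "\<sigma> \<in> F"
    have "prob_of (\<lambda>\<omega>. B (resample A \<sigma> \<omega> (rev (A x))) (\<lambda>i. \<omega> (i + length (rev (A x))))) \<le>
      (\<Prod>y\<in>set (rev (A x)). 1 / (real (length (avail A \<sigma> y)) + 1) + 1 / 2 ^ w) *
      (\<Sum>\<tau>\<in>R \<sigma>. prob_of (B \<tau>))"
      unfolding R_def using A x by (intro prob_of_resample_le B) (auto simp: valid_adj_def)
    then show "prob_of (\<lambda>\<omega>. B (resample A \<sigma> \<omega> (rev (A x))) (\<lambda>i. \<omega> (i + length (A x)))) \<le>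
      \<kappa> \<sigma> * (\<Sum>\<tau>\<in>R \<sigma>. prob_of (B \<tau>))"
      by (simp add: \<kappa>_def X_def)
  qed
  also have "\<dots> = (\<Sum>\<sigma>\<in>F. \<Sum>\<tau>\<in>{\<tau>\<in>colorings A. \<tau> \<in> R \<sigma>}. \<kappa> \<sigma> * prob_of (B \<tau>))"
  proof (rule sum.cong[OF refl])
    fix \<sigma> assume "\<sigma> \<in> F"
    then have "{\<tau>\<in>colorings A. \<tau> \<in> R \<sigma>} = R \<sigma>"
      using reachable_colorings[OF A x] by (auto simp: F_def R_def)
    then show "\<kappa> \<sigma> * (\<Sum>\<tau>\<in>R \<sigma>. prob_of (B \<tau>)) = (\<Sum>\<tau>\<in>{\<tau>\<in>colorings A. \<tau> \<in> R \<sigma>}. \<kappa> \<sigma> * prob_of (B \<tau>))"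
      by (simp add: sum_distrib_left)
  qed
  also have "\<dots> = (\<Sum>\<tau>\<in>colorings A. \<Sum>\<sigma>\<in>{\<sigma>\<in>F. \<tau> \<in> R \<sigma>}. \<kappa> \<sigma> * prob_of (B \<tau>))"
    by (rule sum.swap_restrict) (auto simp: finF finite_colorings)
  also have "\<dots> \<le> (\<Sum>\<tau>\<in>colorings A. exp 1 * flaw_bound * prob_of (B \<tau>))"
  proof (rule sum_mono)
    fix \<tau> assume "\<tau> \<in> colorings A"
    let ?P = "\<Prod>y\<in>X. real (length (avail A \<tau> y)) + 1"
    have P0: "0 < ?P" by (intro prod_pos) auto
    have \<kappa>_le: "\<kappa> \<tau> \<le> exp 1 * (1 / ?P)"
    proof -
      have "\<kappa> \<tau> \<le> (\<Prod>y\<in>X. exp (real (q + 1) / 2 ^ w) * (1 / (real (length (avail A \<tau> y)) + 1)))"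
        unfolding \<kappa>_def
      proof (intro prod_mono conjI)
        fix y
        let ?m = "real (length (avail A \<tau> y)) + 1"
        have "1 / ?m + 1 / 2 ^ w = (1 + ?m / 2 ^ w) * (1 / ?m)"
          by (simp add: field_simps)
        also have "\<dots> \<le> exp (real (q + 1) / 2 ^ w) * (1 / ?m)"
        proof (intro mult_right_mono)
          have "?m / 2 ^ w \<le> real (q + 1) / 2 ^ w"
            using avail_facts(4)[of A \<tau> y] by (intro divide_right_mono) auto
          then show "1 + ?m / 2 ^ w \<le> exp (real (q + 1) / 2 ^ w)"
            using exp_ge_add_one_self[of "real (q + 1) / 2 ^ w"] by linarith
        qed auto
        finally show "1 / ?m + 1 / 2 ^ w \<le> exp (real (q + 1) / 2 ^ w) * (1 / ?m)" .
      qed auto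
      also have "\<dots> = exp (real (card X) * (real (q + 1) / 2 ^ w)) * (1 / ?P)"
        unfolding prod.distrib prod_constant exp_of_nat_mult[symmetric] prod_dividef by simp
      also have "\<dots> \<le> exp 1 * (1 / ?P)"
      proof (intro mult_right_mono)
        have "card X * (q + 1) \<le> 2 ^ w" using X size mult_right_mono[of "card X" \<Delta> "q + 1"] by linarith
        then have "real (card X * (q + 1)) \<le> 2 ^ w" by (metis of_nat_le_iff of_nat_numeral of_nat_power)
        then have "real (card X) * (real (q + 1) / 2 ^ w) \<le> 1" by (simp add: field_simps)
        then show "exp (real (card X) * (real (q + 1) / 2 ^ w)) \<le> exp 1" by simp
      qed (use P0 in auto)
      finally show ?thesis .
    qed
    have eq: "\<kappa> \<sigma> = \<kappa> \<tau>" if "\<sigma> \<in> F" "\<tau> \<in> R \<sigma>" for \<sigma>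
    proof -
      have "avail A \<sigma> y = avail A \<tau> y" if "y \<in> X" for y
        using \<open>\<tau> \<in> R \<sigma>\<close> that by (intro avail_off_neighbors[OF A x]) (auto simp: R_def reachable_def X_def)
      then show ?thesis by (simp add: \<kappa>_def)
    qed
    have "(\<Sum>\<sigma>\<in>{\<sigma>\<in>F. \<tau> \<in> R \<sigma>}. \<kappa> \<sigma> * prob_of (B \<tau>)) = real (card {\<sigma>\<in>F. \<tau> \<in> R \<sigma>}) * (\<kappa> \<tau> * prob_of (B \<tau>))"
      using eq by (simp add: mult.commute)
    also have "\<dots> \<le> flaw_bound * ?P * (exp 1 * (1 / ?P) * prob_of (B \<tau>))"
    proof (intro mult_mono \<kappa>_le order.refl)
      show "real (card {\<sigma>\<in>F. \<tau> \<in> R \<sigma>}) \<le> flaw_bound * ?P"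
        using card_flawed_predecessors_le[OF A x q, of \<tau>] by (simp add: F_def R_def X_def conj_assoc)
      show "0 \<le> flaw_bound * ?P" using P0 by (auto simp: flaw_bound_def)
    qed (use \<kappa>0 P0 in auto)
    also have "\<dots> = exp 1 * flaw_bound * prob_of (B \<tau>)" using P0 by simp
    finally show "(\<Sum>\<sigma>\<in>{\<sigma>\<in>F. \<tau> \<in> R \<sigma>}. \<kappa> \<sigma> * prob_of (B \<tau>)) \<le> exp 1 * flaw_bound * prob_of (B \<tau>)" .
  qed
  finally show ?thesis by (simp add: F_def sum_distrib_left)
qed

section \<open>Updates, and the sum over initial colorings\<close>

lemma set_remove_swap: "set (remove_swap v xs) \<subseteq> set xs"
proof -
  have "set (remove_swap v xs) \<subseteq> set (map (\<lambda>y. if y = v then last xs else y) xs)"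
    unfolding remove_swap_def by (auto dest: in_set_butlastD)
  also have "\<dots> \<subseteq> set xs" by (cases "xs = []") auto
  finally show ?thesis .
qed

text \<open>An insertion makes at most one vertex blank, and its former color can only have been
  that of the other endpoint; so the map on colorings is at most two-to-one. A deletion merely
  admits more colorings.\<close>

lemma sum_update_le:
  assumes "endpoints_ok n u" and P: "\<And>\<tau>. 0 \<le> (P \<tau> :: real)"
  shows "(\<Sum>\<sigma>\<in>colorings A. P (update_col u \<sigma>)) \<le> 2 * (\<Sum>\<tau>\<in>colorings (update_adj u A). P \<tau>)"
proof (cases u)
  case (Delete a b)
  have "colorings A \<subseteq> colorings (update_adj u A)"
    using set_remove_swap by (fastforce simp: colorings_def Delete)
  then have "sum P (colorings A) \<le> sum P (colorings (update_adj u A))"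
    using P finite_colorings by (intro sum_mono2) auto
  also have "\<dots> \<le> 2 * sum P (colorings (update_adj u A))"
    using P by (simp add: sum_nonneg)
  finally show ?thesis using Delete by simp
next
  case (Insert a b)
  have ab: "a \<noteq> b" "a \<in> {1..n}" "b \<in> {1..n}" using assms(1) Insert by auto
  let ?f = "update_col u"
  have sub: "?f ` colorings A \<subseteq> colorings (update_adj u A)"
  proof
    fix \<tau> assume "\<tau> \<in> ?f ` colorings A"
    then obtain \<sigma> where \<sigma>: "\<sigma> \<in> colorings A" and \<tau>: "\<tau> = ?f \<sigma>" by blast
    have "\<tau> \<in> {1..n} \<rightarrow>\<^sub>E {r..r + q}" using \<sigma> ab by (auto simp: \<tau> Insert colorings_def PiE_iff extensional_def)
    moreover have "\<tau> v \<noteq> \<tau> y \<or> \<tau> v = r" if vy: "v \<in> {1..n}" "y \<in> set (update_adj u A v)" for v y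
    proof -
      have "y \<in> set (A v) \<or> (v = a \<and> y = b) \<or> (v = b \<and> y = a)"
        using vy by (auto simp: Insert split: if_splits)
      moreover have "\<sigma> v \<noteq> \<sigma> y \<or> \<sigma> v = r" if "y \<in> set (A v)"
        using \<sigma> vy that by (auto simp: colorings_def)
      ultimately show ?thesis using ab by (auto simp: \<tau> Insert)
    qed
    ultimately show "\<tau> \<in> colorings (update_adj u A)" by (auto simp: colorings_def)
  qed
  have "(\<Sum>\<sigma>\<in>colorings A. P (?f \<sigma>)) = (\<Sum>\<tau>\<in>?f ` colorings A. \<Sum>\<sigma>\<in>{\<sigma>\<in>colorings A. ?f \<sigma> = \<tau>}. P (?f \<sigma>))"
    by (rule sum.image_gen[OF finite_colorings])
  also have "\<dots> = (\<Sum>\<tau>\<in>?f ` colorings A. real (card {\<sigma>\<in>colorings A. ?f \<sigma> = \<tau>}) * P \<tau>)"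
    by (intro sum.cong) auto
  also have "\<dots> \<le> (\<Sum>\<tau>\<in>?f ` colorings A. 2 * P \<tau>)"
  proof (intro sum_mono mult_right_mono P)
    fix \<tau>
    have "{\<sigma>\<in>colorings A. ?f \<sigma> = \<tau>} \<subseteq> {\<tau>, \<tau>(a := \<tau> b)}"
      using ab by (auto simp: Insert split: if_splits)
    then have "card {\<sigma>\<in>colorings A. ?f \<sigma> = \<tau>} \<le> card {\<tau>, \<tau>(a := \<tau> b)}"
      by (intro card_mono) auto
    also have "\<dots> \<le> 2" by (simp add: card_insert_if)
    finally show "real (card {\<sigma>\<in>colorings A. ?f \<sigma> = \<tau>}) \<le> 2" by simp
  qed
  also have "\<dots> \<le> (\<Sum>\<tau>\<in>colorings (update_adj u A). 2 * P \<tau>)"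
    using sub P by (intro sum_mono2 finite_colorings) auto
  finally show ?thesis by (simp add: sum_distrib_left)
qed

lemma set_update_work: "endpoints_ok n u \<Longrightarrow> set (update_work u) \<subseteq> {1..n}"
  by (cases u) auto

text \<open>Each worklist entry carries the weight \<open>1 + 1 / \<Delta>\<close>. Removing an
  entry frees a share \<rho> / \<Delta> of the bound, which pays for the at most
  \<open>\<Delta> + 1\<close> possible culprits, while the at most \<Delta> entries added by a
  recoloring multiply the weight by a constant only. An update costs 4: a factor 2 from
  \<open>sum_update_le\<close> and at most 2 for the entry it puts on the worklist.\<close>

lemma sum_prob_reach_le:
  fixes \<rho> :: real
  assumes D: "1 \<le> \<Delta>" and q: "1 \<le> q" and size: "\<Delta> * (q + 1) \<le> 2 ^ w" and \<rho>: "0 < \<rho>"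
    and small: "(real \<Delta> + 1) * (exp 1 * flaw_bound * (1 + 1 / real \<Delta>) ^ (\<Delta> + 1)) \<le> \<rho> / real \<Delta>"
  shows "valid_adjs A us \<Longrightarrow> set W \<subseteq> {1..n} \<Longrightarrow>
    (\<Sum>\<sigma>\<in>colorings A. prob_of (reach s us A \<sigma> W)) \<le>
      (real q + 1) ^ n * \<rho> ^ s * 4 ^ length us * (1 + 1 / real \<Delta>) ^ length W"
proof (induction s arbitrary: us A W)
  case 0
  have "(\<Sum>\<sigma>\<in>colorings A. prob_of (reach 0 us A \<sigma> W)) \<le> (\<Sum>\<sigma>\<in>colorings A. 1)"
    by (intro sum_mono prob_of_le_1)
  also have "\<dots> \<le> (real q + 1) ^ n"
    using of_nat_mono[OF card_colorings_le[of A], where ?'a = real] by (simp add: add.commute)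
  also have "\<dots> * 1 \<le> (real q + 1) ^ n * (4 ^ length us * (1 + 1 / real \<Delta>) ^ length W)"
  proof (intro mult_left_mono)
    have "(1::real) * 1 \<le> 4 ^ length us * (1 + 1 / real \<Delta>) ^ length W"
      by (intro mult_mono one_le_power) auto
    then show "(1::real) \<le> 4 ^ length us * (1 + 1 / real \<Delta>) ^ length W" by simp
  qed auto
  finally show ?case by (simp only: power_0 mult_1_right mult.assoc)
next
  case (Suc s)
  define b where "b = 1 + 1 / real \<Delta>"
  define N where "N = (real q + 1) ^ n"
  have b1: "1 \<le> b" "b \<le> 2" using D by (auto simp: b_def)
  have N0: "0 \<le> N" by (simp add: N_def)
  have step: "(\<Sum>\<sigma>\<in>colorings A. prob_of (reach (Suc s) us A \<sigma> (v # W))) \<le>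
      N * \<rho> ^ Suc s * 4 ^ length us * b ^ length (v # W)"
    if A: "valid_adjs A us" and vW: "set (v # W) \<subseteq> {1..n}" and
      IH: "(\<Sum>\<sigma>\<in>colorings A. prob_of (reach (Suc s) us A \<sigma> W)) \<le> N * \<rho> ^ Suc s * 4 ^ length us * b ^ length W"
    for A us v W
  proof -
    define K where "K = N * \<rho> ^ s * 4 ^ length us * b ^ length W"
    define W' where "W' x = fold push (rev (A x)) (v # W)" for x
    define Q where "Q x \<sigma> = prob_of (\<lambda>\<omega>. reach s us A (resample A \<sigma> \<omega> (rev (A x))) (W' x) (\<lambda>i. \<omega> (i + length (A x))))" for x \<sigma>
    have vA: "valid_adj A" using A by (rule valid_adjs_imp)
    have v: "v \<in> {1..n}" using vW by simp
    have Nv: "set (A v) \<subseteq> {1..n}" "length (A v) \<le> \<Delta>" using vA v by (auto simp: valid_adj_def)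
    have Q0: "0 \<le> Q x \<sigma>" for x \<sigma> by (simp add: Q_def)
    \<comment> \<open>Whether \<open>v\<close> is settled and who is the culprit depend on \<sigma>.
      Adding up all possibilities removes this dependence, so that the sum over \<sigma> can be
      taken for each \<open>x\<close> separately.\<close>
    have "prob_of (reach (Suc s) us A \<sigma> (v # W)) \<le> prob_of (reach (Suc s) us A \<sigma> W) +
        (\<Sum>x\<in>insert v (set (A v)). if flawed A \<sigma> x then Q x \<sigma> else 0)" for \<sigma>
    proof (cases "settled A \<sigma> v")
      case True
      then have "reach (Suc s) us A \<sigma> (v # W) = reach (Suc s) us A \<sigma> W" by (simp add: fun_eq_iff)
      moreover have "0 \<le> (\<Sum>x\<in>insert v (set (A v)). if flawed A \<sigma> x then Q x \<sigma> else 0)"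
        using Q0 by (intro sum_nonneg) auto
      ultimately show ?thesis by simp
    next
      case False
      let ?x = "culprit A \<sigma> v"
      have "reach (Suc s) us A \<sigma> (v # W) = (\<lambda>\<omega>. reach s us A (resample A \<sigma> \<omega> (rev (A ?x))) (W' ?x)
          (\<lambda>i. \<omega> (i + length (A ?x))))"
        using False by (simp add: fun_eq_iff W'_def)
      then have "prob_of (reach (Suc s) us A \<sigma> (v # W)) = (if flawed A \<sigma> ?x then Q ?x \<sigma> else 0)"
        using culprit_flawed[OF False] by (simp add: Q_def)
      also have "\<dots> \<le> (\<Sum>x\<in>insert v (set (A v)). if flawed A \<sigma> x then Q x \<sigma> else 0)"
        using Q0 culprit_flawed[OF False] by (intro member_le_sum) auto
      finally show ?thesis by (simp add: add_increasing)
    qed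
    then have "(\<Sum>\<sigma>\<in>colorings A. prob_of (reach (Suc s) us A \<sigma> (v # W))) \<le>
      (\<Sum>\<sigma>\<in>colorings A. prob_of (reach (Suc s) us A \<sigma> W) +
        (\<Sum>x\<in>insert v (set (A v)). if flawed A \<sigma> x then Q x \<sigma> else 0))"
      by (rule sum_mono)
    also have "\<dots> = (\<Sum>\<sigma>\<in>colorings A. prob_of (reach (Suc s) us A \<sigma> W)) +
        (\<Sum>x\<in>insert v (set (A v)). \<Sum>\<sigma>\<in>{\<sigma>\<in>colorings A. flawed A \<sigma> x}. Q x \<sigma>)"
      unfolding sum.distrib by (subst sum.swap) (simp add: sum.inter_filter finite_colorings)
    also have "\<dots> \<le> N * \<rho> ^ Suc s * 4 ^ length us * b ^ length W +
        (\<Sum>x\<in>insert v (set (A v)). exp 1 * flaw_bound * (N * \<rho> ^ s * 4 ^ length us * b ^ (length W + (\<Delta> + 1))))"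
    proof (intro add_mono IH sum_mono)
      fix x assume "x \<in> insert v (set (A v))"
      then have x: "x \<in> {1..n}" using v Nv by auto
      have dx: "set (A x) \<subseteq> {1..n}" "length (A x) \<le> \<Delta>" using vA x by (auto simp: valid_adj_def)
      have "(\<Sum>\<sigma>\<in>{\<sigma>\<in>colorings A. flawed A \<sigma> x}. Q x \<sigma>) \<le>
        exp 1 * flaw_bound * (\<Sum>\<tau>\<in>colorings A. prob_of (reach s us A \<tau> (W' x)))"
        unfolding Q_def by (rule sum_flawed_resample_le[OF vA x q size pred_reach])
      also have "\<dots> \<le> exp 1 * flaw_bound * (N * \<rho> ^ s * 4 ^ length us * b ^ (length W + (\<Delta> + 1)))"
      proof (intro mult_left_mono)
        have "(\<Sum>\<tau>\<in>colorings A. prob_of (reach s us A \<tau> (W' x))) \<le> N * \<rho> ^ s * 4 ^ length us * b ^ length (W' x)"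
          unfolding N_def b_def using vW dx by (intro Suc.IH A) (auto simp: W'_def set_fold_push)
        also have "\<dots> \<le> N * \<rho> ^ s * 4 ^ length us * b ^ (length W + (\<Delta> + 1))"
        proof (intro mult_left_mono power_increasing b1)
          show "length (W' x) \<le> length W + (\<Delta> + 1)"
            using length_fold_push[of "rev (A x)" "v # W"] dx by (simp add: W'_def)
        qed (use N0 \<rho> in auto)
        finally show "(\<Sum>\<tau>\<in>colorings A. prob_of (reach s us A \<tau> (W' x))) \<le>
          N * \<rho> ^ s * 4 ^ length us * b ^ (length W + (\<Delta> + 1))" .
      qed (auto simp: flaw_bound_def)
      finally show "(\<Sum>\<sigma>\<in>{\<sigma>\<in>colorings A. flawed A \<sigma> x}. Q x \<sigma>) \<le>
        exp 1 * flaw_bound * (N * \<rho> ^ s * 4 ^ length us * b ^ (length W + (\<Delta> + 1)))" .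
    qed
    also have "\<dots> \<le> N * \<rho> ^ Suc s * 4 ^ length us * b ^ length W +
        (real \<Delta> + 1) * (exp 1 * flaw_bound * (N * \<rho> ^ s * 4 ^ length us * b ^ (length W + (\<Delta> + 1))))"
    proof -
      have "card (insert v (set (A v))) \<le> \<Delta> + 1"
        using Nv card_length[of "A v"] by (simp add: card_insert_if)
      then have "real (card (insert v (set (A v)))) \<le> real \<Delta> + 1" by linarith
      then have "real (card (insert v (set (A v)))) * (exp 1 * flaw_bound * (N * \<rho> ^ s * 4 ^ length us * b ^ (length W + (\<Delta> + 1)))) \<le>
        (real \<Delta> + 1) * (exp 1 * flaw_bound * (N * \<rho> ^ s * 4 ^ length us * b ^ (length W + (\<Delta> + 1))))"
        using N0 \<rho> b1 by (intro mult_right_mono) (auto simp: flaw_bound_def)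
      then show ?thesis by simp
    qed
    also have "\<dots> = K * (\<rho> + (real \<Delta> + 1) * (exp 1 * flaw_bound * b ^ (\<Delta> + 1)))"
      by (simp only: K_def power_add power_Suc distrib_left mult_ac)
    also have "\<dots> \<le> K * (\<rho> + \<rho> / real \<Delta>)"
      using N0 \<rho> b1 small by (intro mult_left_mono add_left_mono) (auto simp: b_def K_def)
    \<comment> \<open>This identity dictates the weight \<open>b\<close> of a worklist
      entry.\<close>
    also have "\<rho> + \<rho> / real \<Delta> = \<rho> * b"
      by (simp only: b_def distrib_left mult_1_right times_divide_eq_right)
    also have "K * (\<rho> * b) = N * \<rho> ^ Suc s * 4 ^ length us * b ^ length (v # W)"
      by (simp only: K_def power_Suc length_Cons mult_ac)
    finally show ?thesis .
  qed
  \<comment> \<open>The empty worklist is a premise here because its bound comes from the next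
    update; \<open>nil\<close> supplies it by induction on the updates, using \<open>all\<close> for
    the worklist after the update.\<close>
  have all: "set W \<subseteq> {1..n} \<Longrightarrow> (\<Sum>\<sigma>\<in>colorings A. prob_of (reach (Suc s) us A \<sigma> W)) \<le>
      N * \<rho> ^ Suc s * 4 ^ length us * b ^ length W"
    if "valid_adjs A us" "(\<Sum>\<sigma>\<in>colorings A. prob_of (reach (Suc s) us A \<sigma> [])) \<le> N * \<rho> ^ Suc s * 4 ^ length us"
    for A us W
  proof (induction W)
    case Nil
    then show ?case using that(2) by simp
  next
    case (Cons v W)
    then show ?case by (intro step that(1)) auto
  qed
  have nil: "(\<Sum>\<sigma>\<in>colorings A. prob_of (reach (Suc s) us A \<sigma> [])) \<le> N * \<rho> ^ Suc s * 4 ^ length us"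
    if "valid_adjs A us" for A us
    using that
  proof (induction us arbitrary: A)
    case Nil
    have "reach (Suc s) [] A \<sigma> [] = (\<lambda>_. False)" for \<sigma> by (simp add: fun_eq_iff)
    then have "(\<Sum>\<sigma>\<in>colorings A. prob_of (reach (Suc s) [] A \<sigma> [])) = 0"
      by (intro sum.neutral) (simp add: prob_of_def)
    moreover have "0 \<le> N * \<rho> ^ Suc s * 4 ^ length ([] :: update list)" using N0 \<rho> by simp
    ultimately show ?case by linarith
  next
    case (Cons u us)
    let ?A = "update_adj u A"
    have ok: "endpoints_ok n u" and v': "valid_adjs ?A us" using Cons.prems by auto
    have "reach (Suc s) (u # us) A \<sigma> [] = reach (Suc s) us ?A (update_col u \<sigma>) (update_work u)" for \<sigma>
      by (simp add: fun_eq_iff)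
    then have "(\<Sum>\<sigma>\<in>colorings A. prob_of (reach (Suc s) (u # us) A \<sigma> [])) \<le>
        2 * (\<Sum>\<tau>\<in>colorings ?A. prob_of (reach (Suc s) us ?A \<tau> (update_work u)))"
      using sum_update_le[OF ok, of "\<lambda>\<tau>. prob_of (reach (Suc s) us ?A \<tau> (update_work u))" A] by simp
    also have "\<dots> \<le> 2 * (N * \<rho> ^ Suc s * 4 ^ length us * b ^ length (update_work u))"
      by (rule mult_left_mono[OF all[OF v' Cons.IH[OF v'] set_update_work[OF ok]]]) simp
    also have "\<dots> \<le> 2 * (N * \<rho> ^ Suc s * 4 ^ length us * 2)"
    proof -
      have "b ^ length (update_work u) \<le> 2" using b1 by (cases u) auto
      then show ?thesis using N0 \<rho> by (intro mult_left_mono) auto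
    qed
    also have "\<dots> = N * \<rho> ^ Suc s * 4 ^ length (u # us)" by simp
    finally show ?case .
  qed
  show ?case using all[OF Suc.prems(1) nil[OF Suc.prems(1)] Suc.prems(2)] by (simp add: N_def b_def)
qed

end

section \<open>Timed execution of programs\<close>

text \<open>Total correctness with a time budget. The budget is an integer, so that subtracting
  along a program never truncates. The continuation \<open>rest\<close> is arbitrary because
  branches and loops unfold onto the list of commands still to be executed.\<close>

definition hoare :: "nat \<Rightarrow> (nat \<Rightarrow> nat) \<Rightarrow> com list \<Rightarrow> int \<Rightarrow> (nat \<Rightarrow> nat) \<Rightarrow> (nat \<Rightarrow> nat) \<Rightarrow> nat \<Rightarrow>
    ((nat \<Rightarrow> nat) \<Rightarrow> (nat \<Rightarrow> nat) \<Rightarrow> nat \<Rightarrow> bool) \<Rightarrow> bool" where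
  "hoare w \<omega> p T R M D Q \<longleftrightarrow> (\<exists>k R' M' D'. int k \<le> T \<and> Q R' M' D' \<and>
     (\<forall>rest. (step w \<omega> ^^ k) \<lparr>todo = p @ rest, regs = R, mem = M, drawn = D\<rparr> =
       \<lparr>todo = rest, regs = R', mem = M', drawn = D'\<rparr>))"

lemma hoare_Nil: "0 \<le> T \<Longrightarrow> Q R M D \<Longrightarrow> hoare w \<omega> [] T R M D Q"
  unfolding hoare_def by (intro exI[of _ 0] exI[of _ R] exI[of _ M] exI[of _ D]) auto

lemma hoare_step:
  assumes "\<And>rest. step w \<omega> \<lparr>todo = c # p @ rest, regs = R, mem = M, drawn = D\<rparr> =
      \<lparr>todo = p' @ rest, regs = R', mem = M', drawn = D'\<rparr>"
    and "hoare w \<omega> p' (T - 1) R' M' D' Q"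
  shows "hoare w \<omega> (c # p) T R M D Q"
proof -
  from assms(2) obtain k R'' M'' D'' where k: "int k \<le> T - 1" "Q R'' M'' D''"
    "\<And>rest. (step w \<omega> ^^ k) \<lparr>todo = p' @ rest, regs = R', mem = M', drawn = D'\<rparr> =
       \<lparr>todo = rest, regs = R'', mem = M'', drawn = D''\<rparr>"
    unfolding hoare_def by blast
  have "(step w \<omega> ^^ Suc k) \<lparr>todo = (c # p) @ rest, regs = R, mem = M, drawn = D\<rparr> =
       \<lparr>todo = rest, regs = R'', mem = M'', drawn = D''\<rparr>" for rest
    using assms(1)[of rest] k(3)[of rest] by (simp del: funpow.simps add: funpow_Suc_right)
  moreover have "int (Suc k) \<le> T" using k(1) by simp
  ultimately show ?thesis using k(2) unfolding hoare_def by blast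
qed

lemma hoare_Const: "hoare w \<omega> p (T - 1) (R(r := k mod 2 ^ w)) M D Q \<Longrightarrow> hoare w \<omega> (Const r k # p) T R M D Q"
  by (rule hoare_step) (auto simp: step_def)
lemma hoare_Op: "hoare w \<omega> p (T - 1) (R(r := word_op w f (R a) (R b))) M D Q \<Longrightarrow> hoare w \<omega> (Op f r a b # p) T R M D Q"
  by (rule hoare_step) (auto simp: step_def)
lemma hoare_Load: "hoare w \<omega> p (T - 1) (R(r := M (R a))) M D Q \<Longrightarrow> hoare w \<omega> (Load r a # p) T R M D Q"
  by (rule hoare_step) (auto simp: step_def)
lemma hoare_Store: "hoare w \<omega> p (T - 1) R (M(R a := R r)) D Q \<Longrightarrow> hoare w \<omega> (Store a r # p) T R M D Q"
  by (rule hoare_step) (auto simp: step_def)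
lemma hoare_Rand: "hoare w \<omega> p (T - 1) (R(r := \<omega> D)) M (Suc D) Q \<Longrightarrow> hoare w \<omega> (Rand r # p) T R M D Q"
  by (rule hoare_step) (auto simp: step_def)
lemma hoare_Cond: "hoare w \<omega> ((if R r \<noteq> 0 then a else b) @ p) (T - 1) R M D Q \<Longrightarrow> hoare w \<omega> (Cond r a b # p) T R M D Q"
  by (rule hoare_step) (auto simp: step_def)
lemma hoare_Loop_exit: "R r = 0 \<Longrightarrow> hoare w \<omega> p (T - 1) R M D Q \<Longrightarrow> hoare w \<omega> (Loop r b # p) T R M D Q"
  by (rule hoare_step) (auto simp: step_def)
lemma hoare_Loop_enter: "R r \<noteq> 0 \<Longrightarrow> hoare w \<omega> (b @ Loop r b # p) (T - 1) R M D Q \<Longrightarrow> hoare w \<omega> (Loop r b # p) T R M D Q"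
  by (rule hoare_step[where p' = "b @ Loop r b # p"]) (auto simp: step_def)

lemma hoare_append:
  assumes "hoare w \<omega> p t R M D Q'" "\<And>R' M' D'. Q' R' M' D' \<Longrightarrow> hoare w \<omega> p' (T - t) R' M' D' Q"
  shows "hoare w \<omega> (p @ p') T R M D Q"
proof -
  from assms(1) obtain k R' M' D' where k: "int k \<le> t" "Q' R' M' D'"
    "\<And>rest. (step w \<omega> ^^ k) \<lparr>todo = p @ rest, regs = R, mem = M, drawn = D\<rparr> =
       \<lparr>todo = rest, regs = R', mem = M', drawn = D'\<rparr>"
    unfolding hoare_def by blast
  from assms(2)[OF k(2)] obtain k' R'' M'' D'' where k': "int k' \<le> T - t" "Q R'' M'' D''"
    "\<And>rest. (step w \<omega> ^^ k') \<lparr>todo = p' @ rest, regs = R', mem = M', drawn = D'\<rparr> =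
       \<lparr>todo = rest, regs = R'', mem = M'', drawn = D''\<rparr>"
    unfolding hoare_def by blast
  have "(step w \<omega> ^^ (k' + k)) \<lparr>todo = (p @ p') @ rest, regs = R, mem = M, drawn = D\<rparr> =
       \<lparr>todo = rest, regs = R'', mem = M'', drawn = D''\<rparr>" for rest
    using k(3)[of "p' @ rest"] k'(3)[of rest] by (simp add: funpow_add)
  moreover have "int (k' + k) \<le> T" using k(1) k'(1) by simp
  ultimately show ?thesis using k'(2) unfolding hoare_def by blast
qed

lemma hoare_mono: "hoare w \<omega> p T R M D Q \<Longrightarrow> T \<le> T' \<Longrightarrow> (\<And>R M D. Q R M D \<Longrightarrow> Q' R M D) \<Longrightarrow> hoare w \<omega> p T' R M D Q'"
  unfolding hoare_def by (meson order_trans)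

text \<open>\<open>I j\<close> is the invariant with \<open>j\<close> rounds left. The body lowers
  the counter itself; a round costs \<open>t\<close> plus one test, and leaving the loop costs one
  more test.\<close>

lemma hoare_for:
  assumes "I m R M D" "R c = m" "0 \<le> t"
    and body: "\<And>i R M D. i < m \<Longrightarrow> R c = Suc i \<Longrightarrow> I (Suc i) R M D \<Longrightarrow>
      hoare w \<omega> b t R M D (\<lambda>R M D. R c = i \<and> I i R M D)"
    and exit: "\<And>R M D. R c = 0 \<Longrightarrow> I 0 R M D \<Longrightarrow> hoare w \<omega> p (T - int m * (t + 1) - 1) R M D Q"
  shows "hoare w \<omega> (Loop c b # p) T R M D Q"
proof -
  have "j \<le> m \<Longrightarrow> R c = j \<Longrightarrow> I j R M D \<Longrightarrow> hoare w \<omega> (Loop c b # p) (T - int (m - j) * (t + 1)) R M D Q" for j R M D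
  proof (induction j arbitrary: R M D)
    case 0
    then show ?case by (intro hoare_Loop_exit) (auto intro: exit)
  next
    case (Suc j)
    have "hoare w \<omega> (b @ Loop c b # p) (T - int (m - Suc j) * (t + 1) - 1) R M D Q"
    proof (rule hoare_append[OF body])
      fix R' M' D' assume "R' c = j \<and> I j R' M' D'"
      then have "hoare w \<omega> (Loop c b # p) (T - int (m - j) * (t + 1)) R' M' D' Q"
        using Suc by auto
      moreover have "int (m - j) = int (m - Suc j) + 1" using Suc.prems by simp
      ultimately show "hoare w \<omega> (Loop c b # p) (T - int (m - Suc j) * (t + 1) - 1 - t) R' M' D' Q"
        by (simp add: algebra_simps)
    qed (use Suc.prems in auto)
    then show ?case using Suc.prems by (intro hoare_Loop_enter) auto
  qed
  from this[of m R M D] show ?thesis using assms by simp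
qed

lemma step_halted: "todo s = [] \<Longrightarrow> (step w \<omega> ^^ k) s = s"
  by (induction k) (auto simp: step_def)

text \<open>A halted machine does not move, so the state after any halting number of steps is the
  state after the least one.\<close>

lemma execute_eq:
  assumes k: "todo ((step w \<omega> ^^ k) s) = []"
  shows "\<exists>k'\<le>k. execute w \<omega> s = Some ((step w \<omega> ^^ k) s, k')"
proof -
  let ?P = "\<lambda>k. todo ((step w \<omega> ^^ k) s) = []"
  define k0 where "k0 = (LEAST k. ?P k)"
  have k0: "?P k0" "k0 \<le> k" unfolding k0_def using k by (auto intro: LeastI Least_le)
  have "(step w \<omega> ^^ k) s = (step w \<omega> ^^ (k - k0)) ((step w \<omega> ^^ k0) s)"
    using k0(2) by (simp flip: funpow_add comp_apply[of "(step w \<omega> ^^ (k - k0))"])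
  also have "\<dots> = (step w \<omega> ^^ k0) s" by (rule step_halted[OF k0(1)])
  finally show ?thesis using k k0 by (auto simp: execute_def k0_def Let_def)
qed

lemma hoare_execute:
  assumes "hoare w \<omega> p T R M D Q"
  shows "\<exists>R' M' D' k. int k \<le> T \<and> Q R' M' D' \<and>
    execute w \<omega> \<lparr>todo = p, regs = R, mem = M, drawn = D\<rparr> =
      Some (\<lparr>todo = [], regs = R', mem = M', drawn = D'\<rparr>, k)"
proof -
  from assms obtain k R' M' D' where k: "int k \<le> T" "Q R' M' D'"
    "(step w \<omega> ^^ k) \<lparr>todo = p @ [], regs = R, mem = M, drawn = D\<rparr> =
       \<lparr>todo = [], regs = R', mem = M', drawn = D'\<rparr>"
    unfolding hoare_def by blast
  then show ?thesis using execute_eq[where w = w and \<omega> = \<omega> and k = k and s = "\<lparr>todo = p, regs = R, mem = M, drawn = D\<rparr>"]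
    by (fastforce intro: order_trans)
qed

text \<open>
  Among the colors in \<open>{lo..<lo + m}\<close> unused in the neighborhood of \<open>v\<close>, this program counts those
  and finds the \<open>j\<close>-th from the top.  The arguments \<open>v\<close>, \<open>lo\<close>, \<open>m\<close>, \<open>j\<close> are in the registers 20 to 23,
  the results in the registers 24 and 25.  Registers 3 to 8 hold constants and register 18 is always 0.
\<close>

definition scan_prog :: "com list" where
  "scan_prog =
    [Op Plus 26 8 21, Op Plus 27 22 18,
     Loop 27 [Op Minus 27 27 3, Op Plus 28 26 27, Store 28 18],
     Op Times 28 20 4, Load 27 28,
     Loop 27 [Op Plus 29 28 27, Load 29 29, Load 29 29, Op Plus 29 8 29, Store 29 3, Op Minus 27 27 3],
     Op Plus 27 22 18, Const 24 0,
     Loop 27 [Op Minus 27 27 3, Op Plus 28 26 27, Load 28 28,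
       Cond 28 [] [Op Equal 28 24 23, Cond 28 [Op Plus 25 21 27] [], Op Plus 24 24 3]]]"

text \<open>
  The worklist is stored as a linked list: the cell of a vertex in the list holds the next vertex plus
  one (so 1 at the end of the list), and the cell of a vertex outside the list holds 0.
\<close>

fun link :: "nat list \<Rightarrow> nat \<Rightarrow> nat" where
  "link [] v = 0"
| "link (x # W) v = (if v = x then Suc (case W of [] \<Rightarrow> 0 | y # _ \<Rightarrow> y) else link W v)"

definition same_off :: "nat set \<Rightarrow> (nat \<Rightarrow> nat) \<Rightarrow> (nat \<Rightarrow> nat) \<Rightarrow> bool" where
  "same_off X R R' \<longleftrightarrow> (\<forall>k. k \<notin> X \<longrightarrow> R' k = R k)"

text \<open>Serves both palettes: with \<open>Suc r\<close> and \<open>q\<close> it is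
  \<open>avail\<close>, with \<open>0\<close> and \<open>r\<close> it lists secondary colors. The
  descending order is that of the last loop of \<open>scan_prog\<close>, so that positions in the
  list mean the same to the program.\<close>

definition free_colors :: "adjacency \<Rightarrow> (nat \<Rightarrow> nat) \<Rightarrow> nat \<Rightarrow> nat \<Rightarrow> nat \<Rightarrow> nat list" where
  "free_colors A \<sigma> v lo m = filter (\<lambda>c. c \<notin> \<sigma> ` set (A v)) (rev [lo..<lo + m])"

lemma pick_snoc: "pick d (xs @ [c]) j = (if j = length xs then c else pick d xs j)"
  by (auto simp: pick_def nth_append)

text \<open>A row has to hold \<open>n\<close> colors and five parameters, or a degree, up to
  \<open>\<Delta> + 1\<close> neighbors and a worklist cell, or one mark per color; \<open>N\<close>
  and \<open>palette\<close> provide for all three. By \<open>fits\<close>, every address in the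
  rows 0 to \<open>n + 1\<close> is a word.\<close>

locale recolor_machine = recolor +
  fixes N :: nat and \<omega> :: "nat \<Rightarrow> nat"
  assumes N: "N = n + \<Delta> + 8" and fits: "(n + 2) * N < 2 ^ w" and r: "1 \<le> r"
    and palette: "r + q + 2 \<le> N" and l_fits: "l < 2 ^ w"
begin

text \<open>
  The memory is divided into rows of length \<open>N\<close>.  Row 0 holds the colors and, at its end, the parameters.
  Row \<open>v\<close> holds the degree of \<open>v\<close>, its neighbors, and its cell of the worklist.  Row \<open>n + 1\<close> is scratch
  space of \<open>scan_prog\<close>, which marks the colors in the neighborhood of a vertex there.
\<close>

definition rep :: "(nat \<Rightarrow> nat) \<Rightarrow> adjacency \<Rightarrow> (nat \<Rightarrow> nat) \<Rightarrow> nat list \<Rightarrow> bool" where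
  "rep M A \<sigma> W \<longleftrightarrow> M 0 = N \<and> M (N - 1) = r \<and> M (N - 2) = q \<and> M (N - 3) = l \<and> M (N - 4) = (n + 1) * N \<and>
     (\<forall>v\<in>{1..n}. M v = \<sigma> v \<and> M (v * N) = length (A v) \<and> (\<forall>i<length (A v). M (v * N + Suc i) = A v ! i) \<and>
        M (v * N + N - 1) = link W v)"

definition loaded :: "(nat \<Rightarrow> nat) \<Rightarrow> bool" where
  "loaded R \<longleftrightarrow> R 3 = 1 \<and> R 4 = N \<and> R 5 = r \<and> R 6 = q \<and> R 7 = l \<and> R 8 = (n + 1) * N \<and> R 18 = 0"

lemma loaded_same_off:
  "loaded R \<Longrightarrow> same_off X R R' \<Longrightarrow> X \<inter> {3, 4, 5, 6, 7, 8, 18} = {} \<Longrightarrow> loaded R'"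
  by (auto simp: loaded_def same_off_def)

lemma fits_row: "a \<le> n + 1 \<Longrightarrow> i \<le> N \<Longrightarrow> a * N + i < 2 ^ w"
proof -
  assume "a \<le> n + 1" "i \<le> N"
  then have "a * N + i \<le> (n + 1) * N + N" by (intro add_mono mult_right_mono) auto
  also have "\<dots> = (n + 2) * N" by simp
  finally show ?thesis using fits by simp
qed

lemma fits_N: "i \<le> N \<Longrightarrow> i < 2 ^ w"
  using fits_row[of 0 i] by simp

text \<open>\<open>scan_prog\<close> writes to row \<open>n + 1\<close> only, beyond everything that
  \<open>rep\<close> speaks about.\<close>

lemma rep_agree:
  assumes "rep M A \<sigma> W" "\<And>a. a < (n + 1) * N \<Longrightarrow> M' a = M a" "valid_adj A"
  shows "rep M' A \<sigma> W"
proof -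
  have N0: "N \<ge> 8" using N by simp
  have small: "i < (n + 1) * N" if "i < N" for i using that by (simp add: trans_less_add1)
  have row: "v * N + i < (n + 1) * N" if "v \<in> {1..n}" "i < N" for v i
  proof -
    have "v * N + i < (v + 1) * N" using that by simp
    also have "\<dots> \<le> (n + 1) * N" using that by (intro mult_right_mono) auto
    finally show ?thesis .
  qed
  have len: "length (A v) < N - 1" if "v \<in> {1..n}" for v
  proof -
    have "length (A v) \<le> \<Delta>" using assms(3) that by (auto simp: valid_adj_def)
    then show ?thesis using N by simp
  qed
  have "M' v = M v" "M' (v * N) = M (v * N)" "M' (v * N + N - 1) = M (v * N + N - 1)"
    "\<And>i. i < length (A v) \<Longrightarrow> M' (v * N + Suc i) = M (v * N + Suc i)"
    if v: "v \<in> {1..n}" for v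
  proof -
    show "M' v = M v" using v N by (intro assms(2) small) auto
    show "M' (v * N) = M (v * N)" using row[OF v, of 0] N0 by (intro assms(2)) auto
    show "M' (v * N + N - 1) = M (v * N + N - 1)" using row[OF v, of "N - 1"] N0 by (intro assms(2)) auto
    show "M' (v * N + Suc i) = M (v * N + Suc i)" if "i < length (A v)" for i
      using row[OF v, of "Suc i"] len[OF v] that by (intro assms(2)) auto
  qed
  moreover have "M' 0 = M 0" "M' (N - 1) = M (N - 1)" "M' (N - 2) = M (N - 2)" "M' (N - 3) = M (N - 3)"
    "M' (N - 4) = M (N - 4)"
    using N0 by (auto intro!: assms(2) small)
  ultimately show ?thesis using assms(1) unfolding rep_def by simp
qed

lemma scan_prog_correct:
  assumes R: "loaded R" and M: "rep M A \<sigma> W" and A: "valid_adj A" and v: "v \<in> {1..n}"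
    and \<sigma>: "\<And>y. y \<in> {1..n} \<Longrightarrow> \<sigma> y \<le> r + q"
    and in20: "R 20 = v" and in21: "R 21 = lo" and in22: "R 22 = m" and lo: "lo + m \<le> r + q + 1"
  shows "hoare w \<omega> scan_prog (13 * int m + 7 * int \<Delta> + 12) R M D (\<lambda>R' M' D'. D' = D \<and>
    same_off {24..30} R R' \<and> R' 24 = length (free_colors A \<sigma> v lo m) \<and>
    R' 25 = pick (R 25) (free_colors A \<sigma> v lo m) (R 23) \<and> (\<forall>a<(n + 1) * N. M' a = M a))"
proof -
  define MB where "MB = (n + 1) * N"
  have mb: "MB + i < 2 ^ w" if "i \<le> N" for i using fits_row[of "n + 1" i] that by (simp add: MB_def)
  have m_lt: "m < 2 ^ w" using lo palette by (intro fits_N) simp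
  have c: "R 3 = 1" "R 4 = N" "R 8 = MB" "R 18 = 0" using R by (auto simp: loaded_def MB_def)
  have len: "length (A v) \<le> \<Delta>" using A v by (auto simp: valid_adj_def)
  have row: "v * N + i < MB" if "i < N" for i
  proof -
    have "v * N + i < (v + 1) * N" using that by simp
    also have "\<dots> \<le> MB" using v unfolding MB_def by (intro mult_right_mono) auto
    finally show ?thesis .
  qed
  have w1: "(1::nat) < 2 ^ w" using fits_N[of 1] N by simp
  have vN: "v * N + i < 2 ^ w" if "i \<le> N" for i using v that by (intro fits_row) auto
  have deg: "M (v * N) = length (A v)" and nth: "i < length (A v) \<Longrightarrow> M (v * N + Suc i) = A v ! i" for i
    using M v by (auto simp: rep_def)
  have colM: "M y = \<sigma> y" if "y \<in> {1..n}" for y using M that by (auto simp: rep_def)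
  have Av: "A v ! i \<in> {1..n}" if "i < length (A v)" for i
    using A v that nth_mem[OF that] unfolding valid_adj_def by blast
  have low: "y < MB" if "y \<in> {1..n}" for y
  proof -
    have "y < N" using that N by simp
    also have "N \<le> MB" by (simp add: MB_def)
    finally show ?thesis .
  qed
  define keep where "keep M' \<longleftrightarrow> (\<forall>a<MB. M' a = M a)" for M' :: "nat \<Rightarrow> nat"
  define fr where "fr R' \<longleftrightarrow> same_off {24..30} R R'" for R' :: "nat \<Rightarrow> nat"
  have frD: "R' 3 = 1" "R' 4 = N" "R' 8 = MB" "R' 18 = 0" "R' 20 = v" "R' 21 = lo" "R' 22 = m" "R' 23 = R 23" if "fr R'" for R'
    using that c in20 in21 in22 by (auto simp: fr_def same_off_def)
  have fr_upd: "fr (R'(k := x))" if "fr R'" "k \<in> {24..30}" for R' k x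
    using that by (auto simp: fr_def same_off_def)
  define inv1 where "inv1 i R' M' D' \<longleftrightarrow> D' = D \<and> fr R' \<and> R' 25 = R 25 \<and> R' 26 = MB + lo \<and> keep M' \<and>
    (\<forall>c\<in>{lo + i..<lo + m}. M' (MB + c) = 0)" for i :: nat and R' M' and D' :: nat
  define inv2 where "inv2 i R' M' D' \<longleftrightarrow> D' = D \<and> fr R' \<and> R' 25 = R 25 \<and> R' 26 = MB + lo \<and> R' 28 = v * N \<and> keep M' \<and>
    (\<forall>c\<in>{lo..<lo + m}. M' (MB + c) = of_bool (c \<in> \<sigma> ` set (drop i (A v))))" for i :: nat and R' M' and D' :: nat
  define inv3 where "inv3 i R' M' D' \<longleftrightarrow> D' = D \<and> fr R' \<and> R' 26 = MB + lo \<and> keep M' \<and>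
    R' 24 = length (free_colors A \<sigma> v (lo + i) (m - i)) \<and>
    R' 25 = pick (R 25) (free_colors A \<sigma> v (lo + i) (m - i)) (R 23) \<and>
    (\<forall>c\<in>{lo..<lo + m}. M' (MB + c) = of_bool (c \<in> \<sigma> ` set (A v)))" for i :: nat and R' M' and D' :: nat
  have body1: "hoare w \<omega> [Op Minus 27 27 3, Op Plus 28 26 27, Store 28 18] 3 R' M' D'
      (\<lambda>R M D. R 27 = i \<and> inv1 i R M D)"
    if i: "i < m" and i1: "R' 27 = Suc i" and inv: "inv1 (Suc i) R' M' D'" for i R' M' D'
  proof -
    have f: "fr R'" using inv by (simp add: inv1_def)
    have "MB + lo + i < 2 ^ w" using mb[of "lo + i"] i lo palette by (simp add: add.assoc)
    moreover have "Suc i < 2 ^ w" "i < 2 ^ w" using i m_lt by auto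
    ultimately show ?thesis
      using inv i1 frD[OF f]
      by (intro hoare_Op hoare_Store hoare_Nil) (auto simp: inv1_def fr_upd keep_def add.assoc le_eq_less_or_eq Suc_le_eq)
  qed
  have body2: "hoare w \<omega> [Op Plus 29 28 27, Load 29 29, Load 29 29, Op Plus 29 8 29, Store 29 3, Op Minus 27 27 3] 6 R' M' D'
      (\<lambda>R M D. R 27 = i \<and> inv2 i R M D)"
    if i: "i < length (A v)" and i1: "R' 27 = Suc i" and inv: "inv2 (Suc i) R' M' D'" for i R' M' D'
  proof -
    have f: "fr R'" using inv by (simp add: inv2_def)
    have iN: "Suc i < N" using i len N by simp
    have a1: "v * N + Suc i < 2 ^ w" using iN by (intro vN) simp
    have m1: "M' (v * N + Suc i) = A v ! i" using inv row[OF iN] nth[OF i] by (auto simp: inv2_def keep_def)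
    have m2: "M' (A v ! i) = \<sigma> (A v ! i)" using inv low[OF Av[OF i]] colM[OF Av[OF i]] by (auto simp: inv2_def keep_def)
    have a2: "MB + \<sigma> (A v ! i) < 2 ^ w" using \<sigma>[OF Av[OF i]] palette by (intro mb) simp
    have dr: "set (drop i (A v)) = insert (A v ! i) (set (drop (Suc i) (A v)))"
      using Cons_nth_drop_Suc[OF i] by (metis list.simps(15))
    have "Suc i < 2 ^ w" "i < 2 ^ w" using iN fits_N[of "Suc i"] by auto
    then show ?thesis
      using inv i1 frD[OF f] a1 a2 m1 m2
      by (intro hoare_Op hoare_Load hoare_Store hoare_Nil) (auto simp: inv2_def fr_upd keep_def dr)
  qed
  have body3: "hoare w \<omega> [Op Minus 27 27 3, Op Plus 28 26 27, Load 28 28,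
       Cond 28 [] [Op Equal 28 24 23, Cond 28 [Op Plus 25 21 27] [], Op Plus 24 24 3]] 8 R' M' D'
      (\<lambda>R M D. R 27 = i \<and> inv3 i R M D)"
    if i: "i < m" and i1: "R' 27 = Suc i" and inv: "inv3 (Suc i) R' M' D'" for i R' M' D'
  proof -
    have f: "fr R'" using inv by (simp add: inv3_def)
    have a: "MB + lo + i < 2 ^ w" using mb[of "lo + i"] i lo palette by (simp add: add.assoc)
    have i2: "Suc i < 2 ^ w" "i < 2 ^ w" using i m_lt by auto
    have lo_i: "lo + i < 2 ^ w" using a by simp
    have mi: "lo + Suc i + (m - Suc i) = lo + m" "lo + i + (m - i) = lo + m" using i by auto
    have "[lo + i..<lo + m] = (lo + i) # [lo + Suc i..<lo + m]" using i by (simp add: upt_conv_Cons)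
    then have fc: "free_colors A \<sigma> v (lo + i) (m - i) = free_colors A \<sigma> v (lo + Suc i) (m - Suc i) @
        (if lo + i \<in> \<sigma> ` set (A v) then [] else [lo + i])"
      unfolding free_colors_def mi by simp
    have "length (free_colors A \<sigma> v (lo + Suc i) (m - Suc i)) \<le> m - Suc i"
      unfolding free_colors_def
      by (rule order_trans[OF length_filter_le]) (simp only: length_rev length_upt diff_add_inverse)
    then have cnt: "Suc (length (free_colors A \<sigma> v (lo + Suc i) (m - Suc i))) < 2 ^ w" using m_lt i by linarith
    have mk: "M' (MB + lo + i) = of_bool (lo + i \<in> \<sigma> ` set (A v))" using inv i by (auto simp: inv3_def add.assoc)
    show ?thesis
      apply (intro hoare_Op hoare_Load hoare_Cond)
      using inv i1 frD[OF f] a i2 lo_i mk cnt fc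
      by (auto simp: inv3_def fr_upd pick_snoc intro!: hoare_Nil hoare_Op hoare_Cond)
  qed
  show ?thesis
    unfolding scan_prog_def
    apply (intro hoare_Op)
    apply (rule hoare_for[where I = inv1 and m = m and t = 3])
    subgoal using c in21 in22 mb[of lo] lo palette m_lt by (auto simp: inv1_def fr_def same_off_def keep_def)
    subgoal using c in22 m_lt by simp
    subgoal by simp
    subgoal by (rule body1)
    apply (intro hoare_Op hoare_Load)
    apply (rule hoare_for[where I = inv2 and m = "length (A v)" and t = 6])
    subgoal for R1 M1 D1
      using vN[of 0] row[of 0] deg N by (auto simp: inv1_def inv2_def fr_upd frD)
    subgoal for R1 M1 D1
      using vN[of 0] row[of 0] deg N by (auto simp: inv1_def keep_def frD)
    subgoal by simp
    subgoal by (rule body2)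
    apply (intro hoare_Op hoare_Const)
    apply (rule hoare_for[where I = inv3 and m = m and t = 8])
    subgoal using m_lt by (auto simp: inv2_def inv3_def fr_upd frD free_colors_def pick_def)
    subgoal using m_lt by (auto simp: inv2_def frD)
    subgoal by simp
    subgoal by (rule body3)
    apply (rule hoare_Nil)
    subgoal using len by (simp add: algebra_simps)
    subgoal by (auto simp: inv3_def fr_def keep_def MB_def)
    done
qed

end

section \<open>Subprograms for worklist, adjacency lists and colors\<close>

definition head :: "nat list \<Rightarrow> nat" where
  "head W = (case W of [] \<Rightarrow> 0 | y # _ \<Rightarrow> y)"

lemma head_simps [simp]: "head [] = 0" "head (y # W) = y"
  by (auto simp: head_def)

lemma link_eq_0_iff: "link W v = 0 \<longleftrightarrow> v \<notin> set W"
  by (induction W) auto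

lemma link_Cons: "link (v # W) y = (if y = v then Suc (head W) else link W y)"
  by (simp add: head_def)

declare link.simps(2) [simp del]
declare link_Cons [simp]

definition push_prog :: "com list" where
  "push_prog = [Op Times 26 20 4, Op Plus 26 26 4, Op Minus 26 26 3, Load 27 26,
     Cond 27 [] [Op Plus 28 9 3, Store 26 28, Op Plus 9 20 18]]"

definition pop_prog :: "com list" where
  "pop_prog = [Op Times 26 9 4, Op Plus 26 26 4, Op Minus 26 26 3, Load 27 26, Op Minus 9 27 3, Store 26 18]"

definition remove_prog :: "nat \<Rightarrow> nat \<Rightarrow> com list" where
  "remove_prog a b = [Op Times 10 a 4, Load 11 10, Op Plus 12 10 11, Load 12 12, Op Plus 13 11 18,
     Loop 13 [Op Plus 14 10 13, Load 15 14, Op Equal 16 15 b, Cond 16 [Store 14 12] [], Op Minus 13 13 3],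
     Op Minus 11 11 3, Store 10 11]"

definition append_prog :: "nat \<Rightarrow> nat \<Rightarrow> com list" where
  "append_prog a b = [Op Times 10 a 4, Load 11 10, Op Plus 11 11 3, Store 10 11, Op Plus 10 10 11, Store 10 b]"

definition count_prog :: "com list" where
  "count_prog = [Op Times 28 10 4, Load 27 28, Const 13 0,
     Loop 27 [Op Plus 29 28 27, Load 29 29, Load 29 29, Op Less 29 5 29, Cond 29 [] [Op Plus 13 13 3],
       Op Minus 27 27 3]]"

text \<open>The neighbors are visited from the last to the first and the result is overwritten, so
  that the first one with a short list remains.\<close>

definition culprit_prog :: "com list" where
  "culprit_prog = [Op Plus 15 10 18, Op Times 16 10 4, Load 17 16, Op Plus 21 5 3, Op Plus 22 6 18,
     Loop 17 ([Op Plus 20 16 17, Load 20 20] @ scan_prog @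
       [Op Less 24 24 7, Cond 24 [Op Plus 15 20 18] [], Op Minus 17 17 3])]"

text \<open>Two scans per neighbor: the first counts the available colors, which fixes the modulus
  for the random word, and the second looks up the color at the drawn position. Register 25 is set
  to \<open>r\<close> in between, so that the position past the end means blank.\<close>

definition resample_prog :: "com list" where
  "resample_prog = [Op Times 16 15 4, Load 17 16, Op Plus 21 5 3, Op Plus 22 6 18,
     Loop 17 ([Op Plus 20 16 17, Load 20 20] @ scan_prog @
       [Rand 31, Op Plus 24 24 3, Op Modulo 23 31 24, Op Plus 25 5 18] @ scan_prog @
       [Store 20 25] @ push_prog @ [Op Minus 17 17 3])]"

definition assign_prog :: "com list" where
  "assign_prog = [Op Plus 20 10 18, Const 21 0, Op Plus 22 5 18, Const 23 0] @ scan_prog @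
     [Store 10 25] @ pop_prog"

section \<open>Correctness of the subprograms\<close>

context recolor_machine
begin

lemma N_ge: "8 \<le> N" "n < N - 4" "n < N" "\<Delta> < N"
  using N by auto

lemma w_pos: "1 < (2::nat) ^ w"
  using fits_N[of 1] N_ge by simp

text \<open>Between the two halves of an update the lists are not symmetric, so the list operations
  can rely on a length bound only. The extra 1 leaves room for the entry appended by the first
  half.\<close>

definition short :: "adjacency \<Rightarrow> bool" where
  "short A \<longleftrightarrow> (\<forall>v\<in>{1..n}. length (A v) \<le> \<Delta> + 1)"

lemma valid_imp_short: "valid_adj A \<Longrightarrow> short A"
  by (fastforce simp: valid_adj_def short_def)

lemma word_minus: "y \<le> x \<Longrightarrow> x < 2 ^ w \<Longrightarrow> (x + 2 ^ w - y) mod 2 ^ w = x - (y :: nat)"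
proof -
  assume "y \<le> x" "x < 2 ^ w"
  then have "x + 2 ^ w - y = (x - y) + 2 ^ w" "x - y < 2 ^ w" by auto
  then show ?thesis by (simp only: mod_add_self2 mod_less)
qed

definition cell :: "(nat \<Rightarrow> nat) \<Rightarrow> nat \<Rightarrow> nat \<Rightarrow> nat" where
  "cell M a i = M (a * N + i)"

text \<open>Division with remainder by \<open>N\<close> recovers row and column from an
  address.\<close>

lemma cell_upd:
  assumes "i < N" "j < N"
  shows "cell (M(a * N + i := x)) b j = (if b = a \<and> j = i then x else cell M b j)"
proof -
  have "b = a \<and> j = i" if "b * N + j = a * N + i"
  proof -
    have "(b * N + j) div N = b" "(a * N + i) div N = a" using assms by simp_all
    then have "b = a" using that by simp
    then show ?thesis using that by simp
  qed
  then show ?thesis by (auto simp: cell_def)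
qed

lemma rep_cell: "rep M A \<sigma> W \<longleftrightarrow> cell M 0 0 = N \<and> cell M 0 (N - 1) = r \<and> cell M 0 (N - 2) = q \<and>
    cell M 0 (N - 3) = l \<and> cell M 0 (N - 4) = (n + 1) * N \<and>
    (\<forall>v\<in>{1..n}. cell M 0 v = \<sigma> v \<and> cell M v 0 = length (A v) \<and>
      (\<forall>i<length (A v). cell M v (Suc i) = A v ! i) \<and> cell M v (N - 1) = link W v)"
proof -
  have "v * N + N - 1 = v * N + (N - 1)" for v using N_ge by simp
  then show ?thesis by (simp add: rep_def cell_def)
qed

lemma short_len: "short A \<Longrightarrow> v \<in> {1..n} \<Longrightarrow> i < length (A v) \<Longrightarrow> Suc i < N - 1"
proof -
  assume "short A" "v \<in> {1..n}" "i < length (A v)"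
  then have "length (A v) \<le> \<Delta> + 1" by (auto simp: short_def)
  then show ?thesis using N \<open>i < length (A v)\<close> by simp
qed

lemma rep_cellD:
  assumes "rep M A \<sigma> W"
  shows "v \<in> {1..n} \<Longrightarrow> cell M 0 v = \<sigma> v" "v \<in> {1..n} \<Longrightarrow> cell M v 0 = length (A v)"
    "v \<in> {1..n} \<Longrightarrow> i < length (A v) \<Longrightarrow> cell M v (Suc i) = A v ! i"
    "v \<in> {1..n} \<Longrightarrow> cell M v (N - 1) = link W v"
  using assms by (simp_all add: rep_cell)

text \<open>Reduces the preservation of \<open>rep\<close> to a comparison of cells by row and
  column, so that each memory write below is checked without address arithmetic.\<close>

lemma rep_update:
  assumes "rep M A \<sigma> W" and short: "short A'"
    and 0: "\<And>j. j < N \<Longrightarrow> j \<notin> {1..n} \<Longrightarrow> cell M' 0 j = cell M 0 j"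
    and color: "\<And>v. v \<in> {1..n} \<Longrightarrow> cell M' 0 v = \<sigma>' v"
    and len: "\<And>v. v \<in> {1..n} \<Longrightarrow> cell M' v 0 = length (A' v)"
    and nth: "\<And>v i. v \<in> {1..n} \<Longrightarrow> i < length (A' v) \<Longrightarrow> Suc i < N - 1 \<Longrightarrow> cell M' v (Suc i) = A' v ! i"
    and link: "\<And>v. v \<in> {1..n} \<Longrightarrow> cell M' v (N - 1) = link W' v"
  shows "rep M' A' \<sigma>' W'"
  unfolding rep_cell
proof (intro conjI ballI allI impI)
  show "cell M' v (Suc i) = A' v ! i" if "v \<in> {1..n}" "i < length (A' v)" for v i
    using that by (rule nth) (rule short_len[OF short that])
  have *: "cell M' 0 0 = cell M 0 0" "cell M' 0 (N - 1) = cell M 0 (N - 1)" "cell M' 0 (N - 2) = cell M 0 (N - 2)"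
    "cell M' 0 (N - 3) = cell M 0 (N - 3)" "cell M' 0 (N - 4) = cell M 0 (N - 4)"
    using N_ge by (auto intro!: 0)
  show "cell M' 0 0 = N" "cell M' 0 (N - 1) = r" "cell M' 0 (N - 2) = q" "cell M' 0 (N - 3) = l"
    "cell M' 0 (N - 4) = (n + 1) * N"
    unfolding * using assms(1) by (simp_all add: rep_cell)
qed (auto simp: color len link[unfolded One_nat_def])

lemma rep_set_color:
  assumes "rep M A \<sigma> W" "v \<in> {1..n}" "short A"
  shows "rep (M(v := c)) A (\<sigma>(v := c)) W"
proof -
  have u: "cell (M(v := c)) b j = (if b = 0 \<and> j = v then c else cell M b j)" if "j < N" for b j
    using cell_upd[of v j M 0 c b] that assms(2) N_ge by simp
  show ?thesis
    by (rule rep_update[OF assms(1,3)]) (use assms(2) N_ge in \<open>auto simp: u rep_cellD[OF assms(1), unfolded One_nat_def]\<close>)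
qed

lemma rep_set_link:
  assumes "rep M A \<sigma> W" "v \<in> {1..n}" "short A" and link: "\<And>y. link W' y = (if y = v then x else link W y)"
  shows "rep (M(v * N + N - 1 := x)) A \<sigma> W'"
proof -
  have a: "v * N + N - 1 = v * N + (N - 1)" using N_ge by simp
  have u: "cell (M(v * N + N - 1 := x)) b j = (if b = v \<and> j = N - 1 then x else cell M b j)" if "j < N" for b j
    unfolding a by (rule cell_upd) (use that N_ge in auto)
  define M' where "M' = M(v * N + N - 1 := x)"
  show ?thesis
    using u unfolding M'_def[symmetric]
    by (intro rep_update[OF assms(1,3)]) (use assms(2) N_ge in \<open>auto simp: rep_cellD[OF assms(1), unfolded One_nat_def] link\<close>)
qed

lemma rep_set_entry:
  assumes "rep M A \<sigma> W" "v \<in> {1..n}" "short A" "i < length (A v)"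
  shows "rep (M(v * N + Suc i := x)) (A(v := (A v)[i := x])) \<sigma> W"
proof -
  have l: "Suc i < N - 1" by (rule short_len[OF assms(3,2,4)])
  have u: "cell (M(v * N + Suc i := x)) b j = (if b = v \<and> j = Suc i then x else cell M b j)" if "j < N" for b j
    by (rule cell_upd) (use that l in auto)
  have s: "short (A(v := (A v)[i := x]))" using assms(3) by (auto simp: short_def)
  define M' where "M' = M(v * N + Suc i := x)"
  show ?thesis
    using u unfolding M'_def[symmetric]
    by (intro rep_update[OF assms(1) s])
      (use assms(2,4) N_ge l in \<open>auto simp: rep_cellD[OF assms(1), unfolded One_nat_def] nth_list_update\<close>)
qed

lemma rep_butlast:
  assumes "rep M A \<sigma> W" "v \<in> {1..n}" "short A"
  shows "rep (M(v * N := length (A v) - 1)) (A(v := butlast (A v))) \<sigma> W"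
proof -
  have u: "cell (M(v * N := x)) b j = (if b = v \<and> j = 0 then x else cell M b j)" if "j < N" for b j x
    using cell_upd[of 0 j M v x b] that N_ge by simp
  have s: "short (A(v := butlast (A v)))" using assms(3) by (auto simp: short_def intro: order_trans[OF diff_le_self])
  show ?thesis
    by (rule rep_update[OF assms(1) s])
      (use assms(2) N_ge in \<open>auto simp: u rep_cellD[OF assms(1), unfolded One_nat_def] nth_butlast\<close>)
qed

lemma rep_append:
  assumes "rep M A \<sigma> W" "v \<in> {1..n}" "short A" "length (A v) \<le> \<Delta>"
  shows "rep (M(v * N := Suc (length (A v)), v * N + Suc (length (A v)) := x)) (A(v := A v @ [x])) \<sigma> W"
proof -
  have l: "Suc (length (A v)) < N - 1" using assms(4) N by simp
  have u0: "cell (M(v * N := y)) b j = (if b = v \<and> j = 0 then y else cell M b j)" if "j < N" for b j y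
    using cell_upd[of 0 j M v y b] that N_ge by simp
  have u: "cell (M(v * N := Suc (length (A v)), v * N + Suc (length (A v)) := x)) b j =
      (if b = v \<and> j = Suc (length (A v)) then x else if b = v \<and> j = 0 then Suc (length (A v)) else cell M b j)" if "j < N" for b j
    unfolding u0[OF that, symmetric] by (rule cell_upd) (use that l in auto)
  have s: "short (A(v := A v @ [x]))" using assms(3,4) by (auto simp: short_def)
  define M' where "M' = M(v * N := Suc (length (A v)), v * N + Suc (length (A v)) := x)"
  show ?thesis
    using u unfolding M'_def[symmetric]
    by (intro rep_update[OF assms(1) s])
      (use assms(2) N_ge l in \<open>auto simp: u0 rep_cellD[OF assms(1), unfolded One_nat_def] nth_append less_Suc_eq\<close>)
qed

lemma loadedD: "loaded R \<Longrightarrow> R 3 = 1 \<and> R 4 = N \<and> R 5 = r \<and> R 6 = q \<and> R 7 = l \<and> R 8 = (n + 1) * N \<and> R 18 = 0"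
  by (simp add: loaded_def)

lemma repD:
  assumes "rep M A \<sigma> W" "v \<in> {1..n}"
  shows "M v = \<sigma> v" "M (v * N) = length (A v)" "i < length (A v) \<Longrightarrow> M (v * N + Suc i) = A v ! i"
    "M (v * N + N - 1) = link W v"
  using assms by (auto simp: rep_def)

lemma row_facts:
  assumes "v \<in> {1..n}"
  shows "v * N < 2 ^ w" "v * N + N < 2 ^ w" "i \<le> N \<Longrightarrow> v * N + i < 2 ^ w" "v < 2 ^ w" "Suc v < 2 ^ w"
  using assms fits_row[of v 0] fits_row[of v N] fits_row[of v i] fits_N[of v] fits_N[of "Suc v"] N by auto

text \<open>A worklist cell is nonzero exactly for the members of the list, so membership is tested
  without a traversal.\<close>

lemma push_prog_correct:
  assumes R: "loaded R" and M: "rep M A \<sigma> W" and A: "short A" and v: "R 20 = v" "v \<in> {1..n}"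
    and h: "R 9 = head W" and W: "set W \<subseteq> {1..n}"
  shows "hoare w \<omega> push_prog 8 R M D (\<lambda>R' M' D'. D' = D \<and> same_off {9, 26, 27, 28} R R' \<and>
    R' 9 = head (push v W) \<and> rep M' A \<sigma> (push v W))"
proof -
  have hW: "Suc (head W) < 2 ^ w"
    using W fits_N[of "Suc (head W)"] N by (cases W) auto
  have "rep (M(v * N + N - 1 := Suc (head W))) A \<sigma> (v # W)"
    by (rule rep_set_link[OF M v(2) A]) auto
  then show ?thesis
    using v(2) M N_ge unfolding push_prog_def
    by (intro hoare_Op hoare_Load hoare_Cond)
      (auto intro!: hoare_Op hoare_Store hoare_Nil simp: word_minus push_def same_off_def loadedD[OF R] v(1) h
        repD(4)[OF M v(2), unfolded One_nat_def] row_facts(1,2,4,5)[OF v(2)] hW link_eq_0_iff[of W v])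
qed

lemma pop_prog_correct:
  assumes R: "loaded R" and M: "rep M A \<sigma> (v # W)" and A: "short A"
    and h: "R 9 = v" and W: "distinct (v # W)" "set (v # W) \<subseteq> {1..n}"
  shows "hoare w \<omega> pop_prog 6 R M D (\<lambda>R' M' D'. D' = D \<and> same_off {9, 26, 27} R R' \<and>
    R' 9 = head W \<and> rep M' A \<sigma> W)"
proof -
  have v: "v \<in> {1..n}" using W by simp
  have hW: "Suc (head W) < 2 ^ w"
    using W fits_N[of "Suc (head W)"] N by (cases W) auto
  have "link W v = 0" using W by (simp add: link_eq_0_iff)
  then have "rep (M(v * N + N - 1 := 0)) A \<sigma> W"
    by (intro rep_set_link[OF M v A]) auto
  then show ?thesis
    using N_ge unfolding pop_prog_def
    by (intro hoare_Op hoare_Load hoare_Store hoare_Nil)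
      (auto simp: word_minus same_off_def loadedD[OF R] h repD(4)[OF M v, unfolded One_nat_def] row_facts(1,2,4,5)[OF v] hW Suc_lessD[OF hW])
qed

lemma append_prog_correct:
  assumes R: "loaded R" and M: "rep M A \<sigma> W" and A: "short A" and u: "R a = u" "u \<in> {1..n}"
    and v: "R b = v" and ab: "a \<notin> {10, 11}" "b \<notin> {10, 11}" and len: "length (A u) \<le> \<Delta>"
  shows "hoare w \<omega> (append_prog a b) 6 R M D (\<lambda>R' M' D'. D' = D \<and> same_off {10, 11} R R' \<and>
    rep M' (A(u := A u @ [v])) \<sigma> W)"
proof -
  have "u * N + Suc (length (A u)) < 2 ^ w" "Suc (length (A u)) < 2 ^ w"
    using len N row_facts(3)[OF u(2), of "Suc (length (A u))"] fits_N[of "Suc (length (A u))"] by auto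
  then show ?thesis
    using rep_append[OF M u(2) A len, of v] ab
    unfolding append_prog_def
    by (intro hoare_Op hoare_Load hoare_Store hoare_Nil)
      (auto simp: same_off_def loadedD[OF R] repD(2)[OF M u(2)] row_facts(1)[OF u(2)] u(1) v)
qed

lemma remove_prog_correct:
  assumes R: "loaded R" and M: "rep M A \<sigma> W" and A: "short A" and u: "R a = u" "u \<in> {1..n}"
    and v: "R b = v" and ab: "a \<notin> {10..16}" "b \<notin> {10..16}" and ne: "A u \<noteq> []"
  shows "hoare w \<omega> (remove_prog a b) (7 * int \<Delta> + 15) R M D (\<lambda>R' M' D'. D' = D \<and> same_off {10..16} R R' \<and>
    rep M' (A(u := remove_swap v (A u))) \<sigma> W)"
proof -
  define xs where "xs = A u"
  define f where "f = (\<lambda>y. if y = v then last xs else y)"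
  \<comment> \<open>The lists after the entries of \<open>u\<close> from position \<open>i\<close>
    on have been rewritten. The last entry was saved in register 12 before the loop.\<close>
  define B where "B i = A(u := take i xs @ map f (drop i xs))" for i
  have len: "length xs \<le> \<Delta> + 1" using A u by (auto simp: short_def xs_def)
  have B: "short (B i)" for i using A len by (auto simp: short_def B_def)
  have row: "Suc (u * N + i) < 2 ^ w" "Suc i < 2 ^ w" "i < 2 ^ w" if "i < length xs" for i
    using that len N row_facts(3)[OF u(2), of "Suc i"] fits_N[of "Suc i"] fits_N[of i] by auto
  have len_w: "length xs < 2 ^ w" "u * N + length xs < 2 ^ w"
    using len N row_facts(3)[OF u(2), of "length xs"] fits_N[of "length xs"] by auto
  have ne': "length xs \<noteq> 0" "Suc 0 \<le> length xs" using ne by (simp_all add: xs_def Suc_le_eq)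
  have last: "M (u * N + length xs) = last xs"
    using repD(3)[OF M u(2), of "length xs - 1"] ne' by (simp add: xs_def last_conv_nth)
  define I where "I i R' M' D' \<longleftrightarrow> D' = D \<and> same_off {10..16} R R' \<and> R' 10 = u * N \<and> R' 11 = length xs \<and>
    R' 12 = last xs \<and> rep M' (B i) \<sigma> W" for i :: nat and R' M' and D' :: nat
  have ID: "R' 3 = 1" "R' 18 = 0" "R' b = v" if "same_off {10..16} R R'" for R'
    using loadedD[OF R] that v ab by (auto simp: same_off_def)
  have upd: "same_off {10..16} R (R'(k := x))" if "same_off {10..16} R R'" "k \<in> {10..16}" for R' k x
    using that by (auto simp: same_off_def)
  have body: "hoare w \<omega> [Op Plus 14 10 13, Load 15 14, Op Equal 16 15 b, Cond 16 [Store 14 12] [], Op Minus 13 13 3]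
      6 R' M' D' (\<lambda>R M D. R 13 = i \<and> I i R M D)"
    if i: "i < length xs" and i1: "R' 13 = Suc i" and inv: "I (Suc i) R' M' D'" for i R' M' D'
  proof -
    have s: "same_off {10..16} R R'" and rp: "rep M' (B (Suc i)) \<sigma> W" using inv by (auto simp: I_def)
    have Bi: "length (B (Suc i) u) = length xs" "B (Suc i) u ! i = xs ! i"
      using i by (auto simp: B_def nth_append)
    have m: "M' (Suc (u * N + i)) = xs ! i" using repD(3)[OF rp u(2), of i] Bi i by simp
    have sp: "drop i xs = xs ! i # drop (Suc i) xs" "take (Suc i) xs = take i xs @ [xs ! i]"
      using i by (simp_all add: Cons_nth_drop_Suc take_Suc_conv_app_nth)
    have eq: "B i = (if xs ! i = v then (B (Suc i))(u := (B (Suc i) u)[i := last xs]) else B (Suc i))"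
      using i by (auto simp: B_def sp f_def list_update_append fun_eq_iff)
    have "rep (M'(Suc (u * N + i) := last xs)) ((B (Suc i))(u := (B (Suc i) u)[i := last xs])) \<sigma> W"
      using rep_set_entry[OF rp u(2) B, of i "last xs"] Bi i by simp
    then show ?thesis
      using inv rp ab
      by (intro hoare_Op hoare_Load hoare_Cond)
        (auto intro!: hoare_Op hoare_Store hoare_Nil simp: I_def upd eq word_minus i1 ID[OF s] row[OF i] m)
  qed
  show ?thesis
    unfolding remove_prog_def
    apply (intro hoare_Op hoare_Load)
    apply (rule hoare_for[where I = I and m = "length xs" and t = 6])
    subgoal
      using M ab len_w last
      by (auto simp: I_def B_def same_off_def repD(2)[OF M u(2)] loadedD[OF R] u(1) row_facts(1)[OF u(2)] xs_def)
    subgoal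
      using ab len_w by (auto simp: repD(2)[OF M u(2)] loadedD[OF R] u(1) row_facts(1)[OF u(2)] xs_def)
    subgoal by simp
    subgoal by (rule body)
    subgoal premises prems for R' M' D'
    proof -
      have s: "same_off {10..16} R R'" and rp: "rep M' (B 0) \<sigma> W" using prems by (auto simp: I_def)
      have "B 0 u = map f xs" "(B 0)(u := butlast (B 0 u)) = A(u := remove_swap v (A u))"
        by (auto simp: B_def remove_swap_def f_def xs_def[symmetric])
      with rep_butlast[OF rp u(2) B]
      have "rep (M'(u * N := length xs - Suc 0)) (A(u := remove_swap v (A u))) \<sigma> W" by simp
      then show ?thesis
        using prems len
        by (intro hoare_Op hoare_Store hoare_Nil) (auto simp: I_def upd word_minus algebra_simps ID[OF s] len_w ne'(2))
    qed
    done
qed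

lemma count_prog_correct:
  assumes R: "loaded R" and M: "rep M A \<sigma> W" and A: "valid_adj A" and v: "R 10 = v" "v \<in> {1..n}"
  shows "hoare w \<omega> count_prog (8 * int \<Delta> + 5) R M D (\<lambda>R' M' D'. D' = D \<and> same_off {13, 27, 28, 29} R R' \<and>
    R' 13 = blank_deg A \<sigma> v \<and> M' = M)"
proof -
  have len: "length (A v) \<le> \<Delta>" using A v by (auto simp: valid_adj_def)
  have Av: "A v ! i \<in> {1..n}" if "i < length (A v)" for i
    using A v that nth_mem[OF that] unfolding valid_adj_def by blast
  let ?f = "\<lambda>i. length (filter (\<lambda>y. \<sigma> y \<le> r) (drop i (A v)))"
  let ?F = "{13, 27, 28, 29} :: nat set"
  define I where "I i R' M' D' \<longleftrightarrow> D' = D \<and> same_off ?F R R' \<and> R' 28 = v * N \<and> R' 13 = ?f i \<and> M' = M"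
    for i :: nat and R' M' and D' :: nat
  have ID: "R' 3 = 1" "R' 5 = r" "R' 18 = 0" if "same_off ?F R R'" for R'
    using loadedD[OF R] that by (auto simp: same_off_def)
  have upd: "same_off ?F R (R'(k := x))" if "same_off ?F R R'" "k \<in> ?F" for R' k x
    using that by (auto simp: same_off_def)
  have body: "hoare w \<omega> [Op Plus 29 28 27, Load 29 29, Load 29 29, Op Less 29 5 29, Cond 29 [] [Op Plus 13 13 3],
       Op Minus 27 27 3] 7 R' M' D' (\<lambda>R M D. R 27 = i \<and> I i R M D)"
    if i: "i < length (A v)" and i1: "R' 27 = Suc i" and inv: "I (Suc i) R' M' D'" for i R' M' D'
  proof -
    have s: "same_off ?F R R'" using inv by (auto simp: I_def)
    have b: "Suc (v * N + i) < 2 ^ w" "Suc i < 2 ^ w" "i < 2 ^ w"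
      using i len N row_facts(3)[OF v(2), of "Suc i"] fits_N[of "Suc i"] fits_N[of i] by auto
    have m: "M (Suc (v * N + i)) = A v ! i" "M (A v ! i) = \<sigma> (A v ! i)"
      using repD(3)[OF M v(2) i] repD(1)[OF M Av[OF i]] by auto
    have sp: "drop i (A v) = A v ! i # drop (Suc i) (A v)" using i by (simp add: Cons_nth_drop_Suc)
    have "?f (Suc i) \<le> length (A v) - Suc i" by (rule order_trans[OF length_filter_le]) simp
    then have c: "Suc (?f (Suc i)) < 2 ^ w" using len N i by (intro fits_N) simp
    show ?thesis
      using inv
      by (intro hoare_Op hoare_Load hoare_Cond)
        (auto intro!: hoare_Op hoare_Nil simp: I_def upd sp word_minus i1 ID[OF s] b m c)
  qed
  show ?thesis
    unfolding count_prog_def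
    apply (intro hoare_Op hoare_Load hoare_Const)
    apply (rule hoare_for[where I = I and m = "length (A v)" and t = 7])
    subgoal
      by (auto simp: I_def same_off_def repD(2)[OF M v(2)] loadedD[OF R] v(1) row_facts(1)[OF v(2)])
    subgoal
      by (auto simp: repD(2)[OF M v(2)] loadedD[OF R] v(1) row_facts(1)[OF v(2)])
    subgoal by simp
    subgoal by (rule body)
    subgoal using len by (intro hoare_Nil) (auto simp: I_def blank_deg_def)
    done
qed

lemma free_colors_avail: "free_colors A \<sigma> v (Suc r) q = avail A \<sigma> v"
  by (simp add: free_colors_def avail_def)

text \<open>Overwriting the result while the position decreases yields the first match; this is the
  recursion behind the loop invariant of \<open>culprit_prog\<close>.\<close>

lemma culprit_drop:
  assumes "i < length xs"
  shows "(case filter P (drop i xs) of [] \<Rightarrow> v | x # _ \<Rightarrow> x) =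
    (if P (xs ! i) then xs ! i else case filter P (drop (Suc i) xs) of [] \<Rightarrow> v | x # _ \<Rightarrow> x)"
proof -
  have "drop i xs = xs ! i # drop (Suc i) xs" using assms by (simp add: Cons_nth_drop_Suc)
  then show ?thesis by simp
qed

lemma culprit_prog_correct:
  assumes R: "loaded R" and M: "rep M A \<sigma> W" and A: "valid_adj A" and v: "R 10 = v" "v \<in> {1..n}"
    and \<sigma>: "\<And>y. y \<in> {1..n} \<Longrightarrow> \<sigma> y \<le> r + q"
  shows "hoare w \<omega> culprit_prog (int \<Delta> * (13 * int q + 7 * int \<Delta> + 19) + 6) R M D
    (\<lambda>R' M' D'. D' = D \<and> same_off ({15, 16, 17} \<union> {20..30}) R R' \<and> R' 15 = culprit A \<sigma> v \<and> rep M' A \<sigma> W)"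
proof -
  let ?t = "13 * int q + 7 * int \<Delta> + 18"
  define F :: "nat set" where "F = {15, 16, 17} \<union> {20..30}"
  have mem [simp]: "15 \<in> F" "16 \<in> F" "17 \<in> F" "20 \<in> F" "21 \<in> F" "22 \<in> F" "24 \<in> F" by (simp_all add: F_def)
  define P where "P y \<longleftrightarrow> length (avail A \<sigma> y) < l" for y
  let ?f = "\<lambda>i. case filter P (drop i (A v)) of [] \<Rightarrow> v | x # _ \<Rightarrow> x"
  have len: "length (A v) \<le> \<Delta>" using A v by (auto simp: valid_adj_def)
  have Av: "A v ! i \<in> {1..n}" if "i < length (A v)" for i
    using A v that nth_mem[OF that] unfolding valid_adj_def by blast
  have c: "Suc r < 2 ^ w" "q < 2 ^ w" using palette fits_N[of "Suc r"] fits_N[of q] by auto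
  define I where "I i R' M' D' \<longleftrightarrow> D' = D \<and> same_off F R R' \<and> R' 16 = v * N \<and> R' 21 = Suc r \<and> R' 22 = q \<and>
    R' 15 = ?f i \<and> rep M' A \<sigma> W" for i :: nat and R' M' and D' :: nat
  have ID: "loaded R'" if "same_off F R R'" for R'
    by (rule loaded_same_off[OF R that]) (auto simp: F_def)
  have upd: "same_off F R (R'(k := x))" if "same_off F R R'" "k \<in> F" for R' k x
    using that by (auto simp: same_off_def)
  have body: "hoare w \<omega> ([Op Plus 20 16 17, Load 20 20] @ scan_prog @
       [Op Less 24 24 7, Cond 24 [Op Plus 15 20 18] [], Op Minus 17 17 3]) ?t R' M' D'
       (\<lambda>R M D. R 17 = i \<and> I i R M D)"
    if i: "i < length (A v)" and i1: "R' 17 = Suc i" and inv: "I (Suc i) R' M' D'" for i R' M' D'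
  proof -
    define y where "y = A v ! i"
    have s: "same_off F R R'" and rp: "rep M' A \<sigma> W" using inv by (auto simp: I_def)
    have y: "y \<in> {1..n}" using Av[OF i] by (simp add: y_def)
    have b: "Suc (v * N + i) < 2 ^ w" "Suc i < 2 ^ w" "i < 2 ^ w"
      using i len N row_facts(3)[OF v(2), of "Suc i"] fits_N[of "Suc i"] fits_N[of i] by auto
    have m: "M' (Suc (v * N + i)) = y" using repD(3)[OF rp v(2) i] by (simp add: y_def)
    define R1 where "R1 = R'(20 := y)"
    have s1: "same_off F R R1" unfolding R1_def by (intro upd s) simp
    have r1: "R1 15 = ?f (Suc i)" "R1 16 = v * N" "R1 17 = Suc i" "R1 20 = y" "R1 21 = Suc r" "R1 22 = q"
      using inv i1 by (simp_all add: R1_def I_def)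
    have "hoare w \<omega> (scan_prog @ [Op Less 24 24 7, Cond 24 [Op Plus 15 20 18] [], Op Minus 17 17 3])
      (?t - 2) R1 M' D (\<lambda>R M D. R 17 = i \<and> I i R M D)"
    proof (rule hoare_append[OF scan_prog_correct[OF ID[OF s1] rp A y \<sigma> r1(4) r1(5) r1(6)]])
      fix R2 M2 D2
      assume "D2 = D \<and> same_off {24..30} R1 R2 \<and> R2 24 = length (free_colors A \<sigma> y (Suc r) q) \<and>
        R2 25 = pick (R1 25) (free_colors A \<sigma> y (Suc r) q) (R1 23) \<and> (\<forall>a<(n + 1) * N. M2 a = M' a)"
      then have D2: "D2 = D" and s2: "same_off {24..30} R1 R2" and l2: "R2 24 = length (avail A \<sigma> y)"
        and m2: "\<And>a. a < (n + 1) * N \<Longrightarrow> M2 a = M' a"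
        by (simp_all add: free_colors_avail)
      have rp2: "rep M2 A \<sigma> W" by (rule rep_agree[OF rp m2 A])
      have r2: "R2 15 = ?f (Suc i)" "R2 16 = v * N" "R2 17 = Suc i" "R2 20 = y" "R2 21 = Suc r" "R2 22 = q"
        using r1 s2 by (simp_all add: same_off_def)
      have s3: "same_off F R R2" using s1 s2 by (auto simp: same_off_def F_def)
      have yw: "y < 2 ^ w" using row_facts(4)[OF y] .
      note L = loadedD[OF ID[OF s3]]
      have eq: "?f i = (if length (avail A \<sigma> y) < l then y else ?f (Suc i))"
        unfolding culprit_drop[OF i] P_def y_def ..
      show "hoare w \<omega> [Op Less 24 24 7, Cond 24 [Op Plus 15 20 18] [], Op Minus 17 17 3]
        (?t - 2 - (13 * int q + 7 * int \<Delta> + 12)) R2 M2 D2 (\<lambda>R M D. R 17 = i \<and> I i R M D)"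
        unfolding D2 using rp2 s3
        by (intro hoare_Op hoare_Cond)
          (auto intro!: hoare_Op hoare_Nil simp: L l2 r2 I_def upd eq yw b word_minus)
    qed auto
    moreover have "D' = D" using inv by (simp add: I_def)
    moreover have "R'(20 := v * N + Suc i, 20 := y) = R1" by (simp add: R1_def)
    moreover have "R' 16 = v * N" using inv by (simp add: I_def)
    ultimately show ?thesis
      unfolding append_Cons append_Nil using i1
      by (intro hoare_Op hoare_Load) (simp add: b m)
  qed
  show ?thesis
    unfolding culprit_prog_def F_def[symmetric]
    apply (intro hoare_Op hoare_Load)
    apply (rule hoare_for[where I = I and m = "length (A v)" and t = ?t])
    subgoal
      using M row_facts(4)[OF v(2)]
      by (auto simp: I_def same_off_def repD(2)[OF M v(2)] loadedD[OF R] v(1) row_facts(1)[OF v(2)] c)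
    subgoal
      by (auto simp: repD(2)[OF M v(2)] loadedD[OF R] v(1) row_facts(1)[OF v(2)])
    subgoal by simp
    subgoal by (rule body)
    subgoal premises prems for R' M' D'
    proof (rule hoare_Nil)
      have "int (length (A v)) * (?t + 1) \<le> int \<Delta> * (?t + 1)" using len by (intro mult_right_mono) auto
      then show "0 \<le> int \<Delta> * (13 * int q + 7 * int \<Delta> + 19) + 6 - 1 - 1 - 1 - 1 - 1 - int (length (A v)) * (?t + 1) - 1"
        by (simp add: algebra_simps)
      show "D' = D \<and> same_off F R R' \<and> R' 15 = culprit A \<sigma> v \<and> rep M' A \<sigma> W"
        using prems by (auto simp: I_def culprit_def P_def[abs_def])
    qed
    done
qed

text \<open>The program starts with the last neighbor, so the processed part
  \<open>rev (drop i (A x))\<close> grows at its end, whereas \<open>resample\<close> recurses at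
  the front.\<close>

lemma resample_snoc:
  "resample A \<sigma> \<rho> (vs @ [v]) = (let \<tau> = resample A \<sigma> \<rho> vs in
     \<tau>(v := pick r (avail A \<tau> v) (\<rho> (length vs) mod Suc (length (avail A \<tau> v)))))"
  by (induction vs arbitrary: \<sigma> \<rho>) (simp_all add: Let_def)

lemma pick_avail_le: "pick r (avail A \<sigma> v) j \<le> r + q"
  using avail_facts(3)[of A \<sigma> v] nth_mem[of j "avail A \<sigma> v"] by (fastforce simp: pick_def)

lemma resample_le: "(\<And>y. y \<in> {1..n} \<Longrightarrow> \<sigma> y \<le> r + q) \<Longrightarrow> y \<in> {1..n} \<Longrightarrow> resample A \<sigma> \<rho> vs y \<le> r + q"
  by (induction vs arbitrary: \<sigma> \<rho>) (auto simp: pick_avail_le)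

lemma resample_prog_correct:
  assumes R: "loaded R" and M: "rep M A \<sigma> W" and A: "valid_adj A" and x: "R 15 = x" "x \<in> {1..n}"
    and \<sigma>: "\<And>y. y \<in> {1..n} \<Longrightarrow> \<sigma> y \<le> r + q" and h: "R 9 = head W" and W: "set W \<subseteq> {1..n}"
  shows "hoare w \<omega> resample_prog (int \<Delta> * (26 * int q + 14 * int \<Delta> + 45) + 5) R M D
    (\<lambda>R' M' D'. D' = D + length (A x) \<and> same_off ({9, 16, 17} \<union> {20..31}) R R' \<and>
      R' 9 = head (fold push (rev (A x)) W) \<and>
      rep M' A (resample A \<sigma> (\<lambda>i. \<omega> (i + D)) (rev (A x))) (fold push (rev (A x)) W))"
proof -
  let ?t = "26 * int q + 14 * int \<Delta> + 44"
  define F :: "nat set" where "F = {9, 16, 17} \<union> {20..31}"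
  have mem [simp]: "16 \<in> F" "17 \<in> F" "20 \<in> F" "21 \<in> F" "22 \<in> F" "23 \<in> F" "24 \<in> F" "25 \<in> F" "31 \<in> F"
    by (simp_all add: F_def)
  define \<tau> where "\<tau> i = resample A \<sigma> (\<lambda>i. \<omega> (i + D)) (rev (drop i (A x)))" for i
  define V where "V i = fold push (rev (drop i (A x))) W" for i
  have len: "length (A x) \<le> \<Delta>" using A x by (auto simp: valid_adj_def)
  have Ax: "A x ! i \<in> {1..n}" if "i < length (A x)" for i
    using A x that nth_mem[OF that] unfolding valid_adj_def by blast
  have c: "Suc r < 2 ^ w" "q < 2 ^ w" "Suc q < 2 ^ w" "r < 2 ^ w"
    using palette fits_N[of "Suc r"] fits_N[of q] fits_N[of "Suc q"] fits_N[of r] by auto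
  define I where "I i R' M' D' \<longleftrightarrow> D' = D + (length (A x) - i) \<and> same_off F R R' \<and> R' 16 = x * N \<and> R' 21 = Suc r \<and>
    R' 22 = q \<and> R' 9 = head (V i) \<and> rep M' A (\<tau> i) (V i)" for i :: nat and R' M' and D' :: nat
  have ID: "loaded R'" if "same_off F R R'" for R'
    by (rule loaded_same_off[OF R that]) (auto simp: F_def)
  have upd: "same_off F R (R'(k := y))" if "same_off F R R'" "k \<in> F" for R' k y
    using that by (auto simp: same_off_def)
  have VW: "set (V i) \<subseteq> {1..n}" for i
    using W A x by (auto simp: V_def set_fold_push valid_adj_def dest!: in_set_dropD)
  have body: "hoare w \<omega> ([Op Plus 20 16 17, Load 20 20] @ scan_prog @
       [Rand 31, Op Plus 24 24 3, Op Modulo 23 31 24, Op Plus 25 5 18] @ scan_prog @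
       [Store 20 25] @ push_prog @ [Op Minus 17 17 3]) ?t R' M' D'
       (\<lambda>R M D. R 17 = i \<and> I i R M D)"
    if i: "i < length (A x)" and i1: "R' 17 = Suc i" and inv: "I (Suc i) R' M' D'" for i R' M' D'
  proof -
    define y where "y = A x ! i"
    define \<tau>' where "\<tau>' = \<tau> (Suc i)"
    define V' where "V' = V (Suc i)"
    define L where "L = avail A \<tau>' y"
    have s: "same_off F R R'" and rp: "rep M' A \<tau>' V'" and r': "R' 9 = head V'" "R' 16 = x * N" "R' 21 = Suc r" "R' 22 = q"
      and D': "D' = D + (length (A x) - Suc i)"
      using inv by (auto simp: I_def \<tau>'_def V'_def)
    have y: "y \<in> {1..n}" using Ax[OF i] by (simp add: y_def)
    have b: "Suc (x * N + i) < 2 ^ w" "Suc i < 2 ^ w" "i < 2 ^ w"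
      using i len N row_facts(3)[OF x(2), of "Suc i"] fits_N[of "Suc i"] fits_N[of i] by auto
    have m: "M' (Suc (x * N + i)) = y" using repD(3)[OF rp x(2) i] by (simp add: y_def)
    have \<tau>'_le: "\<tau>' z \<le> r + q" if "z \<in> {1..n}" for z
      unfolding \<tau>'_def \<tau>_def by (rule resample_le[OF \<sigma> that])
    have V'W: "set V' \<subseteq> {1..n}" using VW by (simp add: V'_def)
    have Lq: "length L \<le> q" unfolding L_def by (rule avail_facts(4))
    have Lw: "Suc (length L) < 2 ^ w" using Lq c by linarith
    have drop: "rev (drop i (A x)) = rev (drop (Suc i) (A x)) @ [y]"
      using i by (simp add: y_def Cons_nth_drop_Suc[symmetric])
    define p where "p = pick r L (\<omega> D' mod Suc (length L))"
    have \<tau>i: "\<tau> i = \<tau>'(y := p)"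
      unfolding \<tau>_def drop resample_snoc Let_def
      by (simp add: \<tau>'_def \<tau>_def p_def L_def D' add.commute)
    have Vi: "V i = push y V'" by (simp add: V_def V'_def drop)
    define R1 where "R1 = R'(20 := y)"
    have s1: "same_off F R R1" unfolding R1_def by (intro upd s) simp
    have r1: "R1 9 = head V'" "R1 16 = x * N" "R1 17 = Suc i" "R1 20 = y" "R1 21 = Suc r" "R1 22 = q"
      using r' i1 by (simp_all add: R1_def)
    have final: "hoare w \<omega> ([Store 20 25] @ push_prog @ [Op Minus 17 17 3]) 14 R4 M4 (Suc D')
        (\<lambda>R M D. R 17 = i \<and> I i R M D)"
      if s4: "same_off F R R4" and rp4: "rep M4 A \<tau>' V'"
        and r4: "R4 9 = head V'" "R4 16 = x * N" "R4 17 = Suc i" "R4 20 = y" "R4 21 = Suc r" "R4 22 = q" "R4 25 = p" for R4 M4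
    proof -
      have rp5: "rep (M4(y := p)) A (\<tau> i) V'"
        unfolding \<tau>i by (rule rep_set_color[OF rp4 y valid_imp_short[OF A]])
      have "hoare w \<omega> (push_prog @ [Op Minus 17 17 3]) 13 R4 (M4(y := p)) (Suc D') (\<lambda>R M D. R 17 = i \<and> I i R M D)"
      proof (rule hoare_append[OF push_prog_correct[OF ID[OF s4] rp5 valid_imp_short[OF A] r4(4) y r4(1) V'W]])
        fix R5 M5 D5
        assume *: "D5 = Suc D' \<and> same_off {9, 26, 27, 28} R4 R5 \<and> R5 9 = head (push y V') \<and> rep M5 A (\<tau> i) (push y V')"
        then have s5: "same_off F R R5" using s4 by (auto simp: same_off_def F_def)
        have "R5 16 = x * N" "R5 17 = Suc i" "R5 21 = Suc r" "R5 22 = q"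
          using * r4 by (simp_all add: same_off_def)
        moreover have "Suc D' = D + (length (A x) - i)" using D' i by simp
        ultimately show "hoare w \<omega> [Op Minus 17 17 3] (13 - 8) R5 M5 D5 (\<lambda>R M D. R 17 = i \<and> I i R M D)"
          using * s5 loadedD[OF ID[OF s5]]
          by (intro hoare_Op hoare_Nil) (simp_all add: I_def upd b word_minus Vi)
      qed
      then show ?thesis using r4 by (simp add: hoare_Store)
    qed
    \<comment> \<open>No color changes between the two scans, so the list counted by the first is
      the list indexed by the second.\<close>
    have "hoare w \<omega> (scan_prog @ [Rand 31, Op Plus 24 24 3, Op Modulo 23 31 24, Op Plus 25 5 18] @ scan_prog @
       [Store 20 25] @ push_prog @ [Op Minus 17 17 3])
      (?t - 2) R1 M' D' (\<lambda>R M D. R 17 = i \<and> I i R M D)"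
    proof (rule hoare_append[OF scan_prog_correct[OF ID[OF s1] rp A y \<tau>'_le r1(4) r1(5) r1(6)]])
      fix R2 M2 D2
      assume "D2 = D' \<and> same_off {24..30} R1 R2 \<and> R2 24 = length (free_colors A \<tau>' y (Suc r) q) \<and>
        R2 25 = pick (R1 25) (free_colors A \<tau>' y (Suc r) q) (R1 23) \<and> (\<forall>a<(n + 1) * N. M2 a = M' a)"
      then have D2: "D2 = D'" and s2: "same_off {24..30} R1 R2" and l2: "R2 24 = length L"
        and m2: "\<And>a. a < (n + 1) * N \<Longrightarrow> M2 a = M' a"
        by (simp_all add: free_colors_avail L_def)
      have rp2: "rep M2 A \<tau>' V'" by (rule rep_agree[OF rp m2 A])
      have s2': "same_off F R R2" using s1 s2 by (auto simp: same_off_def F_def)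
      note LD = loadedD[OF ID[OF s2']]
      define R3 where "R3 = R2(31 := \<omega> D', 24 := Suc (length L), 23 := \<omega> D' mod Suc (length L), 25 := r)"
      have s3: "same_off F R R3" unfolding R3_def by (intro upd s2') simp_all
      have r3: "R3 9 = head V'" "R3 16 = x * N" "R3 17 = Suc i" "R3 20 = y" "R3 21 = Suc r" "R3 22 = q"
        "R3 23 = \<omega> D' mod Suc (length L)" "R3 25 = r"
        using r1 s2 by (simp_all add: R3_def same_off_def)
      have "hoare w \<omega> (scan_prog @ [Store 20 25] @ push_prog @ [Op Minus 17 17 3])
        (26 + (13 * int q + 7 * int \<Delta>)) R3 M2 (Suc D') (\<lambda>R M D. R 17 = i \<and> I i R M D)"
      proof (rule hoare_append[OF scan_prog_correct[OF ID[OF s3] rp2 A y \<tau>'_le r3(4) r3(5) r3(6)]])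
        fix R4 M4 D4
        assume "D4 = Suc D' \<and> same_off {24..30} R3 R4 \<and> R4 24 = length (free_colors A \<tau>' y (Suc r) q) \<and>
          R4 25 = pick (R3 25) (free_colors A \<tau>' y (Suc r) q) (R3 23) \<and> (\<forall>a<(n + 1) * N. M4 a = M2 a)"
        then have D4: "D4 = Suc D'" and s4: "same_off {24..30} R3 R4" and p4: "R4 25 = p"
          and m4: "\<And>a. a < (n + 1) * N \<Longrightarrow> M4 a = M2 a"
          by (simp_all add: free_colors_avail L_def p_def r3)
        have rp4: "rep M4 A \<tau>' V'" by (rule rep_agree[OF rp2 m4 A])
        have s4': "same_off F R R4" using s3 s4 by (auto simp: same_off_def F_def)
        have r4: "R4 9 = head V'" "R4 16 = x * N" "R4 17 = Suc i" "R4 20 = y" "R4 21 = Suc r" "R4 22 = q"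
          using r3 s4 by (simp_all add: same_off_def)
        show "hoare w \<omega> ([Store 20 25] @ push_prog @ [Op Minus 17 17 3])
          (26 + (13 * int q + 7 * int \<Delta>) - (13 * int q + 7 * int \<Delta> + 12)) R4 M4 D4 (\<lambda>R M D. R 17 = i \<and> I i R M D)"
          unfolding D4 using final[OF s4' rp4 r4 p4] by simp
      qed auto
      then show "hoare w \<omega> ([Rand 31, Op Plus 24 24 3, Op Modulo 23 31 24, Op Plus 25 5 18] @ scan_prog @
         [Store 20 25] @ push_prog @ [Op Minus 17 17 3])
        (?t - 2 - (13 * int q + 7 * int \<Delta> + 12)) R2 M2 D2 (\<lambda>R M D. R 17 = i \<and> I i R M D)"
        unfolding append_Cons append_Nil D2 R3_def
        by (intro hoare_Rand hoare_Op) (simp add: LD l2 Lw c)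
    qed auto
    moreover have "R'(20 := x * N + Suc i, 20 := y) = R1" by (simp add: R1_def)
    ultimately show ?thesis
      unfolding append_Cons append_Nil using i1 r'
      by (intro hoare_Op hoare_Load) (simp add: b m)
  qed
  show ?thesis
    unfolding resample_prog_def F_def[symmetric]
    apply (intro hoare_Op hoare_Load)
    apply (rule hoare_for[where I = I and m = "length (A x)" and t = ?t])
    subgoal
      using M
      by (auto simp: I_def same_off_def \<tau>_def V_def repD(2)[OF M x(2)] loadedD[OF R] x(1) h row_facts(1)[OF x(2)] c)
    subgoal
      by (auto simp: repD(2)[OF M x(2)] loadedD[OF R] x(1) row_facts(1)[OF x(2)])
    subgoal by simp
    subgoal by (rule body)
    subgoal premises prems for R' M' D'
    proof (rule hoare_Nil)
      have "int (length (A x)) * (?t + 1) \<le> int \<Delta> * (?t + 1)" using len by (intro mult_right_mono) auto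
      then show "0 \<le> int \<Delta> * (26 * int q + 14 * int \<Delta> + 45) + 5 - 1 - 1 - 1 - 1 - int (length (A x)) * (?t + 1) - 1"
        by (simp add: algebra_simps)
      show "D' = D + length (A x) \<and> same_off F R R' \<and> R' 9 = head (fold push (rev (A x)) W) \<and>
        rep M' A (resample A \<sigma> (\<lambda>i. \<omega> (i + D)) (rev (A x))) (fold push (rev (A x)) W)"
        using prems by (auto simp: I_def \<tau>_def V_def)
    qed
    done
qed

end

section \<open>The main loop\<close>

definition main_body :: "com list" where
  "main_body = [Op Plus 10 9 18, Load 11 10, Op Less 12 5 11,
     Cond 12 pop_prog (count_prog @ [Op Less 14 13 5, Cond 14 assign_prog (culprit_prog @ resample_prog)])]"

text \<open>Registers do not persist between runs. Cell 0 holds the row length, and the other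
  parameters are found from there at the end of row 0.\<close>

definition load_prog :: "com list" where
  "load_prog = [Const 3 1, Load 4 18, Op Minus 10 4 3, Load 5 10, Op Minus 10 10 3, Load 6 10,
     Op Minus 10 10 3, Load 7 10, Op Minus 10 10 3, Load 8 10]"

definition update_program :: "com list" where
  "update_program = load_prog @ [Cond 0
     (append_prog 1 2 @ append_prog 2 1 @
       [Load 10 1, Load 11 2, Op Equal 12 10 11, Cond 12 [Store 1 5] [], Op Plus 20 1 18] @ push_prog)
     (remove_prog 1 2 @ remove_prog 2 1), Loop 9 main_body]"

section \<open>State invariant and projection to the states of the analysis\<close>

context recolor
begin

text \<open>The recoloring decisions depend on primary colors and on blankness only, so the process
  can be followed on projections.\<close>

definition proj :: "(nat \<Rightarrow> nat) \<Rightarrow> nat \<Rightarrow> nat" where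
  "proj \<sigma> = restrict (\<lambda>v. max r (\<sigma> v)) {1..n}"

text \<open>Every vertex without a color is on the worklist, so once the worklist is empty the
  coloring is proper and does not use \<open>r\<close>.\<close>

definition ok_state :: "adjacency \<Rightarrow> (nat \<Rightarrow> nat) \<Rightarrow> nat list \<Rightarrow> bool" where
  "ok_state A \<sigma> W \<longleftrightarrow> valid_adj A \<and> (\<forall>y\<in>{1..n}. \<sigma> y \<le> r + q) \<and> distinct W \<and> set W \<subseteq> {1..n} \<and>
     (\<forall>v\<in>{1..n}. \<forall>y\<in>set (A v). \<sigma> v \<noteq> \<sigma> y \<or> \<sigma> v = r) \<and> (\<forall>v\<in>{1..n}. \<sigma> v = r \<longrightarrow> v \<in> set W)"

lemma valid_adj_neighbor: "valid_adj A \<Longrightarrow> v \<in> {1..n} \<Longrightarrow> y \<in> set (A v) \<Longrightarrow> y \<in> {1..n}"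
  unfolding valid_adj_def by blast

lemma proj_simps: "v \<in> {1..n} \<Longrightarrow> proj \<sigma> v = max r (\<sigma> v)"
  by (simp add: proj_def)

lemma avail_proj:
  assumes "valid_adj A" "v \<in> {1..n}"
  shows "avail A (proj \<sigma>) v = avail A \<sigma> v"
proof -
  have "c \<in> proj \<sigma> ` set (A v) \<longleftrightarrow> c \<in> \<sigma> ` set (A v)" if "r < c" for c
  proof -
    have "proj \<sigma> y = c \<longleftrightarrow> \<sigma> y = c" if "y \<in> set (A v)" for y
    proof -
      have "y \<in> {1..n}" using assms that by (rule valid_adj_neighbor)
      then show ?thesis using \<open>r < c\<close> by (auto simp: proj_simps max_def)
    qed
    then show ?thesis by (auto simp: image_iff) metis+
  qed
  note * = this
  show ?thesis
    unfolding avail_def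
  proof (rule filter_cong[OF refl])
    fix c assume "c \<in> set (rev [Suc r..<Suc r + q])"
    then have "r < c" by auto
    then show "(c \<notin> proj \<sigma> ` set (A v)) = (c \<notin> \<sigma> ` set (A v))" by (simp only: *)
  qed
qed

lemma blank_deg_proj:
  assumes "valid_adj A" "v \<in> {1..n}"
  shows "blank_deg A (proj \<sigma>) v = blank_deg A \<sigma> v"
proof -
  have "y \<in> {1..n}" if "y \<in> set (A v)" for y using assms that by (rule valid_adj_neighbor)
  then have "filter (\<lambda>y. proj \<sigma> y \<le> r) (A v) = filter (\<lambda>y. \<sigma> y \<le> r) (A v)"
    by (intro filter_cong) (simp_all only: proj_simps max.bounded_iff, auto)
  then show ?thesis by (simp add: blank_deg_def)
qed

lemma settled_proj: "valid_adj A \<Longrightarrow> v \<in> {1..n} \<Longrightarrow> settled A (proj \<sigma>) v \<longleftrightarrow> settled A \<sigma> v"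
  by (auto simp: settled_def blank_deg_proj proj_simps)

lemma culprit_proj:
  assumes "valid_adj A" "v \<in> {1..n}"
  shows "culprit A (proj \<sigma>) v = culprit A \<sigma> v"
proof -
  have "y \<in> {1..n}" if "y \<in> set (A v)" for y using assms that by (rule valid_adj_neighbor)
  then have "filter (\<lambda>y. length (avail A (proj \<sigma>) y) < l) (A v) = filter (\<lambda>y. length (avail A \<sigma> y) < l) (A v)"
    using assms(1) by (intro filter_cong) (simp_all add: avail_proj)
  then show ?thesis by (simp add: culprit_def)
qed

lemma resample_proj:
  assumes "valid_adj A"
  shows "set vs \<subseteq> {1..n} \<Longrightarrow> resample A (proj \<sigma>) \<rho> vs = proj (resample A \<sigma> \<rho> vs)"
proof (induction vs arbitrary: \<sigma> \<rho>)
  case (Cons v vs)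
  have "r \<le> pick r (avail A \<sigma> v) j" for j
    using avail_facts(3)[of A \<sigma> v] nth_mem[of j "avail A \<sigma> v"] by (fastforce simp: pick_def)
  then have "(proj \<sigma>)(v := pick r (avail A \<sigma> v) j) = proj (\<sigma>(v := pick r (avail A \<sigma> v) j))" for j
    using Cons.prems by (auto simp: proj_def fun_eq_iff restrict_def max_absorb2)
  then show ?case using Cons avail_proj[OF assms, of v \<sigma>] by simp
qed simp

text \<open>The delicate case has two blank endpoints: their projections always agree and
  \<open>u\<close> is reset to \<open>r\<close>, but \<open>proj\<close> does not distinguish this
  from keeping a secondary color.\<close>

lemma update_col_proj:
  assumes "endpoints_ok n u"
  shows "update_col u (proj \<sigma>) = proj (update_col u \<sigma>)"
  using assms by (cases u) (auto simp: proj_def fun_eq_iff restrict_def max_def)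

text \<open>The counterpart of \<open>prob_of_resample_le\<close> for a fixed sequence of words:
  later vertices of \<open>vs\<close> keep their lists because \<open>vs\<close> spans no
  edge.\<close>

lemma resample_reachable:
  assumes "distinct vs" "\<And>v. v \<in> set vs \<Longrightarrow> set (A v) \<inter> set vs = {}"
  shows "resample A \<sigma> \<rho> vs \<in> reachable A vs \<sigma>"
  using assms
proof (induction vs arbitrary: \<sigma> \<rho>)
  case Nil
  then show ?case by (simp add: reachable_def)
next
  case (Cons v vs)
  define p where "p = pick r (avail A \<sigma> v) (\<rho> 0 mod Suc (length (avail A \<sigma> v)))"
  define \<sigma>' where "\<sigma>' = \<sigma>(v := p)"
  have p: "p \<in> insert r (set (avail A \<sigma> v))" by (auto simp: p_def pick_def)
  have avail': "avail A \<sigma>' x = avail A \<sigma> x" if "x \<in> set vs" for x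
    by (rule avail_cong) (use that Cons.prems in \<open>force simp: \<sigma>'_def\<close>)
  have IH: "resample A \<sigma>' (\<lambda>i. \<rho> (Suc i)) vs \<in> reachable A vs \<sigma>'"
    by (rule Cons.IH) (use Cons.prems in auto)
  have "resample A \<sigma> \<rho> (v # vs) = resample A \<sigma>' (\<lambda>i. \<rho> (Suc i)) vs"
    by (simp add: \<sigma>'_def p_def)
  moreover have "resample A \<sigma>' (\<lambda>i. \<rho> (Suc i)) vs \<in> reachable A (v # vs) \<sigma>"
    using IH p avail' Cons.prems by (auto simp: reachable_def) (auto simp: \<sigma>'_def)
  ultimately show ?case by simp
qed

lemma ok_state_resample:
  assumes ok: "ok_state A \<sigma> W" and x: "x \<in> {1..n}" and b: "\<And>y. y \<in> {1..n} \<Longrightarrow> resample A \<sigma> \<rho> (rev (A x)) y \<le> r + q"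
  shows "ok_state A (resample A \<sigma> \<rho> (rev (A x))) (fold push (rev (A x)) W)"
proof -
  let ?\<tau> = "resample A \<sigma> \<rho> (rev (A x))"
  have A: "valid_adj A" using ok by (simp add: ok_state_def)
  have "?\<tau> \<in> reachable A (rev (A x)) \<sigma>"
    using A x by (intro resample_reachable) (auto simp: valid_adj_def)
  then have off: "y \<notin> set (A x) \<Longrightarrow> ?\<tau> y = \<sigma> y"
    and on: "y \<in> set (A x) \<Longrightarrow> ?\<tau> y \<in> insert r (set (avail A \<sigma> y))" for y
    by (auto simp: reachable_def)
  have "?\<tau> v \<noteq> ?\<tau> y \<or> ?\<tau> v = r" if vy: "v \<in> {1..n}" "y \<in> set (A v)" for v y
  proof (cases "v \<in> set (A x)")
    case True
    then have "y \<notin> set (A x)" using A x vy by (fastforce simp: valid_adj_def)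
    then show ?thesis using on[OF True] off[of y] vy by (auto simp: set_avail)
  next
    case v: False
    show ?thesis
    proof (cases "y \<in> set (A x)")
      case True
      have "v \<in> set (A y)" using A vy by (auto simp: valid_adj_def)
      then have "\<sigma> v \<in> \<sigma> ` set (A y)" by (rule imageI)
      then show ?thesis using on[OF True] off[OF v] by (auto simp: set_avail)
    next
      case False
      then show ?thesis using off[OF v] off[OF False] ok vy by (auto simp: ok_state_def)
    qed
  qed
  moreover have "set (A x) \<subseteq> {1..n}" using A x by (auto simp: valid_adj_def)
  moreover have "v \<in> set (A x) \<union> set W" if "v \<in> {1..n}" "?\<tau> v = r" for v
    using ok that off[of v] by (cases "v \<in> set (A x)") (auto simp: ok_state_def)
  ultimately show ?thesis
    using ok b by (auto simp: ok_state_def set_fold_push distinct_fold_push)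
qed

text \<open>Pigeonhole: secondary colors around \<open>v\<close> occur on blank neighbors only, and
  there are fewer than \<open>r\<close> of these.\<close>

lemma free_color_exists:
  assumes "blank_deg A \<sigma> v < r"
  shows "free_colors A \<sigma> v 0 r \<noteq> []"
proof
  assume "free_colors A \<sigma> v 0 r = []"
  then have "{0..<r} \<subseteq> \<sigma> ` set (A v)" by (auto simp: free_colors_def filter_empty_conv)
  then have "{0..<r} \<subseteq> \<sigma> ` set (filter (\<lambda>y. \<sigma> y \<le> r) (A v))" by fastforce
  then have "card {0..<r} \<le> card (\<sigma> ` set (filter (\<lambda>y. \<sigma> y \<le> r) (A v)))" by (intro card_mono) auto
  also have "\<dots> \<le> card (set (filter (\<lambda>y. \<sigma> y \<le> r) (A v)))" by (rule card_image_le) simp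
  also have "\<dots> \<le> blank_deg A \<sigma> v" unfolding blank_deg_def by (rule card_length)
  finally show False using assms by simp
qed

lemma reach_settled: "settled A \<sigma> v \<Longrightarrow> reach s us A \<sigma> (v # W) \<rho> = reach s us A \<sigma> W \<rho>"
  by (cases s) auto

lemma reach_update: "reach s (u # us) A \<sigma> [] \<rho> = reach s us (update_adj u A) (update_col u \<sigma>) (update_work u) \<rho>"
  by (cases s) auto

end

section \<open>The machine simulates the abstract process\<close>

context recolor_machine
begin

text \<open>Amortization over \<open>k\<close> present worklist entries and at most \<Delta> new
  ones for each of \<open>j\<close> recolorings: removing an entry takes time linear in \<Delta>, a
  recoloring itself quadratic time.\<close>

definition loop_cost :: "nat \<Rightarrow> nat \<Rightarrow> int" where
  "loop_cost k j = 40 * (int \<Delta> + 1) * (int k + int \<Delta> * int j) + 80 * (int \<Delta> + 1)\<^sup>2 * int j + 1"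

lemma ok_stateD:
  assumes "ok_state A \<sigma> W"
  shows "valid_adj A" "y \<in> {1..n} \<Longrightarrow> \<sigma> y \<le> r + q" "distinct W" "set W \<subseteq> {1..n}"
  using assms by (auto simp: ok_state_def)

text \<open>\<open>c\<close> precedes the quantifiers over registers and memory, as it is determined
  by the coloring alone; the main loop needs the next coloring before a machine state is
  given.\<close>

lemma assign_prog_correct:
  assumes ok: "ok_state A \<sigma> (v # W)" and bl: "blank_deg A \<sigma> v < r" "\<sigma> v \<le> r"
  shows "\<exists>c<r. ok_state A (\<sigma>(v := c)) W \<and>
    (\<forall>R M D. loaded R \<longrightarrow> R 10 = v \<longrightarrow> R 9 = v \<longrightarrow> rep M A \<sigma> (v # W) \<longrightarrow>
    hoare w \<omega> assign_prog (13 * int r + 7 * int \<Delta> + 23) R M D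
      (\<lambda>R' M' D'. D' = D \<and> loaded R' \<and> R' 9 = head W \<and> rep M' A (\<sigma>(v := c)) W))"
proof -
  note okD = ok_stateD[OF ok]
  have vn: "v \<in> {1..n}" using okD(4) by simp
  define fs where "fs = free_colors A \<sigma> v 0 r"
  define c where "c = fs ! 0"
  have "fs \<noteq> []" using free_color_exists[OF bl(1)] by (simp add: fs_def)
  then have "c \<in> set fs" by (simp add: c_def)
  then have c: "c < r" "c \<notin> \<sigma> ` set (A v)" by (auto simp: fs_def free_colors_def)
  have pick: "pick d fs 0 = c" for d using \<open>fs \<noteq> []\<close> by (simp add: pick_def c_def)
  have sym: "x \<in> {1..n} \<Longrightarrow> v \<in> set (A x) \<Longrightarrow> x \<in> set (A v)" for x
    using okD(1) by (auto simp: valid_adj_def)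
  have ok': "ok_state A (\<sigma>(v := c)) W"
  proof -
    have "(\<sigma>(v := c)) x \<noteq> (\<sigma>(v := c)) y \<or> (\<sigma>(v := c)) x = r" if xy: "x \<in> {1..n}" "y \<in> set (A x)" for x y
    proof -
      have "y \<noteq> x" using okD(1) xy by (auto simp: valid_adj_def)
      moreover have "\<sigma> x \<noteq> c" if "y = v"
        using c(2) imageI[OF sym[OF xy(1)], of \<sigma>] xy(2) that by auto
      moreover have "\<sigma> y \<noteq> c" if "x = v" using c(2) imageI[of y "set (A v)" \<sigma>] xy(2) that by auto
      ultimately show ?thesis using ok xy by (auto simp: ok_state_def)
    qed
    moreover have "(\<sigma>(v := c)) x = r \<longrightarrow> x \<in> set W" if "x \<in> {1..n}" for x
      using ok that c(1) by (auto simp: ok_state_def)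
    moreover have "(\<sigma>(v := c)) x \<le> r + q" if "x \<in> {1..n}" for x
      using okD(2)[OF that] c(1) by simp
    ultimately show ?thesis using okD(1,3,4) unfolding ok_state_def by simp
  qed
  have rw: "r < 2 ^ w" "v < 2 ^ w" using palette fits_N[of r] row_facts(4)[OF vn] by auto
  have hoare: "hoare w \<omega> assign_prog (13 * int r + 7 * int \<Delta> + 23) R M D
      (\<lambda>R' M' D'. D' = D \<and> loaded R' \<and> R' 9 = head W \<and> rep M' A (\<sigma>(v := c)) W)"
    if R: "loaded R" and v: "R 10 = v" "R 9 = v" and M: "rep M A \<sigma> (v # W)" for R M D
  proof -
  define R1 where "R1 = R(20 := v, 21 := 0, 22 := r, 23 := 0)"
  have s1: "same_off {20..23} R R1" by (auto simp: R1_def same_off_def)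
  have L1: "loaded R1" by (rule loaded_same_off[OF R s1]) auto
  have r1: "R1 20 = v" "R1 21 = 0" "R1 22 = r" "R1 23 = 0" "R1 10 = v" "R1 9 = v" using v by (simp_all add: R1_def)
  have "hoare w \<omega> (scan_prog @ [Store 10 25] @ pop_prog) (19 + (13 * int r + 7 * int \<Delta>)) R1 M D
      (\<lambda>R' M' D'. D' = D \<and> loaded R' \<and> R' 9 = head W \<and> rep M' A (\<sigma>(v := c)) W)"
  proof (rule hoare_append[OF scan_prog_correct[OF L1 M okD(1) vn okD(2) r1(1) r1(2) r1(3)]])
    fix R2 M2 D2
    assume "D2 = D \<and> same_off {24..30} R1 R2 \<and> R2 24 = length (free_colors A \<sigma> v 0 r) \<and>
      R2 25 = pick (R1 25) (free_colors A \<sigma> v 0 r) (R1 23) \<and> (\<forall>a<(n + 1) * N. M2 a = M a)"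
    then have D2: "D2 = D" and s2: "same_off {24..30} R1 R2" and p2: "R2 25 = c"
      and m2: "\<And>a. a < (n + 1) * N \<Longrightarrow> M2 a = M a"
      by (simp_all add: r1 pick fs_def[symmetric])
    have L2: "loaded R2" by (rule loaded_same_off[OF L1 s2]) auto
    have r2: "R2 10 = v" "R2 9 = v" using s2 r1 by (simp_all add: same_off_def)
    have rp: "rep (M2(v := c)) A (\<sigma>(v := c)) (v # W)"
      by (rule rep_set_color[OF rep_agree[OF M m2 okD(1)] vn valid_imp_short[OF okD(1)]])
    have "hoare w \<omega> pop_prog 6 R2 (M2(v := c)) D
      (\<lambda>R' M' D'. D' = D \<and> loaded R' \<and> R' 9 = head W \<and> rep M' A (\<sigma>(v := c)) W)"
    proof (rule hoare_mono[OF pop_prog_correct[OF L2 rp valid_imp_short[OF okD(1)] r2(2) okD(3,4)]])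
      fix R' M' D'
      assume "D' = D \<and> same_off {9, 26, 27} R2 R' \<and> R' 9 = head W \<and> rep M' A (\<sigma>(v := c)) W"
      then show "D' = D \<and> loaded R' \<and> R' 9 = head W \<and> rep M' A (\<sigma>(v := c)) W"
        using loaded_same_off[OF L2, of "{9, 26, 27}" R'] by auto
    qed simp
    then show "hoare w \<omega> ([Store 10 25] @ pop_prog) (19 + (13 * int r + 7 * int \<Delta>) - (13 * int r + 7 * int \<Delta> + 12)) R2 M2 D2
      (\<lambda>R' M' D'. D' = D \<and> loaded R' \<and> R' 9 = head W \<and> rep M' A (\<sigma>(v := c)) W)"
      by (simp add: D2 hoare_Store r2 p2)
  qed auto
  then show "hoare w \<omega> assign_prog (13 * int r + 7 * int \<Delta> + 23) R M D
      (\<lambda>R' M' D'. D' = D \<and> loaded R' \<and> R' 9 = head W \<and> rep M' A (\<sigma>(v := c)) W)"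
    unfolding assign_prog_def append_Cons append_Nil R1_def
    by (intro hoare_Op hoare_Const) (simp add: loadedD[OF R] v rw)
  qed
  show ?thesis using ok' c hoare by blast
qed

text \<open>Termination comes from the failure of \<open>reach s\<close>, which also drives the
  induction. The conclusion records the number \<open>j\<close> of recolorings as a shift of
  \<open>reach\<close>, for arbitrary further updates; this transports facts about
  \<open>reach\<close> between a whole update sequence and its pieces.\<close>

lemma main_loop_correct:
  assumes "q \<le> \<Delta>" "r \<le> \<Delta>"
  shows "\<not> reach s us A (proj \<sigma>) W (\<lambda>i. \<omega> (i + D)) \<Longrightarrow> ok_state A \<sigma> W \<Longrightarrow>
    \<exists>j \<sigma>' D'. (\<forall>R M. loaded R \<longrightarrow> R 9 = head W \<longrightarrow> rep M A \<sigma> W \<longrightarrow>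
        hoare w \<omega> [Loop 9 main_body] (loop_cost (length W) j) R M D (\<lambda>R' M' D''. D'' = D' \<and> rep M' A \<sigma>' [])) \<and>
      ok_state A \<sigma>' [] \<and>
      (\<forall>s' us'. reach (s' + j) us' A (proj \<sigma>) W (\<lambda>i. \<omega> (i + D)) =
        reach s' us' A (proj \<sigma>') [] (\<lambda>i. \<omega> (i + D')))"
proof (induction s arbitrary: \<sigma> W D)
  case 0
  then show ?case by simp
next
  case (Suc s)
  let ?test = "[Op Less 14 13 5, Cond 14 assign_prog (culprit_prog @ resample_prog)]"
  show ?case using Suc.prems
  proof (induction W arbitrary: \<sigma>)
    case Nil
    show ?case
    proof (rule exI[of _ 0], rule exI[of _ \<sigma>], rule exI[of _ D], intro conjI allI impI)
      fix R M assume "loaded R" "R 9 = head []" "rep M A \<sigma> []"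
      then show "hoare w \<omega> [Loop 9 main_body] (loop_cost (length ([] :: nat list)) 0) R M D (\<lambda>R' M' D''. D'' = D \<and> rep M' A \<sigma> [])"
        by (intro hoare_Loop_exit hoare_Nil) (simp_all add: loop_cost_def)
    qed (use Nil in simp_all)
  next
    case (Cons v W)
    note ok = Cons.prems(2)
    note okD = ok_stateD[OF ok]
    have v: "v \<in> {1..n}" using okD(4) by simp
    have sv: "settled A (proj \<sigma>) v \<longleftrightarrow> settled A \<sigma> v" by (rule settled_proj[OF okD(1) v])
    have vw: "v < 2 ^ w" by (rule row_facts(4)[OF v])
    define R1 where "R1 R = R(10 := v, 11 := \<sigma> v, 12 := of_bool (r < \<sigma> v))" for R :: "nat \<Rightarrow> nat"
    have s1: "same_off {10, 11, 12} R (R1 R)" for R by (auto simp: R1_def same_off_def)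
    have L1: "loaded (R1 R)" if "loaded R" for R by (rule loaded_same_off[OF that s1]) auto
    have start: "hoare w \<omega> [Loop 9 main_body] T R M D Q"
      if R: "loaded R" "R 9 = v" and M: "rep M A \<sigma> (v # W)" and
        t: "hoare w \<omega> ((if r < \<sigma> v then pop_prog else count_prog @ ?test)
          @ [Loop 9 main_body]) (T - 5) (R1 R) M D Q" for T R M Q
    proof (rule hoare_Loop_enter)
      show "R 9 \<noteq> 0" using R v by simp
      have "T - 1 - 1 - 1 - 1 - 1 = T - 5" by simp
      with t show "hoare w \<omega> (main_body @ [Loop 9 main_body]) (T - 1) R M D Q"
        unfolding main_body_def append_Cons append_Nil R1_def
        by (intro hoare_Op hoare_Load hoare_Cond) (auto simp: loadedD[OF R(1)] R(2) vw repD(1)[OF M v])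
    qed
    show ?case
    proof (cases "settled A \<sigma> v")
      case settled: True
      have eq: "reach s' us' A (proj \<sigma>) (v # W) \<rho> = reach s' us' A (proj \<sigma>) W \<rho>" for s' us' \<rho>
        by (rule reach_settled) (simp add: sv settled)
      \<comment> \<open>Popping a primary vertex and giving a blank one a secondary color look alike
        after projection: the abstract process just drops \<open>v\<close>.\<close>
      obtain \<sigma>1 where ok1: "ok_state A \<sigma>1 W" and p1: "proj \<sigma>1 = proj \<sigma>"
        and t1: "\<And>R M. loaded R \<Longrightarrow> R 9 = v \<Longrightarrow> rep M A \<sigma> (v # W) \<Longrightarrow>
          hoare w \<omega> (if r < \<sigma> v then pop_prog else count_prog @ ?test)
           (28 * int \<Delta> + 35) (R1 R) M D (\<lambda>R' M' D'. D' = D \<and> loaded R' \<and> R' 9 = head W \<and> rep M' A \<sigma>1 W)"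
      proof (cases "r < \<sigma> v")
        case True
        show ?thesis
        proof (rule that[of \<sigma>])
          show "ok_state A \<sigma> W" using ok True by (auto simp: ok_state_def)
          fix R M assume R: "loaded R" "R 9 = v" and M: "rep M A \<sigma> (v # W)"
          have "R1 R 9 = v" using R by (simp add: R1_def)
          note * = pop_prog_correct[OF L1[OF R(1)] M valid_imp_short[OF okD(1)] this okD(3,4), of D]
          have "hoare w \<omega> pop_prog (28 * int \<Delta> + 35) (R1 R) M D
            (\<lambda>R' M' D'. D' = D \<and> loaded R' \<and> R' 9 = head W \<and> rep M' A \<sigma> W)"
          proof (rule hoare_mono[OF *])
            fix R' M' D'
            assume "D' = D \<and> same_off {9, 26, 27} (R1 R) R' \<and> R' 9 = head W \<and> rep M' A \<sigma> W"
            then show "D' = D \<and> loaded R' \<and> R' 9 = head W \<and> rep M' A \<sigma> W"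
              using loaded_same_off[OF L1[OF R(1)], of "{9, 26, 27}" R'] by auto
          qed simp
          then show "hoare w \<omega> (if r < \<sigma> v then pop_prog else count_prog @ ?test)
            (28 * int \<Delta> + 35) (R1 R) M D (\<lambda>R' M' D'. D' = D \<and> loaded R' \<and> R' 9 = head W \<and> rep M' A \<sigma> W)"
            using True by simp
        qed simp
      next
        case False
        then have bl: "blank_deg A \<sigma> v < r" "\<sigma> v \<le> r" using settled by (auto simp: settled_def)
        define Q where "Q c = (\<lambda>R' M' D'. D' = D \<and> loaded R' \<and> R' 9 = head W \<and> rep M' A (\<sigma>(v := c)) W)" for c
        have "\<exists>c<r. ok_state A (\<sigma>(v := c)) W \<and> (\<forall>R M. loaded R \<longrightarrow> R 10 = v \<longrightarrow> R 9 = v \<longrightarrow> rep M A \<sigma> (v # W) \<longrightarrow>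
            hoare w \<omega> assign_prog (13 * int r + 7 * int \<Delta> + 23) R M D (Q c))"
          unfolding Q_def using assign_prog_correct[OF ok bl] by blast
        then obtain c where c: "c < r" "ok_state A (\<sigma>(v := c)) W"
          and tc: "\<And>R M. loaded R \<Longrightarrow> R 10 = v \<Longrightarrow> R 9 = v \<Longrightarrow> rep M A \<sigma> (v # W) \<Longrightarrow>
            hoare w \<omega> assign_prog (13 * int r + 7 * int \<Delta> + 23) R M D (Q c)" by blast
        show ?thesis
        proof (rule that[of "\<sigma>(v := c)"])
          show "proj (\<sigma>(v := c)) = proj \<sigma>" using c bl by (auto simp: proj_def fun_eq_iff restrict_def)
          fix R M assume R: "loaded R" "R 9 = v" and M: "rep M A \<sigma> (v # W)"
          have r1: "R1 R 10 = v" "R1 R 9 = v" using R by (simp_all add: R1_def)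
          have "hoare w \<omega> (count_prog @ ?test)
            (28 * int \<Delta> + 35) (R1 R) M D (Q c)"
          proof (rule hoare_append[OF count_prog_correct[OF L1[OF R(1)] M okD(1) r1(1) v]])
            fix R2 M2 D2
            assume *: "D2 = D \<and> same_off {13, 27, 28, 29} (R1 R) R2 \<and> R2 13 = blank_deg A \<sigma> v \<and> M2 = M"
            have s3: "same_off {13, 14, 27, 28, 29} (R1 R) (R2(14 := 1))"
              using * by (auto simp: same_off_def)
            have L3: "loaded (R2(14 := 1))" by (rule loaded_same_off[OF L1[OF R(1)] s3]) auto
            have L2: "loaded R2" using * by (intro loaded_same_off[OF L1[OF R(1)], of "{13, 27, 28, 29}"]) auto
            have "R2 10 = v" "R2 9 = v" using * r1 by (simp_all add: same_off_def)
            then have "hoare w \<omega> assign_prog (13 * int r + 7 * int \<Delta> + 23) (R2(14 := 1)) M D (Q c)"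
              by (intro tc L3 M) simp_all
            then have "hoare w \<omega> assign_prog (28 * int \<Delta> + 35 - (8 * int \<Delta> + 5) - 1 - 1) (R2(14 := 1)) M D (Q c)"
              by (rule hoare_mono) (use \<open>r \<le> \<Delta>\<close> in auto)
            then show "hoare w \<omega> ?test
              (28 * int \<Delta> + 35 - (8 * int \<Delta> + 5)) R2 M2 D2 (Q c)"
              using * bl(1) loadedD[OF L2] by (intro hoare_Op hoare_Cond) simp
          qed
          then show "hoare w \<omega> (if r < \<sigma> v then pop_prog else count_prog @ ?test)
            (28 * int \<Delta> + 35) (R1 R) M D (\<lambda>R' M' D'. D' = D \<and> loaded R' \<and> R' 9 = head W \<and> rep M' A (\<sigma>(v := c)) W)"
            using False by (simp add: Q_def)
        qed (use c in auto)
      qed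
      have "\<not> reach (Suc s) us A (proj \<sigma>1) W (\<lambda>i. \<omega> (i + D))"
        using Cons.prems(1) unfolding eq p1 .
      from Cons.IH[OF this ok1] obtain j \<sigma>' D' where
        t2: "\<And>R M. loaded R \<Longrightarrow> R 9 = head W \<Longrightarrow> rep M A \<sigma>1 W \<Longrightarrow>
          hoare w \<omega> [Loop 9 main_body] (loop_cost (length W) j) R M D (\<lambda>R' M' D''. D'' = D' \<and> rep M' A \<sigma>' [])"
        and ok2: "ok_state A \<sigma>' []"
        and eq2: "\<And>s' us'. reach (s' + j) us' A (proj \<sigma>1) W (\<lambda>i. \<omega> (i + D)) =
          reach s' us' A (proj \<sigma>') [] (\<lambda>i. \<omega> (i + D'))"
        by blast
      show ?thesis
      proof (rule exI[of _ j], rule exI[of _ \<sigma>'], rule exI[of _ D'], intro conjI allI impI)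
        show "reach (s' + j) us' A (proj \<sigma>) (v # W) (\<lambda>i. \<omega> (i + D)) = reach s' us' A (proj \<sigma>') [] (\<lambda>i. \<omega> (i + D'))" for s' us'
          using eq2[of s' us'] unfolding eq p1 .
        fix R M assume R: "loaded R" "R 9 = head (v # W)" and M: "rep M A \<sigma> (v # W)"
        have R9: "R 9 = v" using R by simp
        show "hoare w \<omega> [Loop 9 main_body] (loop_cost (length (v # W)) j) R M D (\<lambda>R' M' D''. D'' = D' \<and> rep M' A \<sigma>' [])"
        proof (rule start[OF R(1) R9 M], rule hoare_append[OF t1[OF R(1) R9 M]])
          fix R' M' D''
          assume *: "D'' = D \<and> loaded R' \<and> R' 9 = head W \<and> rep M' A \<sigma>1 W"
          have "hoare w \<omega> [Loop 9 main_body] (loop_cost (length W) j) R' M' D (\<lambda>R' M' D''. D'' = D' \<and> rep M' A \<sigma>' [])"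
            using * by (intro t2) auto
          then show "hoare w \<omega> [Loop 9 main_body] (loop_cost (length (v # W)) j - 5 - (28 * int \<Delta> + 35)) R' M' D''
            (\<lambda>R' M' D''. D'' = D' \<and> rep M' A \<sigma>' [])"
            using * by (auto elim!: hoare_mono simp: loop_cost_def algebra_simps)
        qed
      qed (rule ok2)
    next
      case False
      define x where "x = culprit A \<sigma> v"
      define \<tau> where "\<tau> = resample A \<sigma> (\<lambda>i. \<omega> (i + D)) (rev (A x))"
      define V where "V = fold push (rev (A x)) (v # W)"
      define D1 where "D1 = D + length (A x)"
      have nv: "\<not> r < \<sigma> v" "\<not> blank_deg A \<sigma> v < r" using False by (auto simp: settled_def)
      have "x \<in> insert v (set (A v))" unfolding x_def by (rule culprit_flawed(1)[OF False])
      then have x: "x \<in> {1..n}" using valid_adj_neighbor[OF okD(1) v] v by blast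
      have Ax: "set (A x) \<subseteq> {1..n}" "length (A x) \<le> \<Delta>" using okD(1) x by (auto simp: valid_adj_def)
      have ok1: "ok_state A \<tau> V"
        unfolding \<tau>_def V_def by (rule ok_state_resample[OF ok x resample_le[OF okD(2)]])
      have eq: "reach (Suc s') us' A (proj \<sigma>) (v # W) (\<lambda>i. \<omega> (i + D)) =
          reach s' us' A (proj \<tau>) V (\<lambda>i. \<omega> (i + D1))" for s' us'
      proof -
        have "resample A (proj \<sigma>) (\<lambda>i. \<omega> (i + D)) (rev (A x)) = proj \<tau>"
          unfolding \<tau>_def using Ax by (intro resample_proj okD(1)) simp
        then show ?thesis
          using False sv by (simp add: culprit_proj[OF okD(1) v] x_def[symmetric] V_def D1_def add.assoc add.commute[of D])
      qed
      have "\<not> reach s us A (proj \<tau>) V (\<lambda>i. \<omega> (i + D1))" using Cons.prems(1) unfolding eq .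
      from Suc.IH[OF this ok1] obtain j \<sigma>' D' where
        t2: "\<And>R M. loaded R \<Longrightarrow> R 9 = head V \<Longrightarrow> rep M A \<tau> V \<Longrightarrow>
          hoare w \<omega> [Loop 9 main_body] (loop_cost (length V) j) R M D1 (\<lambda>R' M' D''. D'' = D' \<and> rep M' A \<sigma>' [])"
        and ok2: "ok_state A \<sigma>' []"
        and eq2: "\<And>s' us'. reach (s' + j) us' A (proj \<tau>) V (\<lambda>i. \<omega> (i + D1)) =
          reach s' us' A (proj \<sigma>') [] (\<lambda>i. \<omega> (i + D'))"
        by blast
      define Tc where "Tc = int \<Delta> * (13 * int q + 7 * int \<Delta> + 19) + 6"
      define Tr where "Tr = int \<Delta> * (26 * int q + 14 * int \<Delta> + 45) + 5"
      \<comment> \<open>By \<open>q \<le> \<Delta>\<close>, scanning the palette for every neighbor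
        stays quadratic in \<Delta>.\<close>
      have Tcr: "8 * int \<Delta> + 12 + Tc + Tr \<le> 80 * (int \<Delta> + 1)\<^sup>2"
      proof -
        have "int \<Delta> * int q \<le> int \<Delta> * int \<Delta>" using assms by (intro mult_left_mono) auto
        moreover have "0 \<le> int \<Delta> * int \<Delta>" by simp
        moreover have "8 * int \<Delta> + 12 + Tc + Tr = 39 * (int \<Delta> * int q) + 21 * (int \<Delta> * int \<Delta>) + 72 * int \<Delta> + 23"
          by (simp add: Tc_def Tr_def algebra_simps)
        moreover have "80 * (int \<Delta> + 1)\<^sup>2 = 80 * (int \<Delta> * int \<Delta>) + 160 * int \<Delta> + 80"
          by (simp add: power2_eq_square algebra_simps)
        ultimately show ?thesis by linarith
      qed
      show ?thesis
      proof (rule exI[of _ "Suc j"], rule exI[of _ \<sigma>'], rule exI[of _ D'], intro conjI allI impI)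
        show "reach (s' + Suc j) us' A (proj \<sigma>) (v # W) (\<lambda>i. \<omega> (i + D)) = reach s' us' A (proj \<sigma>') [] (\<lambda>i. \<omega> (i + D'))" for s' us'
          using eq2[of s' us'] eq[of "s' + j" us'] by simp
        fix R M assume R: "loaded R" "R 9 = head (v # W)" and M: "rep M A \<sigma> (v # W)"
        have R9: "R 9 = v" using R by simp
        let ?Q = "\<lambda>R' M' D''. D'' = D' \<and> rep M' A \<sigma>' []"
        have r1: "R1 R 10 = v" "R1 R 9 = v" using R by (simp_all add: R1_def)
        have "hoare w \<omega> (count_prog @ ?test @ [Loop 9 main_body])
            (loop_cost (length (v # W)) (Suc j) - 5) (R1 R) M D ?Q"
        proof (rule hoare_append[OF count_prog_correct[OF L1[OF R(1)] M okD(1) r1(1) v]])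
          fix R2 M2 D2
          assume *: "D2 = D \<and> same_off {13, 27, 28, 29} (R1 R) R2 \<and> R2 13 = blank_deg A \<sigma> v \<and> M2 = M"
          have L2: "loaded R2" using * by (intro loaded_same_off[OF L1[OF R(1)], of "{13, 27, 28, 29}"]) auto
          define R3 where "R3 = R2(14 := 0)"
          have L3: "loaded R3" using L2 by (auto simp: R3_def loaded_def)
          have r3: "R3 10 = v" "R3 9 = head (v # W)" using * r1 by (simp_all add: R3_def same_off_def)
          have "hoare w \<omega> (culprit_prog @ resample_prog @ [Loop 9 main_body])
            (loop_cost (length (v # W)) (Suc j) - 5 - (8 * int \<Delta> + 5) - 2) R3 M D ?Q"
          proof (rule hoare_append[OF culprit_prog_correct[OF L3 M okD(1) r3(1) v okD(2)]])
            fix R4 M4 D4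
            assume **: "D4 = D \<and> same_off ({15, 16, 17} \<union> {20..30}) R3 R4 \<and> R4 15 = culprit A \<sigma> v \<and> rep M4 A \<sigma> (v # W)"
            have L4: "loaded R4" using ** by (intro loaded_same_off[OF L3, of "{15, 16, 17} \<union> {20..30}"]) auto
            have r4: "R4 15 = x" "R4 9 = head (v # W)" using ** r3 by (simp_all add: x_def same_off_def)
            have M4: "rep M4 A \<sigma> (v # W)" using ** by simp
            show "hoare w \<omega> (resample_prog @ [Loop 9 main_body])
              (loop_cost (length (v # W)) (Suc j) - 5 - (8 * int \<Delta> + 5) - 2 - (int \<Delta> * (13 * int q + 7 * int \<Delta> + 19) + 6)) R4 M4 D4 ?Q"
              unfolding Tc_def[symmetric]
            proof (rule hoare_append[OF resample_prog_correct[OF L4 M4 okD(1) r4(1) x okD(2) r4(2) okD(4)]])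
              fix R5 M5 D5
              assume "D5 = D4 + length (A x) \<and> same_off ({9, 16, 17} \<union> {20..31}) R4 R5 \<and>
                R5 9 = head (fold push (rev (A x)) (v # W)) \<and>
                rep M5 A (resample A \<sigma> (\<lambda>i. \<omega> (i + D4)) (rev (A x))) (fold push (rev (A x)) (v # W))"
              then have 5: "D5 = D1" "same_off ({9, 16, 17} \<union> {20..31}) R4 R5" "R5 9 = head V" "rep M5 A \<tau> V"
                using ** by (simp_all add: D1_def \<tau>_def V_def)
              have "loaded R5" by (rule loaded_same_off[OF L4 5(2)]) auto
              then have t: "hoare w \<omega> [Loop 9 main_body] (loop_cost (length V) j) R5 M5 D1 ?Q" using 5 by (intro t2)
              have "length V \<le> Suc (length W) + \<Delta>"
                using length_fold_push[of "rev (A x)" "v # W"] Ax by (simp add: V_def)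
              then have "40 * (int \<Delta> + 1) * (int (length V) + int \<Delta> * int j) \<le>
                40 * (int \<Delta> + 1) * (int (length (v # W)) + int \<Delta> * int (Suc j))"
                by (intro mult_left_mono) (auto simp: algebra_simps)
              then have "loop_cost (length V) j \<le> loop_cost (length (v # W)) (Suc j) - 80 * (int \<Delta> + 1)\<^sup>2"
                by (simp add: loop_cost_def algebra_simps)
              also have "\<dots> \<le> loop_cost (length (v # W)) (Suc j) - 5 - (8 * int \<Delta> + 5) - 2 - Tc - Tr"
                using Tcr by simp
              finally show "hoare w \<omega> [Loop 9 main_body]
                (loop_cost (length (v # W)) (Suc j) - 5 - (8 * int \<Delta> + 5) - 2 - Tc - (int \<Delta> * (26 * int q + 14 * int \<Delta> + 45) + 5)) R5 M5 D5 ?Q"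
                using t 5(1) unfolding Tr_def[symmetric] by (auto elim!: hoare_mono)
            qed
          qed
          moreover have "loop_cost (length (v # W)) (Suc j) - 5 - (8 * int \<Delta> + 5) - 1 - 1 = loop_cost (length (v # W)) (Suc j) - 5 - (8 * int \<Delta> + 5) - 2"
            by simp
          ultimately show "hoare w \<omega> (?test @ [Loop 9 main_body])
            (loop_cost (length (v # W)) (Suc j) - 5 - (8 * int \<Delta> + 5)) R2 M2 D2 ?Q"
            unfolding append_Cons append_Nil R3_def
            using * nv(2) loadedD[OF L2] by (intro hoare_Op hoare_Cond) simp
        qed
        then show "hoare w \<omega> [Loop 9 main_body] (loop_cost (length (v # W)) (Suc j)) R M D ?Q"
          using nv(1) by (intro start[OF R(1) R9 M]) simp
      qed (rule ok2)
    qed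
  qed
qed

end

section \<open>Processing an update\<close>

text \<open>On the list without its last entry, replacing \<open>v\<close> by that last entry is
  injective, because the last entry occurs nowhere else.\<close>

lemma remove_swap_facts:
  assumes "distinct xs" "v \<in> set xs"
  shows "set (remove_swap v xs) = set xs - {v}" "distinct (remove_swap v xs)"
proof -
  define f where "f y = (if y = v then last xs else y)" for y
  obtain ys z where xs: "xs = ys @ [z]" using assms(2) by (cases xs rule: rev_cases) auto
  have rs: "remove_swap v xs = map f ys" by (simp add: remove_swap_def f_def xs)
  have z: "f v = z" by (simp add: f_def xs)
  have "set (remove_swap v xs) = set xs - {v} \<and> distinct (remove_swap v xs)"
  proof (cases "v = z")
    case True
    then have "map f ys = ys" using assms(1) by (intro map_idI) (auto simp: f_def xs)
    then show ?thesis using True assms(1) rs by (auto simp: xs)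
  next
    case False
    have "inj_on f (set ys)" using assms(1) by (auto simp: inj_on_def f_def xs)
    moreover have "f ` set ys = insert z (set ys - {v})"
      using assms(2) False by (auto simp: f_def xs image_iff)
    ultimately show ?thesis using assms(1) rs False by (auto simp: distinct_map xs)
  qed
  then show "set (remove_swap v xs) = set xs - {v}" "distinct (remove_swap v xs)" by auto
qed

lemma graph_after_snoc: "graph_after (us @ [x]) = apply_update x (graph_after us)"
  by (simp add: graph_after_def)

lemma valid_updates_snoc:
  "valid_updates n \<Delta> (us @ [x]) \<longleftrightarrow> valid_updates n \<Delta> us \<and> valid_update n \<Delta> (graph_after us) x"
  unfolding valid_updates_def by (auto simp: nth_append less_Suc_eq)

lemma valid_updates_take: "valid_updates n \<Delta> us \<Longrightarrow> valid_updates n \<Delta> (take t us)"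
  unfolding valid_updates_def by auto

section \<open>Graphs and their adjacency lists\<close>

context recolor
begin

definition represents :: "adjacency \<Rightarrow> nat set set \<Rightarrow> bool" where
  "represents A E \<longleftrightarrow> (\<forall>v\<in>{1..n}. set (A v) = {y. {v, y} \<in> E} \<and> distinct (A v)) \<and>
     (\<forall>e\<in>E. \<exists>u v. e = {u, v} \<and> u \<noteq> v \<and> u \<in> {1..n} \<and> v \<in> {1..n})"

lemma represents_edge:
  assumes "represents A E" "{u, v} \<in> E"
  shows "u \<in> {1..n}" "v \<in> {1..n}" "u \<noteq> v"
proof -
  obtain x y where "{u, v} = {x, y}" "x \<noteq> y" "x \<in> {1..n}" "y \<in> {1..n}"
    using assms by (auto simp: represents_def)
  then show "u \<in> {1..n}" "v \<in> {1..n}" "u \<noteq> v" by (auto simp: doubleton_eq_iff)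
qed

lemma represents_valid_adj:
  assumes AE: "represents A E" and "triangle_free E" and deg: "\<forall>v\<in>{1..n}. degree E v \<le> \<Delta>"
  shows "valid_adj A"
  unfolding valid_adj_def
proof (intro ballI conjI)
  fix v assume v: "v \<in> {1..n}"
  have Av: "set (A v) = {y. {v, y} \<in> E}" "distinct (A v)" using AE v by (auto simp: represents_def)
  show "set (A v) \<subseteq> {1..n}" using represents_edge(2)[OF AE] Av by auto
  show "distinct (A v)" by (rule Av(2))
  show "v \<notin> set (A v)" using represents_edge(3)[OF AE, of v v] Av by auto
  \<comment> \<open>Edges at \<open>v\<close> correspond to neighbors of \<open>v\<close>, which
    identifies \<open>degree\<close> with the length of the list.\<close>
  have "bij_betw (\<lambda>y. {v, y}) (set (A v)) {e \<in> E. v \<in> e}"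
    unfolding bij_betw_def
  proof
    show "inj_on (\<lambda>y. {v, y}) (set (A v))" by (auto simp: inj_on_def doubleton_eq_iff)
    show "(\<lambda>y. {v, y}) ` set (A v) = {e \<in> E. v \<in> e}"
    proof (intro equalityI subsetI)
      fix e assume e: "e \<in> {e \<in> E. v \<in> e}"
      then obtain a b where "e = {a, b}" using AE by (auto simp: represents_def)
      with e have "e = {v, if v = a then b else a}" by auto
      moreover from this e have "(if v = a then b else a) \<in> set (A v)" using Av by auto
      ultimately show "e \<in> (\<lambda>y. {v, y}) ` set (A v)" by (rule image_eqI)
    qed (auto simp: Av)
  qed
  then have "card (set (A v)) = degree E v" unfolding degree_def by (rule bij_betw_same_card)
  then show "length (A v) \<le> \<Delta>" using deg v Av(2) by (simp add: distinct_card)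
  fix u assume u: "u \<in> set (A v)"
  then have vu: "{v, u} \<in> E" using Av by auto
  have un: "u \<in> {1..n}" "v \<noteq> u" using represents_edge[OF AE vu] by auto
  have Au: "set (A u) = {y. {u, y} \<in> E}" using AE un by (auto simp: represents_def)
  show "v \<in> set (A u)" using vu by (simp add: Au insert_commute)
  show "set (A u) \<inter> set (A v) = {}"
  proof (rule ccontr)
    assume "set (A u) \<inter> set (A v) \<noteq> {}"
    then obtain y where y: "{u, y} \<in> E" "{v, y} \<in> E" using Au Av by auto
    have "distinct [v, u, y]" using represents_edge(3)[OF AE y(1)] represents_edge(3)[OF AE y(2)] un by auto
    then show False using assms(2) vu y unfolding triangle_free_def by blast
  qed
qed

lemma represents_update:
  assumes AE: "represents A E" and u: "changes_one_edge n E x"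
  shows "represents (update_adj x A) (apply_update x E)" "endpoints_ok n x"
    "x = Delete a b \<Longrightarrow> b \<in> set (A a) \<and> a \<in> set (A b)"
proof -
  have "represents (update_adj x A) (apply_update x E) \<and> endpoints_ok n x \<and>
    (x = Delete a b \<longrightarrow> b \<in> set (A a) \<and> a \<in> set (A b))"
  proof (cases x)
    case (Insert a' b')
    then have ab: "a' \<in> {1..n}" "b' \<in> {1..n}" "a' \<noteq> b'" "{a', b'} \<notin> E" "{b', a'} \<notin> E"
      using u by (auto simp: insert_commute)
    have "set ((A(a' := A a' @ [b'], b' := A b' @ [a'])) v) = {y. {v, y} \<in> E \<union> {{a', b'}}} \<and>
        distinct ((A(a' := A a' @ [b'], b' := A b' @ [a'])) v)" if v: "v \<in> {1..n}" for v
    proof -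
      have "set (A v) = {y. {v, y} \<in> E}" "distinct (A v)" using AE v by (auto simp: represents_def)
      then show ?thesis using ab by (auto simp: doubleton_eq_iff)
    qed
    then show ?thesis using AE ab by (auto simp: Insert represents_def)
  next
    case (Delete a' b')
    then have E: "{a', b'} \<in> E" "{b', a'} \<in> E" using u by (auto simp: insert_commute)
    then have ab: "a' \<in> {1..n}" "b' \<in> {1..n}" "a' \<noteq> b'" using represents_edge[OF AE] by auto
    have mem: "b' \<in> set (A a')" "a' \<in> set (A b')" using AE ab E by (auto simp: represents_def)
    have "set ((A(a' := remove_swap b' (A a'), b' := remove_swap a' (A b'))) v) = {y. {v, y} \<in> E - {{a', b'}}} \<and>
        distinct ((A(a' := remove_swap b' (A a'), b' := remove_swap a' (A b'))) v)" if v: "v \<in> {1..n}" for v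
    proof -
      have Av: "set (A v) = {y. {v, y} \<in> E}" "distinct (A v)" using AE v by (auto simp: represents_def)
      have "set (remove_swap b' (A a')) = set (A a') - {b'}" "distinct (remove_swap b' (A a'))"
        "set (remove_swap a' (A b')) = set (A b') - {a'}" "distinct (remove_swap a' (A b'))"
        using remove_swap_facts mem AE ab by (auto simp: represents_def)
      then show ?thesis using ab Av by (auto simp: doubleton_eq_iff)
    qed
    then show ?thesis using AE ab mem by (auto simp: Delete represents_def)
  qed
  then show "represents (update_adj x A) (apply_update x E)" "endpoints_ok n x"
    "x = Delete a b \<Longrightarrow> b \<in> set (A a) \<and> a \<in> set (A b)" by auto
qed

definition adj_after :: "update list \<Rightarrow> adjacency" where
  "adj_after us = fold update_adj us (\<lambda>_. [])"

lemma adj_after_snoc: "adj_after (us @ [x]) = update_adj x (adj_after us)"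
  by (simp add: adj_after_def)

lemma valid_adjs_snoc:
  "valid_adjs A (us @ [x]) \<longleftrightarrow> valid_adjs A us \<and> endpoints_ok n x \<and> valid_adj (update_adj x (fold update_adj us A))"
  by (induction us arbitrary: A) (auto dest: valid_adjs_imp)

lemma valid_updates_represents:
  "valid_updates n \<Delta> us \<Longrightarrow> represents (adj_after us) (graph_after us) \<and> valid_adj (adj_after us) \<and>
    valid_adjs (\<lambda>_. []) us"
proof (induction us rule: rev_induct)
  case Nil
  show ?case by (simp add: represents_def adj_after_def graph_after_def valid_adj_def)
next
  case (snoc x us)
  then have vu: "valid_update n \<Delta> (graph_after us) x" and
    IH: "represents (adj_after us) (graph_after us)" "valid_adjs (\<lambda>_. []) us"
    by (auto simp: valid_updates_snoc)
  have ch: "changes_one_edge n (graph_after us) x" using vu by (simp add: valid_update_def)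
  have rp: "represents (adj_after (us @ [x])) (graph_after (us @ [x]))"
    using represents_update(1)[OF IH(1) ch] by (simp add: adj_after_snoc graph_after_snoc)
  have "valid_adj (adj_after (us @ [x]))"
    using vu by (intro represents_valid_adj[OF rp]) (auto simp: graph_after_snoc valid_update_def)
  then show ?case
    using rp IH(2) represents_update(2)[OF IH(1) ch] by (simp add: valid_adjs_snoc adj_after_def)
qed

text \<open>An insertion can create a conflict only between its endpoints; the first of them then
  loses its color, and it is on the worklist.\<close>

lemma ok_state_update:
  assumes ok: "ok_state A \<sigma> []" and x: "endpoints_ok n x" and A: "valid_adj (update_adj x A)"
  shows "ok_state (update_adj x A) (update_col x \<sigma>) (update_work x)"
proof (cases x)
  case (Insert a b)
  then have ab: "a \<noteq> b" "a \<in> {1..n}" "b \<in> {1..n}" using x by auto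
  have "update_col x \<sigma> v \<noteq> update_col x \<sigma> y \<or> update_col x \<sigma> v = r"
    if vy: "v \<in> {1..n}" "y \<in> set (update_adj x A v)" for v y
  proof -
    have "y \<in> set (A v) \<or> (v = a \<and> y = b) \<or> (v = b \<and> y = a)"
      using vy by (auto simp: Insert split: if_splits)
    moreover have "\<sigma> v \<noteq> \<sigma> y" if "y \<in> set (A v)"
      using ok vy that by (auto simp: ok_state_def)
    moreover have "\<sigma> v \<noteq> r" using ok vy by (auto simp: ok_state_def)
    moreover have "\<sigma> b \<noteq> r" using ok ab by (auto simp: ok_state_def)
    ultimately show ?thesis using ab by (auto simp: Insert)
  qed
  note proper = this
  have "\<forall>v\<in>{1..n}. update_col x \<sigma> v = r \<longrightarrow> v \<in> set (update_work x)"
    using ok by (auto simp: Insert ok_state_def)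
  moreover have "update_col x \<sigma> v \<le> r + q" if "v \<in> {1..n}" for v
    using ok that by (auto simp: Insert ok_state_def)
  moreover have "distinct (update_work x)" "set (update_work x) \<subseteq> {1..n}" using ab by (auto simp: Insert)
  ultimately show ?thesis
    unfolding ok_state_def using A proper by blast
next
  case (Delete a b)
  have "\<sigma> v \<noteq> \<sigma> y" if "v \<in> {1..n}" "y \<in> set (update_adj x A v)" for v y
  proof -
    have "y \<in> set (A v)" using that set_remove_swap by (auto simp: Delete split: if_splits)
    then show ?thesis using ok that(1) by (auto simp: ok_state_def)
  qed
  then show ?thesis using ok A unfolding ok_state_def by (simp add: Delete)
qed

lemma reach_pred: "reach s us A \<sigma> W \<rho> \<Longrightarrow> reach (s - 1) us A \<sigma> W \<rho>"
proof (induction s us A \<sigma> W \<rho> rule: reach.induct)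
  case (3 s u us A \<sigma> \<rho>)
  then show ?case by (simp add: reach_update)
next
  case (4 s us A \<sigma> v W \<rho>)
  then show ?case by (cases s) (auto split: if_splits)
qed auto

lemma reach_antimono: "reach t us A \<sigma> W \<rho> \<Longrightarrow> s \<le> t \<Longrightarrow> reach s us A \<sigma> W \<rho>"
proof (induction t)
  case (Suc t)
  then show ?case using reach_pred[OF Suc.prems(1)] by (cases "s = Suc t") auto
qed simp

end

section \<open>Correctness of the update program\<close>

context recolor_machine
begin

lemma load_prog_correct:
  assumes "rep M A \<sigma> W" "R 18 = 0" "R 9 = 0"
    and "hoare w \<omega> p (T - 10) (R(3 := 1, 4 := N, 5 := r, 6 := q, 7 := l, 8 := (n + 1) * N, 10 := N - 4)) M D Q"
  shows "hoare w \<omega> (load_prog @ p) T R M D Q"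
proof -
  have m: "M 0 = N" "M (N - 1) = r" "M (N - 2) = q" "M (N - 3) = l" "M (N - 4) = (n + 1) * N"
    using assms(1) by (auto simp: rep_def)
  have Nw: "N < 2 ^ w" "N - 1 < 2 ^ w" "N - 2 < 2 ^ w" "N - 3 < 2 ^ w" using fits_N[of N] by auto
  have e: "N - 1 - 1 = N - 2" "N - 2 - 1 = N - 3" "N - 3 - 1 = N - 4" by simp_all
  have ge: "1 \<le> N" "1 \<le> N - 1" "1 \<le> N - 2" "1 \<le> N - 3" using N_ge by auto
  have down: "hoare w \<omega> (Op Minus 10 10 3 # Load k 10 # p) T R M D Q"
    if "R 3 = 1" "R 10 = a" "1 \<le> a" "a < 2 ^ w" "k \<noteq> 10"
      "hoare w \<omega> p (T - 2) (R(10 := a - 1, k := M (a - 1))) M D Q" for a k p T R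
  proof (intro hoare_Op hoare_Load)
    have "word_op w Minus (R 10) (R 3) = a - 1" using that by (simp only: word_op.simps word_minus)
    then show "hoare w \<omega> p (T - 1 - 1) ((R(10 := word_op w Minus (R 10) (R 3)))
        (k := M ((R(10 := word_op w Minus (R 10) (R 3))) 10))) M D Q"
      using that(6) by simp
  qed
  have w0: "w \<noteq> 0" using w_pos by (cases w) auto
  define R4 where "R4 = R(3 := 1, 4 := N, 10 := N - 1, 5 := r)"
  define R5 where "R5 = R4(10 := N - 2, 6 := q)"
  define R6 where "R6 = R5(10 := N - 3, 7 := l)"
  have eq: "R6(10 := N - 4, 8 := (n + 1) * N) =
      R(3 := 1, 4 := N, 5 := r, 6 := q, 7 := l, 8 := (n + 1) * N, 10 := N - 4)"
    by (auto simp: fun_eq_iff R6_def R5_def R4_def)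
  have r: "R4 3 = 1" "R4 10 = N - 1" "R5 3 = 1" "R5 10 = N - 2" "R6 3 = 1" "R6 10 = N - 3"
    by (simp_all add: R6_def R5_def R4_def)
  have "hoare w \<omega> (Op Minus 10 10 3 # Load 8 10 # p) (T - 8) R6 M D Q"
    by (rule down[OF r(5,6) ge(4) Nw(4)], simp) (use assms(4) in \<open>simp only: e m eq, simp\<close>)
  then have "hoare w \<omega> (Op Minus 10 10 3 # Load 7 10 # Op Minus 10 10 3 # Load 8 10 # p) (T - 6) R5 M D Q"
    by (intro down[OF r(3,4) ge(3) Nw(3)]) (simp_all only: e m R6_def[symmetric], simp_all)
  then have *: "hoare w \<omega> (Op Minus 10 10 3 # Load 6 10 # Op Minus 10 10 3 # Load 7 10 # Op Minus 10 10 3 # Load 8 10 # p) (T - 4) R4 M D Q"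
    by (intro down[OF r(1,2) ge(2) Nw(2)]) (simp_all only: e m R5_def[symmetric], simp_all)
  show ?thesis
    unfolding load_prog_def append_Cons append_Nil
    apply (rule hoare_Const, rule hoare_Load, rule hoare_Op, rule hoare_Load)
    using * w_pos w0 unfolding R4_def
    by (simp add: assms(2) m[unfolded One_nat_def] word_minus[OF ge(1) Nw(1), unfolded One_nat_def])
qed

text \<open>The lists of the two endpoints change one after the other, and the state
  \<open>A1\<close> in between is merely \<open>short\<close>. Premise \<open>del\<close> provides
  the last entry that \<open>remove_prog\<close> reads.\<close>

lemma update_program_correct:
  assumes qr: "q \<le> \<Delta>" "r \<le> \<Delta>" and ok: "ok_state A \<sigma> []" and M: "rep M A \<sigma> []"
    and x: "endpoints_ok n x" and A': "valid_adj (update_adj x A)"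
    and del: "\<And>a b. x = Delete a b \<Longrightarrow> A a \<noteq> [] \<and> A b \<noteq> []"
    and R: "\<And>k. R k = (if k < length (input_of x) then input_of x ! k else 0)"
    and nr: "\<not> reach s (x # us) A (proj \<sigma>) [] (\<lambda>i. \<omega> (i + D))"
  shows "\<exists>j \<sigma>' D'. hoare w \<omega> update_program (14 * int \<Delta> + 50 + loop_cost 1 j) R M D
        (\<lambda>R' M' D''. D'' = D' \<and> rep M' (update_adj x A) \<sigma>' []) \<and>
      ok_state (update_adj x A) \<sigma>' [] \<and>
      (\<forall>s' us'. reach (s' + j) (x # us') A (proj \<sigma>) [] (\<lambda>i. \<omega> (i + D)) =
        reach s' us' (update_adj x A) (proj \<sigma>') [] (\<lambda>i. \<omega> (i + D')))"
proof -
  let ?A = "update_adj x A"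
  let ?ins = "[Load 10 1, Load 11 2, Op Equal 12 10 11, Cond 12 [Store 1 5] [], Op Plus 20 1 18]"
  define \<sigma>1 where "\<sigma>1 = update_col x \<sigma>"
  define W where "W = update_work x"
  have ok1: "ok_state ?A \<sigma>1 W" unfolding \<sigma>1_def W_def by (rule ok_state_update[OF ok x A'])
  have eq: "reach s' (x # us') A (proj \<sigma>) [] \<rho> = reach s' us' ?A (proj \<sigma>1) W \<rho>" for s' us' \<rho>
    by (simp add: reach_update update_col_proj[OF x] \<sigma>1_def W_def)
  have "\<not> reach s us ?A (proj \<sigma>1) W (\<lambda>i. \<omega> (i + D))" using nr unfolding eq .
  from main_loop_correct[OF qr this ok1] obtain j \<sigma>' D' where
    t: "\<And>R M. loaded R \<Longrightarrow> R 9 = head W \<Longrightarrow> rep M ?A \<sigma>1 W \<Longrightarrow>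
        hoare w \<omega> [Loop 9 main_body] (loop_cost (length W) j) R M D (\<lambda>R' M' D''. D'' = D' \<and> rep M' ?A \<sigma>' [])"
    and ok': "ok_state ?A \<sigma>' []"
    and eq': "\<And>s' us'. reach (s' + j) us' ?A (proj \<sigma>1) W (\<lambda>i. \<omega> (i + D)) =
        reach s' us' ?A (proj \<sigma>') [] (\<lambda>i. \<omega> (i + D'))"
    by blast
  let ?Q = "\<lambda>R' M' D''. D'' = D' \<and> rep M' ?A \<sigma>' []"
  have lW: "loop_cost (length W) j \<le> loop_cost 1 j"
    unfolding W_def by (cases x) (auto simp: loop_cost_def)
  have t1: "hoare w \<omega> [Loop 9 main_body] T R M D ?Q"
    if "loaded R" "R 9 = head W" "rep M ?A \<sigma>1 W" "loop_cost 1 j \<le> T" for R M T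
    by (rule hoare_mono[OF t[OF that(1-3)]]) (use lW that(4) in auto)
  have vA: "valid_adj A" using ok by (simp add: ok_state_def)
  define R1 where "R1 = R(3 := 1, 4 := N, 5 := r, 6 := q, 7 := l, 8 := (n + 1) * N, 10 := N - 4)"
  have len3: "length (input_of x) = 3" by (cases x) auto
  have R18: "R 18 = 0" "R 9 = 0" by (simp_all add: R len3)
  have L1: "loaded R1" by (simp add: R1_def loaded_def R18)
  have "hoare w \<omega> (load_prog @ [Cond 0
     (append_prog 1 2 @ append_prog 2 1 @ ?ins @ push_prog)
     (remove_prog 1 2 @ remove_prog 2 1), Loop 9 main_body]) (14 * int \<Delta> + 50 + loop_cost 1 j) R M D ?Q"
  proof (rule load_prog_correct[OF M R18], fold R1_def)
    show "hoare w \<omega> [Cond 0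
     (append_prog 1 2 @ append_prog 2 1 @ ?ins @ push_prog)
     (remove_prog 1 2 @ remove_prog 2 1), Loop 9 main_body] (14 * int \<Delta> + 50 + loop_cost 1 j - 10) R1 M D ?Q"
    proof (rule hoare_Cond, cases x)
      case (Insert a b)
      then have ab: "a \<noteq> b" "a \<in> {1..n}" "b \<in> {1..n}" using x by auto
      have r1: "R1 0 = 1" "R1 1 = a" "R1 2 = b" "R1 9 = 0" using R Insert by (simp_all add: R1_def)
      define A1 where "A1 = A(a := A a @ [b])"
      have A1: "?A = A1(b := A1 b @ [a])" using ab by (simp add: A1_def Insert)
      have lens: "length (A v) \<le> \<Delta>" if "v \<in> {1..n}" for v using vA that by (auto simp: valid_adj_def)
      have s1: "short A1" using lens by (auto simp: short_def A1_def le_SucI)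
      have lb: "length (A1 b) \<le> \<Delta>" using lens[OF ab(3)] ab by (simp add: A1_def)
      have W: "W = [a]" by (simp add: W_def Insert)
      have aw: "a < 2 ^ w" using row_facts(4)[OF ab(2)] .
      have last: "hoare w \<omega> (?ins @ push_prog @ [Loop 9 main_body])
          (27 + (14 * int \<Delta> + loop_cost 1 j)) R3 M3 D ?Q"
        if L3: "loaded R3" and r3: "R3 1 = a" "R3 2 = b" "R3 9 = 0" and M3: "rep M3 ?A \<sigma> []" for R3 M3
      proof -
        note sA = valid_imp_short[OF A']
        have m: "M3 a = \<sigma> a" "M3 b = \<sigma> b" using repD(1)[OF M3] ab by auto
        have push: "hoare w \<omega> (push_prog @ [Loop 9 main_body]) (8 + loop_cost 1 j) R4 M4 D ?Q"
          if L4: "loaded R4" and r4: "R4 20 = a" "R4 9 = head []" and M4: "rep M4 ?A \<sigma>1 []" for R4 M4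
        proof (rule hoare_append[OF push_prog_correct[OF L4 M4 sA r4(1) ab(2) r4(2)]])
          fix R5 M5 D5
          assume *: "D5 = D \<and> same_off {9, 26, 27, 28} R4 R5 \<and> R5 9 = head (push a []) \<and> rep M5 ?A \<sigma>1 (push a [])"
          then have "loaded R5" by (intro loaded_same_off[OF L4, of "{9, 26, 27, 28}"]) auto
          then show "hoare w \<omega> [Loop 9 main_body] (8 + loop_cost 1 j - 8) R5 M5 D5 ?Q"
            using * by (simp add: t1 W push_def)
        qed simp
        have push': "hoare w \<omega> (push_prog @ [Loop 9 main_body]) T R4 M4 D ?Q"
          if "loaded R4" "R4 20 = a" "R4 9 = head []" "rep M4 ?A \<sigma>1 []" "8 + loop_cost 1 j \<le> T" for R4 M4 T
          by (rule hoare_mono[OF push[OF that(1-4)] that(5)])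
        have M4: "rep (M3(a := r)) ?A (\<sigma>(a := r)) []" by (rule rep_set_color[OF M3 ab(2) sA])
        have \<sigma>1: "\<sigma>1 = (if \<sigma> a = \<sigma> b then \<sigma>(a := r) else \<sigma>)" by (simp add: \<sigma>1_def Insert)
        show ?thesis
          unfolding append_Cons append_Nil
          apply (intro hoare_Load hoare_Op hoare_Cond)
          using M3 M4 L3
          by (auto simp: r3 r3(1)[unfolded One_nat_def] m loadedD[OF L3] aw \<sigma>1 loaded_def intro!: push' hoare_Store hoare_Op)
      qed
      have "hoare w \<omega> (append_prog 1 2 @ append_prog 2 1 @ ?ins @ push_prog @ [Loop 9 main_body])
         (39 + (14 * int \<Delta> + loop_cost 1 j)) R1 M D ?Q"
      proof (rule hoare_append[OF append_prog_correct[OF L1 M valid_imp_short[OF vA] r1(2) ab(2) r1(3) _ _ lens[OF ab(2)]]])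
        fix R2 M2 D2
        assume *: "D2 = D \<and> same_off {10, 11} R1 R2 \<and> rep M2 (A(a := A a @ [b])) \<sigma> []"
        have L2: "loaded R2" using * by (intro loaded_same_off[OF L1, of "{10, 11}"]) auto
        have r2: "R2 1 = a" "R2 2 = b" "R2 9 = 0" using * r1 by (simp_all add: same_off_def)
        have M2: "rep M2 A1 \<sigma> []" and D2: "D2 = D" using * by (simp_all add: A1_def)
        show "hoare w \<omega> (append_prog 2 1 @ ?ins @ push_prog @ [Loop 9 main_body])
         (39 + (14 * int \<Delta> + loop_cost 1 j) - 6) R2 M2 D2 ?Q"
        proof (rule hoare_append[OF append_prog_correct[OF L2 M2 s1 r2(2) ab(3) r2(1) _ _ lb]])
          fix R3 M3 D3
          assume *: "D3 = D2 \<and> same_off {10, 11} R2 R3 \<and> rep M3 (A1(b := A1 b @ [a])) \<sigma> []"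
          have L3: "loaded R3" using * by (intro loaded_same_off[OF L2, of "{10, 11}"]) auto
          have "R3 1 = a" "R3 2 = b" "R3 9 = 0" using * r2 by (simp_all add: same_off_def)
          from last[OF L3 this] show "hoare w \<omega> (?ins @ push_prog @ [Loop 9 main_body])
            (39 + (14 * int \<Delta> + loop_cost 1 j) - 6 - 6) R3 M3 D3 ?Q"
            using * D2 A1 by simp
        qed simp_all
      qed simp_all
      then show "hoare w \<omega> ((if R1 0 \<noteq> 0 then append_prog 1 2 @ append_prog 2 1 @ ?ins @ push_prog
         else remove_prog 1 2 @ remove_prog 2 1) @ [Loop 9 main_body]) (14 * int \<Delta> + 50 + loop_cost 1 j - 10 - 1) R1 M D ?Q"
        using r1(1) by simp
    next
      case (Delete a b)
      then have ab: "a \<noteq> b" "a \<in> {1..n}" "b \<in> {1..n}" using x by auto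
      have r1: "R1 0 = 0" "R1 1 = a" "R1 2 = b" "R1 9 = 0" using R Delete by (simp_all add: R1_def)
      define A1 where "A1 = A(a := remove_swap b (A a))"
      have A1: "?A = A1(b := remove_swap a (A1 b))" using ab by (simp add: A1_def Delete)
      have lens: "length (A v) \<le> \<Delta>" if "v \<in> {1..n}" for v using vA that by (auto simp: valid_adj_def)
      have s1: "short A1"
        using lens by (auto simp: short_def A1_def remove_swap_def le_SucI intro: order_trans[OF diff_le_self])
      have ne: "A a \<noteq> []" "A1 b \<noteq> []" using del[OF Delete] ab by (simp_all add: A1_def)
      have "hoare w \<omega> (remove_prog 1 2 @ remove_prog 2 1 @ [Loop 9 main_body]) (39 + (14 * int \<Delta> + loop_cost 1 j)) R1 M D ?Q"
      proof (rule hoare_append[OF remove_prog_correct[OF L1 M valid_imp_short[OF vA] r1(2) ab(2) r1(3) _ _ ne(1)]])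
        fix R2 M2 D2
        assume *: "D2 = D \<and> same_off {10..16} R1 R2 \<and> rep M2 (A(a := remove_swap b (A a))) \<sigma> []"
        have L2: "loaded R2" using * by (intro loaded_same_off[OF L1, of "{10..16}"]) auto
        have r2: "R2 1 = a" "R2 2 = b" "R2 9 = 0" using * r1 by (simp_all add: same_off_def)
        have M2: "rep M2 A1 \<sigma> []" and D2: "D2 = D" using * by (simp_all add: A1_def)
        show "hoare w \<omega> (remove_prog 2 1 @ [Loop 9 main_body]) (39 + (14 * int \<Delta> + loop_cost 1 j) - (7 * int \<Delta> + 15)) R2 M2 D2 ?Q"
        proof (rule hoare_append[OF remove_prog_correct[OF L2 M2 s1 r2(2) ab(3) r2(1) _ _ ne(2)]])
          fix R3 M3 D3
          assume *: "D3 = D2 \<and> same_off {10..16} R2 R3 \<and> rep M3 (A1(b := remove_swap a (A1 b))) \<sigma> []"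
          have L3: "loaded R3" using * by (intro loaded_same_off[OF L2, of "{10..16}"]) auto
          have "R3 9 = head W" using * r2 by (simp add: same_off_def W_def Delete)
          moreover have "rep M3 ?A \<sigma>1 W" using * A1 by (simp add: W_def \<sigma>1_def Delete)
          ultimately show "hoare w \<omega> [Loop 9 main_body]
            (39 + (14 * int \<Delta> + loop_cost 1 j) - (7 * int \<Delta> + 15) - (7 * int \<Delta> + 15)) R3 M3 D3 ?Q"
            using * D2 L3 t1 by simp
        qed simp_all
      qed simp_all
      then show "hoare w \<omega> ((if R1 0 \<noteq> 0 then append_prog 1 2 @ append_prog 2 1 @ ?ins @ push_prog
         else remove_prog 1 2 @ remove_prog 2 1) @ [Loop 9 main_body]) (14 * int \<Delta> + 50 + loop_cost 1 j - 10 - 1) R1 M D ?Q"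
        using r1(1) by simp
    qed
  qed
  then have "hoare w \<omega> update_program (14 * int \<Delta> + 50 + loop_cost 1 j) R M D ?Q"
    by (simp only: update_program_def)
  then show ?thesis using ok' eq' unfolding eq by blast
qed

end

section \<open>Runs against an adversary\<close>

lemma sets_random_words_finite_prefix:
  assumes A: "A \<subseteq> space (random_words w)"
    and dep: "\<And>\<omega>. \<omega> \<in> A \<Longrightarrow> \<exists>m. \<forall>\<omega>'\<in>space (random_words w). (\<forall>i<m. \<omega>' i = \<omega> i) \<longrightarrow> \<omega>' \<in> A"
  shows "A \<in> sets (random_words w)"
proof -
  define Cyl where "Cyl xs = {\<omega> \<in> space (random_words w). \<forall>i<length xs. \<omega> i = xs ! i}" for xs :: "nat list"
  have comp: "(\<lambda>\<omega>. \<omega> i) \<in> measurable (random_words w) (count_space UNIV)" for i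
  proof -
    have "(\<lambda>\<omega>. \<omega> i) \<in> measurable (random_words w) (uniform_count_measure {..<2 ^ w})"
      unfolding random_words_def by (rule measurable_component_singleton) simp
    moreover have "(\<lambda>x. x) \<in> measurable (uniform_count_measure {..<2 ^ w :: nat}) (count_space UNIV)"
      by (auto simp: measurable_def space_uniform_count_measure sets_uniform_count_measure)
    ultimately show ?thesis by (rule measurable_compose)
  qed
  have Cyl: "Cyl xs \<in> sets (random_words w)" for xs
  proof -
    have "{\<omega> \<in> space (random_words w). \<omega> i = c} \<in> sets (random_words w)" for i c
    proof -
      have "(\<lambda>\<omega>. \<omega> i) -` {c} \<inter> space (random_words w) \<in> sets (random_words w)"
        by (rule measurable_sets[OF comp]) simp
      moreover have "(\<lambda>\<omega>. \<omega> i) -` {c} \<inter> space (random_words w) = {\<omega> \<in> space (random_words w). \<omega> i = c}" by auto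
      ultimately show ?thesis by simp
    qed
    then have "{\<omega> \<in> space (random_words w). \<forall>i\<in>{..<length xs}. \<omega> i = xs ! i} \<in> sets (random_words w)"
      by (intro sets.sets_Collect_finite_All) auto
    then show ?thesis by (simp only: Cyl_def Ball_def lessThan_iff)
  qed
  \<comment> \<open>There are only countably many finite lists of words, so an arbitrary union of
    cylinders is measurable.\<close>
  have "A = (\<Union>xs\<in>{xs. Cyl xs \<subseteq> A}. Cyl xs)"
  proof (intro equalityI subsetI)
    fix \<omega> assume w: "\<omega> \<in> A"
    from dep[OF w] obtain m where m: "\<And>\<omega>'. \<omega>' \<in> space (random_words w) \<Longrightarrow> (\<forall>i<m. \<omega>' i = \<omega> i) \<Longrightarrow> \<omega>' \<in> A" by blast
    have "Cyl (map \<omega> [0..<m]) \<subseteq> A" by (auto simp: Cyl_def intro!: m)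
    moreover have "\<omega> \<in> Cyl (map \<omega> [0..<m])" using w A by (auto simp: Cyl_def)
    ultimately show "\<omega> \<in> (\<Union>xs\<in>{xs. Cyl xs \<subseteq> A}. Cyl xs)" by blast
  qed auto
  also have "\<dots> \<in> sets (random_words w)"
    by (rule sets.countable_UN'') (auto simp: Cyl)
  finally show ?thesis .
qed

lemma step_drawn_mono: "drawn s \<le> drawn (step w \<omega> s)"
proof (cases "todo s")
  case (Cons c cs)
  then show ?thesis by (cases c) (simp_all add: step_def)
qed (simp add: step_def)

lemma step_cong:
  assumes "\<And>i. i < drawn (step w \<omega> s) \<Longrightarrow> \<omega>' i = \<omega> i"
  shows "step w \<omega>' s = step w \<omega> s"
proof (cases "todo s")
  case (Cons c cs)
  then show ?thesis using assms by (cases c) (simp_all add: step_def)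
qed (simp add: step_def)

lemma steps_drawn_mono: "i \<le> k \<Longrightarrow> drawn ((step w \<omega> ^^ i) s) \<le> drawn ((step w \<omega> ^^ k) s)"
  by (induction k) (auto simp: le_Suc_eq intro: order_trans[OF _ step_drawn_mono])

lemma steps_cong:
  assumes "\<And>i. i < drawn ((step w \<omega> ^^ k) s) \<Longrightarrow> \<omega>' i = \<omega> i"
  shows "(step w \<omega>' ^^ k) s = (step w \<omega> ^^ k) s"
  using assms
proof (induction k)
  case (Suc k)
  have "(step w \<omega>' ^^ k) s = (step w \<omega> ^^ k) s"
    using Suc.prems steps_drawn_mono[of k "Suc k" w \<omega> s] by (intro Suc.IH) auto
  moreover have "step w \<omega>' ((step w \<omega> ^^ k) s) = step w \<omega> ((step w \<omega> ^^ k) s)"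
    by (rule step_cong) (use Suc.prems in simp)
  ultimately show ?case by simp
qed simp

text \<open>No step before halting draws a word with index \<open>drawn s'\<close> or above, so
  changing those words affects neither the states nor the halting time.\<close>

lemma execute_cong:
  assumes ex: "execute w \<omega> s = Some (s', k)" and eq: "\<And>i. i < drawn s' \<Longrightarrow> \<omega>' i = \<omega> i"
  shows "execute w \<omega>' s = Some (s', k)" "drawn s \<le> drawn s'"
proof -
  let ?P = "\<lambda>\<omega> k. todo ((step w \<omega> ^^ k) s) = []"
  have e: "\<exists>k. ?P \<omega> k" and k: "k = (LEAST k. ?P \<omega> k)" and s': "s' = (step w \<omega> ^^ k) s"
    using ex by (auto simp: execute_def Let_def split: if_splits)
  have Pk: "?P \<omega> k" unfolding k using e by (rule LeastI_ex)
  have same: "(step w \<omega>' ^^ i) s = (step w \<omega> ^^ i) s" if "i \<le> k" for i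
    using eq steps_drawn_mono[OF that, of w \<omega> s] by (intro steps_cong) (auto simp: s')
  have "(LEAST k. ?P \<omega>' k) = k"
  proof (rule Least_equality)
    show "?P \<omega>' k" using Pk same by simp
    fix j assume j: "?P \<omega>' j"
    show "k \<le> j"
    proof (rule ccontr)
      assume "\<not> k \<le> j"
      then have "?P \<omega> j" using j same[of j] by simp
      then have "k \<le> j" unfolding k by (rule Least_le)
      then show False using \<open>\<not> k \<le> j\<close> by simp
    qed
  qed
  moreover have "\<exists>k. ?P \<omega>' k" using Pk same[of k] by (intro exI[of _ k]) simp
  ultimately show "execute w \<omega>' s = Some (s', k)" using same by (simp add: execute_def Let_def s')
  show "drawn s \<le> drawn s'" using steps_drawn_mono[of 0 k w \<omega> s] by (simp add: s')
qed

lemma run_cong: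
  assumes "run alg n \<Delta> adv \<omega> t = Some X" "\<And>i. i < words_drawn X \<Longrightarrow> \<omega>' i = \<omega> i"
  shows "run alg n \<Delta> adv \<omega>' t = Some X"
  using assms
proof (induction t arbitrary: X)
  case 0
  let ?s = "start (init_prog alg) [n, \<Delta>] (\<lambda>_. 0) 0"
  from 0 obtain s k where ex: "execute (word_size alg n \<Delta>) \<omega> ?s = Some (s, k)"
    by (auto split: option.splits)
  then have "words_drawn X = drawn s" using 0 by auto
  then have "execute (word_size alg n \<Delta>) \<omega>' ?s = Some (s, k)" using 0 by (intro execute_cong(1)[OF ex]) auto
  then show ?case using 0(1) ex by simp
next
  case (Suc t)
  from Suc.prems(1) obtain Y where Y: "run alg n \<Delta> adv \<omega> t = Some Y" by (auto split: option.splits)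
  define x where "x = next_update adv \<omega> Y"
  let ?s = "start (update_prog alg) (input_of x) (memory Y) (words_drawn Y)"
  from Suc.prems(1) Y obtain s k where ex: "execute (word_size alg n \<Delta>) \<omega> ?s = Some (s, k)"
    by (auto simp: x_def Let_def split: option.splits)
  have X: "words_drawn X = drawn s" using Suc.prems(1) Y ex by (auto simp: x_def Let_def)
  have ex': "execute (word_size alg n \<Delta>) \<omega>' ?s = Some (s, k)" "words_drawn Y \<le> words_drawn X"
    using execute_cong[OF ex, of \<omega>'] Suc.prems(2) X by (auto simp: start_def)
  have Y': "run alg n \<Delta> adv \<omega>' t = Some Y"
    using ex'(2) Suc.prems(2) by (intro Suc.IH Y) auto
  \<comment> \<open>The adversary sees only words already drawn, so it issues the same update for
    both sequences.\<close>
  have "map \<omega>' [0..<words_drawn Y] = map \<omega> [0..<words_drawn Y]"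
    using ex'(2) Suc.prems(2) by auto
  then have "next_update adv \<omega>' Y = x" by (simp only: next_update_def x_def)
  then show ?case using Suc.prems(1) Y Y' ex ex' by (simp add: x_def Let_def)
qed

lemma sets_run:
  "{\<omega> \<in> space (random_words w). \<exists>X. run alg n \<Delta> adv \<omega> t = Some X \<and> P X} \<in> sets (random_words w)"
proof (rule sets_random_words_finite_prefix)
  fix \<omega> assume "\<omega> \<in> {\<omega> \<in> space (random_words w). \<exists>X. run alg n \<Delta> adv \<omega> t = Some X \<and> P X}"
  then obtain X where X: "run alg n \<Delta> adv \<omega> t = Some X" "P X" by auto
  show "\<exists>m. \<forall>\<omega>'\<in>space (random_words w). (\<forall>i<m. \<omega>' i = \<omega> i) \<longrightarrow>
      \<omega>' \<in> {\<omega> \<in> space (random_words w). \<exists>X. run alg n \<Delta> adv \<omega> t = Some X \<and> P X}"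
  proof (intro exI[of _ "words_drawn X"] ballI impI)
    fix \<omega>' assume "\<omega>' \<in> space (random_words w)" "\<forall>i<words_drawn X. \<omega>' i = \<omega> i"
    then show "\<omega>' \<in> {\<omega> \<in> space (random_words w). \<exists>X. run alg n \<Delta> adv \<omega> t = Some X \<and> P X}"
      using run_cong[OF X(1), of \<omega>'] X(2) by auto
  qed
qed auto

definition init_program :: "nat \<Rightarrow> nat \<Rightarrow> nat \<Rightarrow> com list" where
  "init_program a b c = [Const 3 1, Op Plus 4 0 1, Const 5 8, Op Plus 4 4 5, Op Plus 5 1 18, Const 7 2,
     Loop 5 [Op Divide 5 5 7, Op Plus 6 6 3],
     Const 8 a, Op Times 8 8 1, Const 9 b, Op Times 9 9 6, Op Divide 8 8 9,
     Const 9 c, Op Times 9 9 6, Op Divide 10 1 9, Const 11 6, Op Times 11 11 9,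
     Op Plus 12 0 3, Op Times 12 12 4, Store 18 4,
     Op Minus 13 4 3, Store 13 10, Op Minus 13 13 3, Store 13 8,
     Op Minus 13 13 3, Store 13 11, Op Minus 13 13 3, Store 13 12]"

definition coloring_alg :: "nat \<Rightarrow> nat \<Rightarrow> nat \<Rightarrow> algorithm" where
  "coloring_alg a b c = \<lparr>init_prog = init_program a b c, update_prog = update_program, word_factor = 4\<rparr>"

text \<open>\<open>floorlog 2 \<Delta>\<close> is the number of binary digits of \<Delta>, which a
  program finds by repeated halving; it replaces the natural logarithm. The fractions
  \<open>a / b\<close> and \<open>1 / c\<close> absorb the change of base and the dependence on
  \<epsilon>, and \<open>ab\<close> keeps the intermediate products within a word.\<close>

locale recolor_alg = recolor_machine +
  fixes a b c :: nat
  assumes q_def: "q = (a * \<Delta>) div (b * floorlog 2 \<Delta>)" and r_def: "r = \<Delta> div (c * floorlog 2 \<Delta>)"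
    and l_def: "l = 6 * (c * floorlog 2 \<Delta>)"
    and qr: "q \<le> \<Delta>" "r \<le> \<Delta>" and w_def: "w = word_size (coloring_alg a b c) n \<Delta>"
    and ab: "a * \<Delta> < 2 ^ w" "b * floorlog 2 \<Delta> < 2 ^ w" "c * floorlog 2 \<Delta> < 2 ^ w" "a < 2 ^ w" "b < 2 ^ w" "c < 2 ^ w"
begin

lemma log_loop:
  "R 5 = x \<Longrightarrow> R 7 = 2 \<Longrightarrow> R 3 = 1 \<Longrightarrow> R 6 + floorlog 2 x < 2 ^ w \<Longrightarrow>
    hoare w \<omega> p (T - 3 * int (floorlog 2 x) - 1) (R(5 := 0, 6 := R 6 + floorlog 2 x)) M D Q \<Longrightarrow>
    hoare w \<omega> (Loop 5 [Op Divide 5 5 7, Op Plus 6 6 3] # p) T R M D Q"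
proof (induction x arbitrary: R T rule: less_induct)
  case (less x)
  show ?case
  proof (cases "x = 0")
    case True
    then have "R(5 := 0, 6 := R 6 + floorlog 2 x) = R" using less.prems by (auto simp: floorlog_def)
    moreover have "T - 3 * int (floorlog 2 x) - 1 = T - 1" using True by (simp add: floorlog_def)
    ultimately have "hoare w \<omega> p (T - 1) R M D Q" using less.prems(5) by (simp only:)
    then show ?thesis using less.prems True by (intro hoare_Loop_exit) auto
  next
    case False
    then have fl: "floorlog 2 x = Suc (floorlog 2 (x div 2))" by (subst compute_floorlog) simp
    define R' where "R' = R(5 := x div 2, 6 := Suc (R 6))"
    have eq: "R'(5 := 0, 6 := R' 6 + floorlog 2 (x div 2)) = R(5 := 0, 6 := R 6 + floorlog 2 x)"
      by (auto simp: R'_def fl fun_eq_iff)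
    have T: "T - 3 - 3 * int (floorlog 2 (x div 2)) - 1 = T - 3 * int (floorlog 2 x) - 1" by (simp add: fl)
    have "hoare w \<omega> (Loop 5 [Op Divide 5 5 7, Op Plus 6 6 3] # p) (T - 3) R' M D Q"
    proof (rule less.IH)
      show "hoare w \<omega> p (T - 3 - 3 * int (floorlog 2 (x div 2)) - 1) (R'(5 := 0, 6 := R' 6 + floorlog 2 (x div 2))) M D Q"
        unfolding eq T by (rule less.prems(5))
    qed (use False less.prems fl in \<open>auto simp: R'_def\<close>)
    moreover have "Suc (R 6) < 2 ^ w" using less.prems(4) fl by simp
    ultimately show ?thesis
      using less.prems False unfolding R'_def
      by (intro hoare_Loop_enter) (auto intro!: hoare_Op)
  qed
qed

lemma init_program_correct:
  assumes R: "\<And>k. R k = (if k < 2 then [n, \<Delta>] ! k else 0)"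
  shows "hoare w \<omega> (init_program a b c) (30 + 3 * int \<Delta>) R (\<lambda>_. 0) D
    (\<lambda>R' M' D'. D' = D \<and> rep M' (\<lambda>_. []) (\<lambda>_. 0) [])"
proof -
  let ?rest = "[Const 8 a, Op Times 8 8 1, Const 9 b, Op Times 9 9 6, Op Divide 8 8 9,
     Const 9 c, Op Times 9 9 6, Op Divide 10 1 9, Const 11 6, Op Times 11 11 9,
     Op Plus 12 0 3, Op Times 12 12 4, Store 18 4,
     Op Minus 13 4 3, Store 13 10, Op Minus 13 13 3, Store 13 8,
     Op Minus 13 13 3, Store 13 11, Op Minus 13 13 3, Store 13 12]"
  have rR: "R 0 = n" "R (Suc 0) = \<Delta>" "R 6 = 0" "R 18 = 0" by (simp_all add: R)
  define g where "g = floorlog 2 \<Delta>"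
  have g: "g \<le> \<Delta>"
  proof (cases "\<Delta> = 0")
    case False
    have "2 ^ (g - 1) \<le> \<Delta>" using floorlog_bounds[of \<Delta> 2] False by (simp add: g_def)
    moreover have "g - 1 < 2 ^ (g - 1)" by simp
    ultimately show ?thesis by linarith
  qed (simp add: g_def floorlog_def)
  have w2: "w \<noteq> 0" "(2::nat) < 2 ^ w" "(8::nat) < 2 ^ w" "(6::nat) < 2 ^ w"
    using w_pos fits_row[of 1 1] N_ge fits by (auto intro!: gr0I simp: algebra_simps)
  have small: "n + \<Delta> < 2 ^ w" "n + \<Delta> + 8 < 2 ^ w" "\<Delta> < 2 ^ w" "g < 2 ^ w" "Suc n < 2 ^ w"
    using fits_N[of "n + \<Delta>"] fits_N[of "n + \<Delta> + 8"] fits_N[of "\<Delta>"] fits_N[of g] fits_N[of "Suc n"] N g by auto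
  \<comment> \<open>The zeros elsewhere already encode empty lists, an empty worklist and color 0
    for every vertex, a secondary color because \<open>1 \<le> r\<close>.\<close>
  let ?M = "(\<lambda>_. 0)(0 := N, N - 1 := r, N - 2 := q, N - 3 := l, N - 4 := (n + 1) * N)"
  let ?Q = "\<lambda>R' M' D'. D' = D \<and> rep M' (\<lambda>_. []) (\<lambda>_. 0) []"
  have M: "rep ?M (\<lambda>_. []) (\<lambda>_. 0) []"
  proof -
    have z: "?M a = 0" if "a \<noteq> 0" "a < N - 4 \<or> N \<le> a" for a
      using that N_ge by auto
    have "?M v = 0 \<and> ?M (v * N) = 0 \<and> ?M (v * N + N - 1) = 0" if v: "v \<in> {1..n}" for v
    proof -
      have "1 * N \<le> v * N" using v by (intro mult_right_mono) auto
      then have "N \<le> v * N" by simp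
      moreover from this have "N \<le> v * N + N - 1" using N_ge by linarith
      moreover have "v < N - 4" using v N_ge by simp
      ultimately have "N \<le> v * N" "N \<le> v * N + N - 1" "v < N - 4" by auto
      then show ?thesis using v N_ge by (intro conjI z) auto
    qed
    moreover have "?M 0 = N \<and> ?M (N - 1) = r \<and> ?M (N - 2) = q \<and> ?M (N - 3) = l \<and> ?M (N - 4) = (n + 1) * N"
    proof -
      obtain K where K: "N = K + 8" using N_ge(1) by (metis add.commute le_Suc_ex)
      show ?thesis unfolding K by simp
    qed
    ultimately show ?thesis unfolding rep_def link.simps(1) list.size(3) by blast
  qed
  have down: "hoare w \<omega> (Op Minus 13 13 3 # Store 13 k # p) T R M D Q"
    if "R 3 = 1" "R 13 = a" "1 \<le> a" "a < 2 ^ w" "k \<noteq> 13"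
      "hoare w \<omega> p (T - 2) (R(13 := a - 1)) (M(a - 1 := R k)) D Q" for a k p T R M Q
  proof (intro hoare_Op hoare_Store)
    have "word_op w Minus (R 13) (R 3) = a - 1" using that by (simp only: word_op.simps word_minus)
    then show "hoare w \<omega> p (T - 1 - 1) (R(13 := word_op w Minus (R 13) (R 3)))
        (M((R(13 := word_op w Minus (R 13) (R 3))) 13 := (R(13 := word_op w Minus (R 13) (R 3))) k)) D Q"
      using that(5,6) by simp
  qed
  have e: "N - 1 - 1 = N - 2" "N - 2 - 1 = N - 3" "N - 3 - 1 = N - 4" by simp_all
  have ge: "1 \<le> N" "1 \<le> N - 1" "1 \<le> N - 2" "1 \<le> N - 3" using N_ge by auto
  have Nw: "N < 2 ^ w" "N - 1 < 2 ^ w" "N - 2 < 2 ^ w" "N - 3 < 2 ^ w" using fits_N[of N] by auto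
  have tail: "hoare w \<omega> [Op Minus 13 4 3, Store 13 10, Op Minus 13 13 3, Store 13 8,
     Op Minus 13 13 3, Store 13 11, Op Minus 13 13 3, Store 13 12] T R ((\<lambda>_. 0)(0 := N)) D ?Q"
    if r: "R 3 = 1" "R 4 = N" "R 8 = q" "R 10 = r" "R 11 = l" "R 12 = (n + 1) * N" and T: "8 \<le> T" for R T
  proof -
    have t6: "hoare w \<omega> [Op Minus 13 13 3, Store 13 12] (T - 6) (R(13 := N - 3)) ((\<lambda>_. 0)(0 := N, N - 1 := r, N - 2 := q, N - 3 := l)) D ?Q"
      by (rule down[of _ "N - 3"], insert r ge Nw M T)
        (simp_all only: e fun_upd_apply fun_upd_upd, simp_all add: hoare_Nil)
    have t4: "hoare w \<omega> [Op Minus 13 13 3, Store 13 11, Op Minus 13 13 3, Store 13 12] (T - 4) (R(13 := N - 2)) ((\<lambda>_. 0)(0 := N, N - 1 := r, N - 2 := q)) D ?Q"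
      by (rule down[of _ "N - 2"], insert t6 r ge Nw)
        (simp_all only: e fun_upd_apply fun_upd_upd, simp_all)
    have "hoare w \<omega> [Op Minus 13 13 3, Store 13 8, Op Minus 13 13 3, Store 13 11, Op Minus 13 13 3, Store 13 12] (T - 2) (R(13 := N - 1)) ((\<lambda>_. 0)(0 := N, N - 1 := r)) D ?Q"
      by (rule down[of _ "N - 1"], insert t4 r ge Nw)
        (simp_all only: e fun_upd_apply fun_upd_upd, simp_all)
    moreover have "word_op w Minus (R 4) (R 3) = N - 1" using r by (simp only: word_op.simps word_minus[OF ge(1) Nw(1)])
    ultimately show ?thesis
      by - (rule hoare_Op, rule hoare_Store, simp add: r)
  qed
  define R1 where "R1 = R(3 := 1, 4 := N, 7 := 2, 5 := 0, 6 := g)"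
  have r1: "R1 0 = n" "R1 (Suc 0) = \<Delta>" "R1 3 = 1" "R1 4 = N" "R1 6 = g" "R1 18 = 0" by (simp_all add: R1_def rR)
  have v: "a * \<Delta> div (b * g) = q" "\<Delta> div (c * g) = r" "6 * (c * g) = l"
    by (simp_all add: q_def r_def l_def g_def)
  have m: "(a * \<Delta>) mod 2 ^ w = a * \<Delta>" "(b * g) mod 2 ^ w = b * g" "(c * g) mod 2 ^ w = c * g"
    "a mod 2 ^ w = a" "b mod 2 ^ w = b" "c mod 2 ^ w = c" "6 mod 2 ^ w = (6 :: nat)" "l mod 2 ^ w = l"
    "Suc n mod 2 ^ w = Suc n" "(Suc n * N) mod 2 ^ w = Suc n * N" "n mod 2 ^ w = n"
    using ab w2 small l_fits fits_row[of "Suc n" 0] by (simp_all add: g_def)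
  have m': "(N + n * N) mod 2 ^ w = N + n * N" using fits_row[of "Suc n" 0] by simp
  have main: "hoare w \<omega> ?rest 21 R1 (\<lambda>_. 0) D ?Q"
    apply (rule hoare_Const, rule hoare_Op, rule hoare_Const, rule hoare_Op, rule hoare_Op, rule hoare_Const, rule hoare_Op,
      rule hoare_Op, rule hoare_Const, rule hoare_Op, rule hoare_Op, rule hoare_Op, rule hoare_Store)
    apply (simp add: r1 m v)
    apply (rule tail)
          apply (simp_all add: r1 m m' v)
    done
  define R0 where "R0 = R(3 := 1, 4 := N, 5 := \<Delta>, 7 := 2)"
  have eq1: "R0(5 := 0, 6 := R0 6 + floorlog 2 \<Delta>) = R1"
    by (auto simp: R0_def R1_def rR g_def fun_eq_iff)
  have start: "hoare w \<omega> (Loop 5 [Op Divide 5 5 7, Op Plus 6 6 3] # ?rest) (24 + 3 * int \<Delta>) R0 (\<lambda>_. 0) D ?Q"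
  proof (rule log_loop[where x = \<Delta>], unfold eq1)
    show "R0 6 + floorlog 2 \<Delta> < 2 ^ w" using small by (simp add: R0_def rR g_def)
    show "hoare w \<omega> ?rest
      (24 + 3 * int \<Delta> - 3 * int (floorlog 2 \<Delta>) - 1) R1 (\<lambda>_. 0) D ?Q"
      by (rule hoare_mono[OF main]) (use g in \<open>simp_all add: g_def\<close>)
  qed (simp_all add: R0_def)
  have cong: "hoare w \<omega> p T' R' M D Q" if "hoare w \<omega> p T R0 M D Q" "R' = R0" "T \<le> T'" for p T T' R' M Q
    using hoare_mono[OF that(1,3)] that(2) by simp
  show ?thesis
    unfolding init_program_def
    apply (rule hoare_Const, rule hoare_Op, rule hoare_Const, rule hoare_Op, rule hoare_Op, rule hoare_Const)
    apply (rule cong[OF start])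
    subgoal using w_pos by (auto simp: R0_def rR small w2 N fun_eq_iff)
    subgoal by simp
    done
qed

section \<open>Invariant along a run\<close>

definition time_bound :: "nat \<Rightarrow> nat \<Rightarrow> int" where
  "time_bound t j = 30 + 3 * int \<Delta> + int t * (54 * int \<Delta> + 91) +
     int j * (40 * (int \<Delta> + 1) * int \<Delta> + 80 * (int \<Delta> + 1)\<^sup>2)"

definition start_col :: "nat \<Rightarrow> nat" where
  "start_col = proj (\<lambda>_. 0)"

text \<open>\<open>j\<close> counts the recolorings so far. The link to \<open>reach\<close> holds
  for all further updates \<open>us\<close>, so that the run can be continued with whatever the
  adversary asks for next.\<close>

definition good_snapshot :: "snapshot \<Rightarrow> nat \<Rightarrow> bool" where
  "good_snapshot X t \<longleftrightarrow> length (updates X) = t \<and> (\<exists>\<sigma> j. ok_state (adj_after (updates X)) \<sigma> [] \<and>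
     rep (memory X) (adj_after (updates X)) \<sigma> [] \<and>
     (\<forall>s us. reach (s + j) (updates X @ us) (\<lambda>_. []) start_col [] \<omega> =
        reach s us (adj_after (updates X)) (proj \<sigma>) [] (\<lambda>i. \<omega> (i + words_drawn X))) \<and>
     int (total_time X) \<le> time_bound t j)"

abbreviation run' :: "adversary \<Rightarrow> nat \<Rightarrow> snapshot option" where
  "run' adv t \<equiv> run (coloring_alg a b c) n \<Delta> adv \<omega> t"

lemma run_0: "\<exists>X. run' adv 0 = Some X \<and> good_snapshot X 0 \<and> updates X = []"
proof -
  define R where "R = (\<lambda>k. if k < length [n, \<Delta>] then [n, \<Delta>] ! k else 0)"
  have "hoare w \<omega> (init_program a b c) (30 + 3 * int \<Delta>) R (\<lambda>_. 0) 0
      (\<lambda>R' M' D'. D' = 0 \<and> rep M' (\<lambda>_. []) (\<lambda>_. 0) [])"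
    by (rule init_program_correct) (simp add: R_def numeral_2_eq_2)
  from hoare_execute[OF this] obtain R' M' k where k: "int k \<le> 30 + 3 * int \<Delta>" "rep M' (\<lambda>_. []) (\<lambda>_. 0) []"
    "execute w \<omega> \<lparr>todo = init_program a b c, regs = R, mem = (\<lambda>_. 0), drawn = 0\<rparr> =
      Some (\<lparr>todo = [], regs = R', mem = M', drawn = 0\<rparr>, k)" by blast
  have "start (init_prog (coloring_alg a b c)) [n, \<Delta>] (\<lambda>_. 0) 0 =
      \<lparr>todo = init_program a b c, regs = R, mem = (\<lambda>_. 0), drawn = 0\<rparr>"
    by (simp add: start_def coloring_alg_def R_def)
  with k(3) have "run' adv 0 = Some \<lparr>memory = M', words_drawn = 0, updates = [], outputs = [], total_time = k\<rparr>"
    by (simp add: w_def[symmetric])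
  moreover have "good_snapshot \<lparr>memory = M', words_drawn = 0, updates = [], outputs = [], total_time = k\<rparr> 0"
    unfolding good_snapshot_def
  proof (intro conjI exI[of _ "\<lambda>_. 0"] exI[of _ 0])
    show "ok_state (adj_after (updates \<lparr>memory = M', words_drawn = 0, updates = [], outputs = [], total_time = k\<rparr>)) (\<lambda>_. 0) []"
      using r by (simp add: ok_state_def adj_after_def valid_adj_def)
  qed (use k in \<open>simp_all add: adj_after_def start_col_def time_bound_def\<close>)
  ultimately show ?thesis by auto
qed

lemma run_Suc:
  assumes X: "run' adv t = Some X" and good: "good_snapshot X t"
    and x: "x = next_update adv \<omega> X" and valid: "valid_updates n \<Delta> (updates X @ [x])"
    and nr: "\<not> reach s (updates X @ [x]) (\<lambda>_. []) start_col [] \<omega>"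
  shows "\<exists>Y. run' adv (Suc t) = Some Y \<and> good_snapshot Y (Suc t) \<and> updates Y = updates X @ [x]"
proof -
  let ?A = "adj_after (updates X)"
  from good obtain \<sigma> j where len: "length (updates X) = t" and ok: "ok_state ?A \<sigma> []" and M: "rep (memory X) ?A \<sigma> []"
    and eq: "\<And>s us. reach (s + j) (updates X @ us) (\<lambda>_. []) start_col [] \<omega> =
        reach s us ?A (proj \<sigma>) [] (\<lambda>i. \<omega> (i + words_drawn X))"
    and time: "int (total_time X) \<le> time_bound t j"
    unfolding good_snapshot_def by blast
  have vu: "valid_update n \<Delta> (graph_after (updates X)) x" "valid_updates n \<Delta> (updates X)"
    using valid by (auto simp: valid_updates_snoc)
  have rp: "represents ?A (graph_after (updates X))" using valid_updates_represents[OF vu(2)] by simp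
  have ch: "changes_one_edge n (graph_after (updates X)) x" using vu(1) by (simp add: valid_update_def)
  have vA: "valid_adj (update_adj x ?A)"
    using valid_updates_represents[OF valid] by (simp add: adj_after_snoc)
  have nr': "\<not> reach s [x] ?A (proj \<sigma>) [] (\<lambda>i. \<omega> (i + words_drawn X))"
    using nr reach_antimono[of "s + j" "updates X @ [x]" "\<lambda>_. []" start_col "[]" \<omega> s] eq[of s "[x]"] by auto
  define R where "R = (\<lambda>k. if k < length (input_of x) then input_of x ! k else 0)"
  obtain i \<sigma>' D' where
    t: "hoare w \<omega> update_program (14 * int \<Delta> + 50 + loop_cost 1 i) R (memory X) (words_drawn X)
        (\<lambda>R' M' D''. D'' = D' \<and> rep M' (update_adj x ?A) \<sigma>' [])"
    and ok': "ok_state (update_adj x ?A) \<sigma>' []"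
    and eq': "\<And>s' us'. reach (s' + i) (x # us') ?A (proj \<sigma>) [] (\<lambda>i. \<omega> (i + words_drawn X)) =
        reach s' us' (update_adj x ?A) (proj \<sigma>') [] (\<lambda>i. \<omega> (i + D'))"
    using update_program_correct[OF qr ok M represents_update(2)[OF rp ch] vA _ _ nr', of R]
      represents_update(3)[OF rp ch] by (fastforce simp: R_def)
  from hoare_execute[OF t] obtain R' M' k where k: "int k \<le> 14 * int \<Delta> + 50 + loop_cost 1 i"
    "rep M' (update_adj x ?A) \<sigma>' []"
    "execute w \<omega> \<lparr>todo = update_program, regs = R, mem = memory X, drawn = words_drawn X\<rparr> =
      Some (\<lparr>todo = [], regs = R', mem = M', drawn = D'\<rparr>, k)" by blast
  have st: "start (update_prog (coloring_alg a b c)) (input_of x) (memory X) (words_drawn X) =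
      \<lparr>todo = update_program, regs = R, mem = memory X, drawn = words_drawn X\<rparr>"
    by (simp add: start_def coloring_alg_def R_def)
  define Y where "Y = \<lparr>memory = M', words_drawn = D', updates = updates X @ [x],
    outputs = outputs X @ [coloring_of n M'], total_time = total_time X + k\<rparr>"
  have "run' adv (Suc t) = Some Y"
    using X k(3) st by (simp add: w_def[symmetric] x[symmetric] Let_def Y_def)
  moreover have "good_snapshot Y (Suc t)"
    unfolding good_snapshot_def
  proof (rule conjI, simp add: Y_def len, rule exI[of _ \<sigma>'], rule exI[of _ "i + j"], intro conjI allI)
    show "ok_state (adj_after (updates Y)) \<sigma>' []" using ok' by (simp add: Y_def adj_after_snoc)
    show "rep (memory Y) (adj_after (updates Y)) \<sigma>' []" using k(2) by (simp add: Y_def adj_after_snoc)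
    show "reach (s + (i + j)) (updates Y @ us) (\<lambda>_. []) start_col [] \<omega> =
        reach s us (adj_after (updates Y)) (proj \<sigma>') [] (\<lambda>i. \<omega> (i + words_drawn Y))" for s us
      using eq[of "s + i" "x # us"] eq'[of s us] by (simp add: Y_def adj_after_snoc add.assoc)
    show "int (total_time Y) \<le> time_bound (Suc t) (i + j)"
      using time k(1) by (simp add: Y_def time_bound_def loop_cost_def algebra_simps)
  qed
  ultimately show ?thesis by (auto simp: Y_def)
qed

text \<open>The update sequence emerges only during the run, so failure of \<open>reach\<close> for
  some \<open>s\<close> is required of every valid sequence.\<close>

lemma run_good:
  assumes legal: "\<And>t X. t < T \<Longrightarrow> run' adv t = Some X \<Longrightarrow> valid_updates n \<Delta> (updates X @ [next_update adv \<omega> X])"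
    and nr: "\<And>us. valid_updates n \<Delta> us \<Longrightarrow> length us \<le> T \<Longrightarrow> \<exists>s. \<not> reach s us (\<lambda>_. []) start_col [] \<omega>"
  shows "t \<le> T \<Longrightarrow> \<exists>X. run' adv t = Some X \<and> good_snapshot X t \<and> valid_updates n \<Delta> (updates X)"
proof (induction t)
  case 0
  then show ?case using run_0[of adv] by (auto simp: valid_updates_def)
next
  case (Suc t)
  then obtain X where X: "run' adv t = Some X" "good_snapshot X t" by auto
  define x where "x = next_update adv \<omega> X"
  have v: "valid_updates n \<Delta> (updates X @ [x])" using legal[of t X] X Suc.prems by (simp add: x_def)
  have "length (updates X @ [x]) \<le> T" using X(2) Suc.prems by (simp add: good_snapshot_def)
  from nr[OF v this] obtain s where "\<not> reach s (updates X @ [x]) (\<lambda>_. []) start_col [] \<omega>" by blast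
  from run_Suc[OF X x_def v this] show ?case using v by auto
qed

text \<open>With an empty worklist no vertex has the value \<open>r\<close>, which leaves
  \<open>q\<close> primary and \<open>r\<close> secondary colors.\<close>

lemma good_snapshot_coloring:
  assumes good: "good_snapshot X t" and v: "valid_updates n \<Delta> (updates X)"
  shows "proper_coloring (graph_after (updates X)) (coloring_of n (memory X))"
    "card (coloring_of n (memory X) ` {1..n}) \<le> q + r"
proof -
  let ?A = "adj_after (updates X)"
  from good obtain \<sigma> where ok: "ok_state ?A \<sigma> []" and M: "rep (memory X) ?A \<sigma> []"
    unfolding good_snapshot_def by blast
  have rp: "represents ?A (graph_after (updates X))" using valid_updates_represents[OF v] by simp
  have col: "coloring_of n (memory X) y = \<sigma> y" if "y \<in> {1..n}" for y
    using repD(1)[OF M that] that by (simp add: coloring_of_def)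
  show "proper_coloring (graph_after (updates X)) (coloring_of n (memory X))"
    unfolding proper_coloring_def
  proof (intro allI impI)
    fix u v assume e: "{u, v} \<in> graph_after (updates X)"
    note uv = represents_edge[OF rp e]
    have "v \<in> set (?A u)" using rp uv e by (auto simp: represents_def)
    then show "coloring_of n (memory X) u \<noteq> coloring_of n (memory X) v"
      using ok uv col by (auto simp: ok_state_def)
  qed
  have "coloring_of n (memory X) ` {1..n} \<subseteq> {..r + q} - {r}"
    using ok col by (auto simp: ok_state_def)
  then have "card (coloring_of n (memory X) ` {1..n}) \<le> card ({..r + q} - {r})"
    by (intro card_mono) auto
  also have "\<dots> = q + r" by simp
  finally show "card (coloring_of n (memory X) ` {1..n}) \<le> q + r" .
qed

text \<open>The \<open>j\<close> recolorings of the run make \<open>reach j\<close> true; since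
  \<open>reach s\<close> is false, \<open>j < s\<close> by monotonicity.\<close>

lemma good_snapshot_time:
  assumes good: "good_snapshot X t" and nr: "\<not> reach s (updates X) (\<lambda>_. []) start_col [] \<omega>"
  shows "int (total_time X) \<le> time_bound t s"
proof -
  from good obtain \<sigma> j where
    eq: "\<And>s us. reach (s + j) (updates X @ us) (\<lambda>_. []) start_col [] \<omega> =
        reach s us (adj_after (updates X)) (proj \<sigma>) [] (\<lambda>i. \<omega> (i + words_drawn X))"
    and time: "int (total_time X) \<le> time_bound t j"
    unfolding good_snapshot_def by blast
  have "reach j (updates X) (\<lambda>_. []) start_col [] \<omega>" using eq[of 0 "[]"] by simp
  then have "j < s" using reach_antimono nr by (meson not_less)
  then have "int j * (40 * (int \<Delta> + 1) * int \<Delta> + 80 * (int \<Delta> + 1)\<^sup>2) \<le> int s * (40 * (int \<Delta> + 1) * int \<Delta> + 80 * (int \<Delta> + 1)\<^sup>2)"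
    by (intro mult_right_mono) auto
  then show ?thesis using time by (simp add: time_bound_def)
qed

end

section \<open>Probability bounds\<close>

context recolor
begin

lemma valid_adjs_endpoints: "valid_adjs A us \<Longrightarrow> x \<in> set us \<Longrightarrow> endpoints_ok n x"
  by (induction us arbitrary: A) auto

definition all_updates :: "update set" where
  "all_updates = (\<lambda>(u, v). Insert u v) ` ({1..n} \<times> {1..n}) \<union> (\<lambda>(u, v). Delete u v) ` ({1..n} \<times> {1..n})"

lemma finite_all_updates: "finite all_updates"
  by (simp add: all_updates_def)

lemma card_all_updates_le: "card all_updates \<le> 2 * n ^ 2"
proof -
  have "card all_updates \<le> card ((\<lambda>(u, v). Insert u v) ` ({1..n} \<times> {1..n})) + card ((\<lambda>(u, v). Delete u v) ` ({1..n} \<times> {1..n}))"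
    unfolding all_updates_def by (rule card_Un_le)
  also have "\<dots> \<le> card ({1..n} \<times> {1..n}) + card ({1..n} \<times> {1..n})"
    by (intro add_mono card_image_le) auto
  finally show ?thesis by (simp add: power2_eq_square)
qed

lemma valid_updates_subset: "valid_updates n \<Delta> us \<Longrightarrow> set us \<subseteq> all_updates"
proof
  fix x assume "valid_updates n \<Delta> us" "x \<in> set us"
  then have "endpoints_ok n x" using valid_updates_represents valid_adjs_endpoints by blast
  then show "x \<in> all_updates" by (cases x) (force simp: all_updates_def)+
qed

lemma proj_0_colorings: "proj (\<lambda>_. 0) \<in> colorings (\<lambda>_. [])"
  by (auto simp: colorings_def proj_def)

end

text \<open>\<rho> is the factor that one recoloring costs in the sum over colorings. By
  \<open>\<rho>_small\<close> it beats \<open>q + 1\<close> per vertex and 4 per update once there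
  are at least as many recolorings as vertices and as updates; \<open>flaw_small\<close> is the
  condition under which \<open>sum_prob_reach_le\<close> works.\<close>

locale recolor_bounds = recolor_alg +
  fixes \<rho> :: real
  assumes \<Delta>_pos: "1 \<le> \<Delta>" and q_pos: "1 \<le> q" and size: "\<Delta> * (q + 1) \<le> 2 ^ w" and \<rho>_pos: "0 < \<rho>"
    and \<rho>_small: "4 * (real q + 1) * \<rho> \<le> exp (- 4)"
    and flaw_small: "(real \<Delta> + 1) * (exp 1 * flaw_bound * (1 + 1 / real \<Delta>) ^ (\<Delta> + 1)) \<le> \<rho> / real \<Delta>"
begin

abbreviation "S \<equiv> random_words w"
abbreviation "bad s us \<equiv> {\<omega> \<in> space S. reach s us (\<lambda>_. []) start_col [] \<omega>}"

lemma prob_space_S: "prob_space S"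
  unfolding random_words_def
  by (intro prob_space_PiM prob_space_uniform_count_measure) (auto simp: lessThan_empty_iff)

lemma bad_sets [measurable]: "bad s us \<in> sets S"
  using pred_reach by (simp add: pred_def)

text \<open>The actual initial coloring is one term of the sum over all of them, and all terms are
  nonnegative.\<close>

lemma prob_bad_le:
  assumes "valid_updates n \<Delta> us"
  shows "measure S (bad s us) \<le> (real q + 1) ^ n * \<rho> ^ s * 4 ^ length us"
proof -
  have v: "valid_adjs (\<lambda>_. []) us" using valid_updates_represents[OF assms] by simp
  have "measure S (bad s us) = prob_of (reach s us (\<lambda>_. []) start_col [])" by (simp add: prob_of_def)
  also have "\<dots> \<le> (\<Sum>\<sigma>\<in>colorings (\<lambda>_. []). prob_of (reach s us (\<lambda>_. []) \<sigma> []))"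
    unfolding start_col_def by (rule member_le_sum) (auto simp: proj_0_colorings finite_colorings)
  also have "\<dots> \<le> (real q + 1) ^ n * \<rho> ^ s * 4 ^ length us"
    using sum_prob_reach_le[OF \<Delta>_pos q_pos size \<rho>_pos flaw_small v, of "[]" s] by simp
  finally show ?thesis .
qed

lemma \<rho>_lt_1: "\<rho> < 1"
proof -
  have "\<rho> \<le> 4 * (real q + 1) * \<rho>" using \<rho>_pos by simp
  also have "\<dots> \<le> exp (- 4)" by (rule \<rho>_small)
  also have "\<dots> < 1" by simp
  finally show ?thesis .
qed

text \<open>The probability of \<open>s\<close> recolorings decays geometrically in
  \<open>s\<close>, so almost surely there are only finitely many.\<close>

lemma AE_not_bad:
  assumes "valid_updates n \<Delta> us"
  shows "AE \<omega> in S. \<exists>s. \<not> reach s us (\<lambda>_. []) start_col [] \<omega>"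
proof -
  interpret prob_space S by (rule prob_space_S)
  let ?B = "\<Inter>s. bad s us"
  have B: "?B \<in> sets S" by (rule sets.countable_INT') auto
  have "measure S ?B \<le> (real q + 1) ^ n * 4 ^ length us * \<rho> ^ s" for s
  proof -
    have "measure S ?B \<le> measure S (bad s us)" by (intro finite_measure_mono) auto
    also have "\<dots> \<le> (real q + 1) ^ n * \<rho> ^ s * 4 ^ length us" by (rule prob_bad_le[OF assms])
    finally show ?thesis by (simp add: mult_ac)
  qed
  moreover have "(\<lambda>s. (real q + 1) ^ n * 4 ^ length us * \<rho> ^ s) \<longlonglongrightarrow> (real q + 1) ^ n * 4 ^ length us * 0"
    using \<rho>_pos \<rho>_lt_1 by (intro tendsto_intros) auto
  ultimately have "measure S ?B \<le> 0"
    by (intro tendsto_lowerbound[of "\<lambda>s. (real q + 1) ^ n * 4 ^ length us * \<rho> ^ s" _ sequentially]) auto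
  then have "emeasure S ?B = 0" by (simp add: emeasure_eq_measure measure_le_0_iff)
  then show ?thesis
    by (intro AE_I'[of ?B]) (auto simp: null_sets_def B)
qed

lemma AE_all_not_bad:
  "AE \<omega> in S. \<forall>us\<in>{us. valid_updates n \<Delta> us \<and> length us \<le> T}. \<exists>s. \<not> reach s us (\<lambda>_. []) start_col [] \<omega>"
proof (rule AE_finite_allI)
  have "{us. valid_updates n \<Delta> us \<and> length us \<le> T} \<subseteq> {us. set us \<subseteq> all_updates \<and> length us \<le> T}"
    using valid_updates_subset by auto
  then show "finite {us. valid_updates n \<Delta> us \<and> length us \<le> T}"
    by (rule finite_subset) (rule finite_lists_length_le[OF finite_all_updates])
qed (use AE_not_bad in auto)

section \<open>Adaptive and oblivious adversaries\<close>

abbreviation "alg \<equiv> coloring_alg a b c"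

lemma run_summary:
  assumes "\<And>t X. t < T \<Longrightarrow> run alg n \<Delta> adv \<omega> t = Some X \<Longrightarrow> valid_updates n \<Delta> (updates X @ [next_update adv \<omega> X])"
    and "\<And>us. valid_updates n \<Delta> us \<Longrightarrow> length us \<le> T \<Longrightarrow> \<exists>s. \<not> reach s us (\<lambda>_. []) start_col [] \<omega>"
    and "t \<le> T"
  shows "\<exists>X. run alg n \<Delta> adv \<omega> t = Some X \<and> valid_updates n \<Delta> (updates X) \<and> length (updates X) = t \<and>
    proper_coloring (graph_after (updates X)) (coloring_of n (memory X)) \<and>
    card (coloring_of n (memory X) ` {1..n}) \<le> q + r \<and>
    (\<forall>s. \<not> reach s (updates X) (\<lambda>_. []) start_col [] \<omega> \<longrightarrow> int (total_time X) \<le> time_bound t s)"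
proof -
  obtain X where X: "run alg n \<Delta> adv \<omega> t = Some X" "good_snapshot X t" "valid_updates n \<Delta> (updates X)"
    using run_good[of T adv t] assms by blast
  then show ?thesis
    using good_snapshot_coloring[OF X(2,3)] good_snapshot_time[OF X(2)] by (auto simp: good_snapshot_def)
qed

text \<open>The locale assumptions do not constrain \<omega>, so the summary holds for every
  sequence of random words, as needed under \<open>AE\<close>.\<close>

lemmas run_summary' = recolor_bounds.run_summary[OF recolor_bounds_axioms]

lemma legalD:
  "legal_adversary alg n \<Delta> adv T \<Longrightarrow> \<xi> \<in> space S \<Longrightarrow> t < T \<Longrightarrow> run alg n \<Delta> adv \<xi> t = Some X \<Longrightarrow>
    valid_updates n \<Delta> (updates X @ [next_update adv \<xi> X])"
  unfolding legal_adversary_def w_def[symmetric] by blast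

text \<open>Only finitely many valid sequences of at most \<open>T\<close> updates exist; almost
  surely the process stops on each of them, hence also on the one that the adversary
  produces.\<close>

lemma maintains:
  assumes "legal_adversary alg n \<Delta> adv T" and K: "real (q + r) \<le> K"
  shows "maintains_coloring alg n \<Delta> adv T K"
  unfolding maintains_coloring_def w_def[symmetric]
  using AE_all_not_bad[of T] AE_space
proof eventually_elim
  case (elim \<omega>)
  show ?case
  proof
    fix t assume t: "t \<in> {1..T}"
    have "\<exists>X. run alg n \<Delta> adv \<omega> t = Some X \<and> valid_updates n \<Delta> (updates X) \<and> length (updates X) = t \<and>
      proper_coloring (graph_after (updates X)) (coloring_of n (memory X)) \<and>
      card (coloring_of n (memory X) ` {1..n}) \<le> q + r \<and>
      (\<forall>s. \<not> reach s (updates X) (\<lambda>_. []) start_col [] \<omega> \<longrightarrow> int (total_time X) \<le> time_bound t s)"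
      using elim t by (intro run_summary'[of T]) (auto intro: legalD[OF assms(1)])
    then obtain X where X: "run alg n \<Delta> adv \<omega> t = Some X"
      "proper_coloring (graph_after (updates X)) (coloring_of n (memory X))"
      "card (coloring_of n (memory X) ` {1..n}) \<le> q + r" by blast
    have "real (card (coloring_of n (memory X) ` {1..n})) \<le> real (q + r)" using X(3) by (rule of_nat_mono)
    then show "\<exists>X. run alg n \<Delta> adv \<omega> t = Some X \<and>
      proper_coloring (graph_after (updates X)) (coloring_of n (memory X)) \<and>
      real (card (coloring_of n (memory X) ` {1..n})) \<le> K" using X K by auto
  qed
qed

text \<open>Union bound: a slow run performs \<open>s\<close> recolorings on its own update
  sequence, which lies in \<open>U\<close>. For an oblivious adversary \<open>U\<close> is a
  singleton; for an adaptive one it consists of all valid sequences of length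
  \<open>T\<close>.\<close>

lemma prob_time_ge:
  assumes legal: "legal_adversary alg n \<Delta> adv T" and U: "finite U" "\<And>us. us \<in> U \<Longrightarrow> valid_updates n \<Delta> us \<and> length us = T"
    and inU: "\<And>\<omega> X. \<omega> \<in> space S \<Longrightarrow> run alg n \<Delta> adv \<omega> T = Some X \<Longrightarrow> valid_updates n \<Delta> (updates X) \<Longrightarrow>
      length (updates X) = T \<Longrightarrow> updates X \<in> U"
    and T: "1 \<le> T" and B: "of_int (time_bound T s) \<le> B * real T"
  shows "1 - real (card U) * ((real q + 1) ^ n * \<rho> ^ s * 4 ^ T) \<le> prob_amortized_time_le alg n \<Delta> adv T B"
proof -
  interpret prob_space S by (rule prob_space_S)
  define G where "G = {\<omega> \<in> space S. \<exists>X. run alg n \<Delta> adv \<omega> T = Some X \<and> real (total_time X) / real T \<le> B}"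
  have G: "G \<in> sets S" unfolding G_def by (rule sets_run)
  have "AE \<omega> in S. \<omega> \<in> space S - G \<longrightarrow> \<omega> \<in> (\<Union>us\<in>U. bad s us)"
    using AE_all_not_bad[of T] AE_space
  proof eventually_elim
    case (elim \<omega>)
    have "\<exists>X. run alg n \<Delta> adv \<omega> T = Some X \<and> valid_updates n \<Delta> (updates X) \<and> length (updates X) = T \<and>
      proper_coloring (graph_after (updates X)) (coloring_of n (memory X)) \<and>
      card (coloring_of n (memory X) ` {1..n}) \<le> q + r \<and>
      (\<forall>s. \<not> reach s (updates X) (\<lambda>_. []) start_col [] \<omega> \<longrightarrow> int (total_time X) \<le> time_bound T s)"
      using elim by (intro run_summary'[of T]) (auto intro: legalD[OF legal])
    then obtain X where X: "run alg n \<Delta> adv \<omega> T = Some X" "valid_updates n \<Delta> (updates X)" "length (updates X) = T"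
      "\<And>s. \<not> reach s (updates X) (\<lambda>_. []) start_col [] \<omega> \<Longrightarrow> int (total_time X) \<le> time_bound T s" by blast
    show ?case
    proof
      assume "\<omega> \<in> space S - G"
      then have "\<not> real (total_time X) / real T \<le> B" using X(1) by (auto simp: G_def)
      then have "B * real T < real (total_time X)" using T by (simp add: field_simps)
      then have "\<not> int (total_time X) \<le> time_bound T s" using B by linarith
      then have "reach s (updates X) (\<lambda>_. []) start_col [] \<omega>" using X(4) by blast
      moreover have "updates X \<in> U" by (rule inU[OF _ X(1-3)]) (use elim in auto)
      ultimately show "\<omega> \<in> (\<Union>us\<in>U. bad s us)" using elim by auto
    qed
  qed
  then have "measure S (space S - G) \<le> measure S (\<Union>us\<in>U. bad s us)"
    using U(1) by (intro finite_measure_mono_AE) auto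
  also have "\<dots> \<le> (\<Sum>us\<in>U. measure S (bad s us))"
    using U(1) by (intro measure_UNION_le) auto
  also have "\<dots> \<le> (\<Sum>us\<in>U. (real q + 1) ^ n * \<rho> ^ s * 4 ^ T)"
    using prob_bad_le U(2) by (intro sum_mono) metis
  also have "\<dots> = real (card U) * ((real q + 1) ^ n * \<rho> ^ s * 4 ^ T)" by simp
  finally have "1 - measure S G \<le> real (card U) * ((real q + 1) ^ n * \<rho> ^ s * 4 ^ T)"
    using prob_compl[OF G] by simp
  then show ?thesis unfolding prob_amortized_time_le_def w_def[symmetric] G_def by simp
qed

lemma failure_le:
  assumes "n \<le> T" "T \<le> s"
  shows "(real q + 1) ^ n * \<rho> ^ s * 4 ^ T \<le> exp (- 4 * real s)"
proof -
  have "(real q + 1) ^ n * \<rho> ^ s * 4 ^ T \<le> (real q + 1) ^ s * \<rho> ^ s * 4 ^ s"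
    using assms \<rho>_pos by (intro mult_mono order.refl power_increasing) auto
  also have "\<dots> = (4 * (real q + 1) * \<rho>) ^ s" by (simp only: power_mult_distrib mult_ac)
  also have "\<dots> \<le> exp (- 4) ^ s" using \<rho>_small \<rho>_pos by (intro power_mono) auto
  also have "\<dots> = exp (- 4 * real s)" by (simp add: exp_of_nat_mult[symmetric])
  finally show ?thesis .
qed

text \<open>\<open>1 \<le> T\<close> lets the updates pay for the initialization.\<close>

lemma time_bound_le: "1 \<le> T \<Longrightarrow> of_int (time_bound T s) \<le> real \<Delta> ^ 2 * (178 * real T + 400 * real s)"
proof -
  assume T: "1 \<le> T"
  define d where "d = real \<Delta>"
  have d1: "1 \<le> d" using \<Delta>_pos by (simp add: d_def)
  have "d \<le> d ^ 2" using mult_right_mono[OF d1, of d] d1 by (simp add: power2_eq_square)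
  with d1 have d: "1 \<le> d" "d \<le> d ^ 2" "1 \<le> d ^ 2" by linarith+
  have "of_int (time_bound T s) = 30 + 3 * d + real T * (54 * d + 91) + real s * (40 * (d + 1) * d + 80 * (d + 1)\<^sup>2)"
    by (simp add: time_bound_def d_def)
  also have "\<dots> \<le> real T * (33 * d ^ 2) + real T * (145 * d ^ 2) + real s * (400 * d ^ 2)"
  proof (intro add_mono mult_left_mono)
    have "30 + 3 * d \<le> 1 * (33 * d ^ 2)" using d by linarith
    also have "\<dots> \<le> real T * (33 * d ^ 2)" using T by (intro mult_right_mono) auto
    finally show "30 + 3 * d \<le> real T * (33 * d ^ 2)" .
    show "54 * d + 91 \<le> 145 * d ^ 2" using d by linarith
    have "40 * (d + 1) * d + 80 * (d + 1)\<^sup>2 = 120 * d ^ 2 + 200 * d + 80"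
      by (simp add: power2_eq_square algebra_simps)
    then show "40 * (d + 1) * d + 80 * (d + 1)\<^sup>2 \<le> 400 * d ^ 2" using d by linarith
  qed auto
  also have "\<dots> = real \<Delta> ^ 2 * (178 * real T + 400 * real s)" by (simp add: d_def algebra_simps)
  finally show ?thesis .
qed

lemma adaptive_time:
  assumes legal: "legal_adversary alg n \<Delta> adv T" and T: "n \<le> T" and n: "2 \<le> n"
  shows "1 - 1 / real n \<le> prob_amortized_time_le alg n \<Delta> adv T (2000 * (real \<Delta> ^ 2 * ln (real n)))"
proof -
  define U where "U = {us. valid_updates n \<Delta> us \<and> length us = T}"
  \<comment> \<open>The union bound costs \<open>exp (3 * T * ln n)\<close> and \<open>s\<close>
    recolorings gain \<open>exp (- 4 * s)\<close>. The factor 2 also yields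
    \<open>T \<le> s\<close>, since \<open>2 * ln 2\<close> exceeds 1.\<close>
  define s where "s = nat \<lceil>2 * real T * ln (real n)\<rceil>"
  have T1: "1 \<le> T" "2 \<le> T" using T n by auto
  have ln2: "ln 2 \<le> ln (real n)" using n by simp
  have ln2': "(2::real) / 3 \<le> ln 2" by (rule ln2_ge_two_thirds)
  have L: "2 / 3 \<le> ln (real n)" using ln2 ln2' by linarith
  have s_ge: "2 * real T * ln (real n) \<le> real s" unfolding s_def by linarith
  have TL: "2 / 3 * real T \<le> real T * ln (real n)" using mult_left_mono[OF L, of "real T"] by (simp add: mult.commute)
  have s_le: "real s \<le> 4 * (real T * ln (real n))"
  proof -
    have "real s \<le> 2 * real T * ln (real n) + 1" unfolding s_def using L by (simp add: of_nat_ceiling)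
    moreover have "2 \<le> real T" using T1 by simp
    moreover have "2 * real T * ln (real n) = 2 * (real T * ln (real n))" by simp
    ultimately show ?thesis using TL by linarith
  qed
  have "real T \<le> 2 * real T * ln (real n)" using TL by simp
  then have Ts: "T \<le> s" using s_ge by linarith
  have sub: "U \<subseteq> {us. set us \<subseteq> all_updates \<and> length us = T}"
    using valid_updates_subset by (auto simp: U_def)
  have finU: "finite U" by (rule finite_subset[OF sub finite_lists_length_eq[OF finite_all_updates]])
  have "card U \<le> card {us. set us \<subseteq> all_updates \<and> length us = T}"
    by (intro card_mono sub finite_lists_length_eq finite_all_updates)
  also have "\<dots> = card all_updates ^ T" by (rule card_lists_length_eq[OF finite_all_updates])
  also have "\<dots> \<le> (2 * n ^ 2) ^ T" by (intro power_mono card_all_updates_le) simp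
  also have "\<dots> \<le> (n ^ 3) ^ T" using n by (intro power_mono) (auto simp: power2_eq_square power3_eq_cube)
  finally have "real (card U) \<le> real n ^ (3 * T)"
    by (metis of_nat_le_iff of_nat_power power_mult)
  also have "\<dots> = exp (3 * real T * ln (real n))"
    using n by (simp add: exp_of_nat_mult[symmetric] powr_realpow[symmetric] powr_def)
  finally have cU: "real (card U) \<le> exp (3 * real T * ln (real n))" .
  have "real (card U) * ((real q + 1) ^ n * \<rho> ^ s * 4 ^ T) \<le> exp (3 * real T * ln (real n)) * exp (- 4 * real s)"
    using \<rho>_pos by (intro mult_mono cU failure_le T Ts) auto
  also have "\<dots> = exp (3 * real T * ln (real n) - 4 * real s)" by (simp add: exp_add[symmetric])
  also have "\<dots> \<le> exp (- ln (real n))"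
  proof -
    have "1 * ln (real n) \<le> real T * ln (real n)" using T1 L by (intro mult_right_mono) auto
    then have "3 * real T * ln (real n) - 4 * real s \<le> - ln (real n)" using s_ge by linarith
    then show ?thesis by simp
  qed
  also have "\<dots> = 1 / real n" using n by (simp add: exp_minus inverse_eq_divide)
  finally have fail: "real (card U) * ((real q + 1) ^ n * \<rho> ^ s * 4 ^ T) \<le> 1 / real n" .
  have "1 - real (card U) * ((real q + 1) ^ n * \<rho> ^ s * 4 ^ T) \<le>
      prob_amortized_time_le alg n \<Delta> adv T (2000 * (real \<Delta> ^ 2 * ln (real n)))"
  proof (rule prob_time_ge[OF legal finU])
    have "of_int (time_bound T s) \<le> real \<Delta> ^ 2 * (178 * real T + 400 * real s)" by (rule time_bound_le[OF T1(1)])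
    also have "\<dots> \<le> real \<Delta> ^ 2 * (2000 * (real T * ln (real n)))"
      using s_le TL by (intro mult_left_mono) auto
    finally show "of_int (time_bound T s) \<le> 2000 * (real \<Delta> ^ 2 * ln (real n)) * real T" by (simp add: mult_ac)
  qed (use T1 in \<open>auto simp: U_def\<close>)
  then show ?thesis using fail by linarith
qed

lemma oblivious_run:
  assumes v: "valid_updates n \<Delta> us"
  shows "t \<le> length us \<Longrightarrow> run alg n \<Delta> (oblivious us) \<xi> t = Some X \<Longrightarrow>
    updates X = take t us \<and> length (outputs X) = t"
proof (induction t arbitrary: X)
  case 0
  then show ?case by (auto split: option.splits)
next
  case (Suc t)
  from Suc.prems(2) obtain Y where Y: "run alg n \<Delta> (oblivious us) \<xi> t = Some Y" by (auto split: option.splits)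
  have IH: "updates Y = take t us" "length (outputs Y) = t" using Suc.IH[OF _ Y] Suc.prems(1) by auto
  have "next_update (oblivious us) \<xi> Y = us ! t" by (simp add: next_update_def oblivious_def IH)
  then show ?case using Suc.prems Y IH
    by (auto simp: Let_def take_Suc_conv_app_nth split: option.splits)
qed

lemma oblivious_legal:
  assumes v: "valid_updates n \<Delta> us"
  shows "legal_adversary alg n \<Delta> (oblivious us) (length us)"
  unfolding legal_adversary_def
proof (intro ballI allI impI)
  fix \<omega> t X assume t: "t < length us" and X: "run alg n \<Delta> (oblivious us) \<omega> t = Some X"
  have o: "updates X = take t us" "length (outputs X) = t" using oblivious_run[OF v _ X] t by auto
  have "updates X @ [next_update (oblivious us) \<omega> X] = take (Suc t) us"
    using t by (simp add: o next_update_def oblivious_def take_Suc_conv_app_nth)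
  then show "valid_updates n \<Delta> (updates X @ [next_update (oblivious us) \<omega> X])"
    using valid_updates_take[OF v] by simp
qed

text \<open>For a single sequence there is no union bound to pay for, so already \<open>T\<close>
  recolorings are unlikely and the logarithm disappears.\<close>

lemma oblivious_time:
  assumes v: "valid_updates n \<Delta> us" and T: "n \<le> length us" and n: "1 \<le> n"
  shows "1 - 1 / real n \<le> prob_amortized_time_le alg n \<Delta> (oblivious us) (length us) (2000 * real \<Delta> ^ 2)"
proof -
  let ?T = "length us"
  have T1: "1 \<le> ?T" using T n by simp
  have "real n \<le> exp (real n)" using exp_ge_add_one_self[of "real n"] by linarith
  also have "\<dots> \<le> exp (4 * real ?T)" using T by simp
  finally have "exp (- 4 * real ?T) \<le> 1 / real n" using n by (simp add: exp_minus field_simps)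
  then have fail: "real (card {us}) * ((real q + 1) ^ n * \<rho> ^ ?T * 4 ^ ?T) \<le> 1 / real n"
    using failure_le[OF T order_refl] by simp
  have "1 - real (card {us}) * ((real q + 1) ^ n * \<rho> ^ ?T * 4 ^ ?T) \<le>
      prob_amortized_time_le alg n \<Delta> (oblivious us) ?T (2000 * real \<Delta> ^ 2)"
  proof (rule prob_time_ge[OF oblivious_legal[OF v]])
    show "of_int (time_bound ?T ?T) \<le> 2000 * real \<Delta> ^ 2 * real ?T"
    proof -
      have "of_int (time_bound ?T ?T) \<le> real \<Delta> ^ 2 * (178 * real ?T + 400 * real ?T)" by (rule time_bound_le[OF T1])
      also have "\<dots> \<le> real \<Delta> ^ 2 * (2000 * real ?T)" by (intro mult_left_mono) auto
      finally show ?thesis by (simp add: mult_ac)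
    qed
    show "updates X \<in> {us}" if "run alg n \<Delta> (oblivious us) \<omega> ?T = Some X" for \<omega> X
      using oblivious_run[OF v _ that] by simp
  qed (use v T1 in auto)
  then show ?thesis using fail by linarith
qed

end

section \<open>Choice of the parameters\<close>

text \<open>Everything asked of \<Delta>, with logarithms in place of digit counts. The terms
  \<open>ln 2\<close>, \<open>- 1\<close> and \<open>c\<close> allow for rounding. In the two
  exponential estimates, a positive power of \<open>x\<close> over a logarithm in the exponent
  outweighs the polynomial.\<close>

lemma eventually_parameters:
  fixes \<epsilon> c \<theta> K :: real
  assumes "0 < \<epsilon>" "0 < c" "0 < \<theta>"
  shows "\<forall>\<^sub>F x::real in at_top.
    (1 + \<epsilon> / 8) * (x / ln x) \<le> (1 + \<epsilon> / 4) * (x / (ln x + ln 2)) - 1 \<and>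
    x / (2 * ln x) + c \<le> x / (3 / 2 * ln x + 1) \<and> 1 \<le> x / (2 * c * ln x) \<and> 1 \<le> x / ln x \<and>
    (1 + \<epsilon>) * (x / ln x) + 2 \<le> x \<and>
    (x + 1) ^ 3 * x * exp (6 * c * (3 / 2 * ln x + 1) - x powr \<theta> / (2 * ln x)) \<le> exp (- 20) \<and>
    (x + 1) ^ 3 * x * exp (- (x / (2 * c * ln x)) / 3) \<le> exp (- 20) \<and> K \<le> x \<and> exp 1 \<le> x"
proof -
  have "((\<lambda>x::real. (x + 1) ^ 3 * x * exp (6 * c * (3 / 2 * ln x + 1) - x powr \<theta> / (2 * ln x))) \<longlongrightarrow> 0) at_top"
    using assms by real_asymp
  then have 1: "\<forall>\<^sub>F x::real in at_top. (x + 1) ^ 3 * x * exp (6 * c * (3 / 2 * ln x + 1) - x powr \<theta> / (2 * ln x)) < exp (- 20)"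
    by (rule order_tendstoD) simp
  have "((\<lambda>x::real. (x + 1) ^ 3 * x * exp (- (x / (2 * c * ln x)) / 3)) \<longlongrightarrow> 0) at_top"
    using assms by real_asymp
  then have 2: "\<forall>\<^sub>F x::real in at_top. (x + 1) ^ 3 * x * exp (- (x / (2 * c * ln x)) / 3) < exp (- 20)"
    by (rule order_tendstoD) simp
  have 3: "\<forall>\<^sub>F x::real in at_top. (1 + \<epsilon> / 8) * (x / ln x) \<le> (1 + \<epsilon> / 4) * (x / (ln x + ln 2)) - 1"
    using assms by real_asymp
  have 4: "\<forall>\<^sub>F x::real in at_top. x / (2 * ln x) + c \<le> x / (3 / 2 * ln x + 1)"
    by real_asymp
  have 5: "\<forall>\<^sub>F x::real in at_top. 1 \<le> x / (2 * c * ln x)"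
    using assms by real_asymp
  have 6: "\<forall>\<^sub>F x::real in at_top. 1 \<le> x / ln x" by real_asymp
  have 7: "\<forall>\<^sub>F x::real in at_top. (1 + \<epsilon>) * (x / ln x) + 2 \<le> x"
    using assms by real_asymp
  show ?thesis
    using 1 2 3 4 5 6 7 eventually_ge_at_top[of K] eventually_ge_at_top[of "exp 1 :: real"]
    by eventually_elim auto
qed

lemma parameter_bounds:
  fixes \<epsilon> :: real and \<Delta> a b c :: nat
  assumes \<epsilon>: "0 < \<epsilon>" and c: "1 \<le> c" "ln 2 / real c \<le> \<epsilon> / 4" and b: "1 \<le> b"
    and ab: "(1 + \<epsilon> / 4) / ln 2 \<le> real a / real b" "real a / real b \<le> (1 + \<epsilon> / 2) / ln 2"
    and \<theta>: "\<theta> = 1 - 1 / (1 + \<epsilon> / 8)"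
    and x: "x = real \<Delta>"
    and x1: "(1 + \<epsilon> / 8) * (x / ln x) \<le> (1 + \<epsilon> / 4) * (x / (ln x + ln 2)) - 1"
    and x2: "x / (2 * ln x) + real c \<le> x / (3 / 2 * ln x + 1)" and x3: "1 \<le> x / (2 * real c * ln x)" and x4: "1 \<le> x / ln x"
    and x5: "(1 + \<epsilon>) * (x / ln x) + 2 \<le> x"
    and x6: "(x + 1) ^ 3 * x * exp (6 * real c * (3 / 2 * ln x + 1) - x powr \<theta> / (2 * ln x)) \<le> exp (- 20)"
    and x7: "(x + 1) ^ 3 * x * exp (- (x / (2 * real c * ln x)) / 3) \<le> exp (- 20)"
    and x8: "exp 1 \<le> x"
    and g: "g = floorlog 2 \<Delta>" and q: "q = (a * \<Delta>) div (b * g)" and r: "r = \<Delta> div (c * g)" and l: "l = 6 * (c * g)"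
    and \<rho>: "\<rho> = exp (- 4) / (4 * (real q + 1))"
  shows "1 \<le> q" "1 \<le> r" "real (q + r) \<le> (1 + \<epsilon>) * (x / ln x)" "q + r + 2 \<le> \<Delta>" "g \<le> \<Delta>"
    "(real \<Delta> + 1) * (exp 1 * recolor.flaw_bound \<Delta> q r l * (1 + 1 / real \<Delta>) ^ (\<Delta> + 1)) \<le> \<rho> / real \<Delta>"
proof -
  have xp: "0 < x" "1 < x" using x8 exp_ge_add_one_self[of 1] by linarith+
  have \<Delta>: "1 \<le> \<Delta>" using xp x by simp
  define L where "L = ln x"
  have L1: "1 \<le> L" using x8 xp unfolding L_def by (simp add: ln_ge_iff)
  have ln2: "2 / 3 \<le> ln (2::real)" by (rule ln2_ge_two_thirds)
  have ln2': "ln (2::real) < 1" by (rule ln_2_less_1)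
  have gb: "2 ^ (g - 1) \<le> \<Delta>" "\<Delta> < 2 ^ g" using floorlog_bounds[of \<Delta> 2] \<Delta> by (auto simp: g)
  have g1: "1 \<le> g" using gb(2) \<Delta> by (cases g) auto
  have Lg: "L \<le> real g * ln 2"
  proof -
    have "x \<le> 2 ^ g" using gb(2) unfolding x by (metis less_imp_le of_nat_le_iff of_nat_numeral of_nat_power)
    then have "L \<le> ln (2 ^ g)" using xp unfolding L_def by simp
    then show ?thesis by (simp add: ln_realpow)
  qed
  have gL: "(real g - 1) * ln 2 \<le> L"
  proof -
    have "2 ^ (g - 1) \<le> x" using gb(1) unfolding x by (metis of_nat_le_iff of_nat_numeral of_nat_power)
    then have "ln (2 ^ (g - 1)) \<le> L" using xp unfolding L_def by simp
    then show ?thesis using g1 by (simp add: ln_realpow of_nat_diff)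
  qed
  have gL': "real g \<le> 3 / 2 * L + 1"
  proof -
    have "(real g - 1) * (2 / 3) \<le> (real g - 1) * ln 2" using ln2 g1 by (intro mult_left_mono) auto
    then show ?thesis using gL by simp
  qed
  have gpos: "0 < real g" using g1 by simp
  show "g \<le> \<Delta>"
  proof -
    have "g - 1 < 2 ^ (g - 1)" by simp
    then show ?thesis using gb(1) by linarith
  qed
  have bg: "0 < real b * real g" "0 < real c * real g" using b c g1 by auto
  have cpos: "0 < real c" using c by simp
  have q_le: "real q \<le> real a / real b * (x / real g)"
    using of_nat_div_le_of_nat[of "a * \<Delta>" "b * g", where ?'a = real] by (simp add: q x)
  have q_ge: "real a / real b * (x / real g) - 1 \<le> real q"
  proof -
    have "real (a * \<Delta>) / real (b * g) - 1 < real ((a * \<Delta>) div (b * g))"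
      using floor_divide_of_nat_eq[of "a * \<Delta>" "b * g", where ?'a = real] by linarith
    then show ?thesis by (simp add: q x)
  qed
  have r_le: "real r \<le> x / (real c * real g)"
    using of_nat_div_le_of_nat[of \<Delta> "c * g", where ?'a = real] by (simp add: r x)
  have r_ge: "x / (real c * real g) - 1 \<le> real r"
  proof -
    have "real \<Delta> / real (c * g) - 1 \<le> real (\<Delta> div (c * g))"
      using floor_divide_of_nat_eq[of \<Delta> "c * g", where ?'a = real] by linarith
    then show ?thesis by (simp add: r x)
  qed
  have xg: "x / real g \<le> ln 2 * (x / L)"
    using Lg xp L1 gpos by (simp add: field_simps)
  have "real q \<le> (1 + \<epsilon> / 2) / ln 2 * (ln 2 * (x / L))"
    using q_le mult_mono[OF ab(2) xg] xp gpos \<epsilon> ln2 by simp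
  then have q_up: "real q \<le> (1 + \<epsilon> / 2) * (x / L)" using ln2 by simp
  have "x / (real c * real g) = 1 / real c * (x / real g)" by simp
  also have "\<dots> \<le> 1 / real c * (ln 2 * (x / L))" using xg by (intro mult_left_mono) auto
  also have "\<dots> = ln 2 / real c * (x / L)" by simp
  also have "\<dots> \<le> \<epsilon> / 4 * (x / L)" using c(2) xp L1 by (intro mult_right_mono) auto
  finally have r_up: "real r \<le> \<epsilon> / 4 * (x / L)" using r_le by linarith
  have xL: "0 \<le> x / L" using xp L1 by simp
  have sum_up: "real (q + r) \<le> (1 + \<epsilon>) * (x / L)"
  proof -
    have "real (q + r) \<le> (1 + \<epsilon> / 2) * (x / L) + \<epsilon> / 4 * (x / L)" using q_up r_up by simp
    also have "\<dots> = (1 + \<epsilon>) * (x / L) - \<epsilon> / 4 * (x / L)"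
    proof -
      have "(1 + \<epsilon> / 2) * y + \<epsilon> / 4 * y = (1 + \<epsilon>) * y - \<epsilon> / 4 * y" for y by (simp add: field_simps)
      then show ?thesis .
    qed
    also have "\<dots> \<le> (1 + \<epsilon>) * (x / L)" using mult_nonneg_nonneg[OF _ xL, of "\<epsilon> / 4"] \<epsilon> by linarith
    finally show ?thesis .
  qed
  then show "real (q + r) \<le> (1 + \<epsilon>) * (x / ln x)" by (simp add: L_def)
  have "real (q + r + 2) \<le> x" using sum_up x5 by (simp add: L_def)
  then show qr\<Delta>: "q + r + 2 \<le> \<Delta>" unfolding x by linarith
  have q_low: "(1 + \<epsilon> / 8) * (x / L) \<le> real q"
  proof -
    \<comment> \<open>The digit count exceeds the binary logarithm by at most 1.\<close>
    have "real g * ln 2 \<le> L + ln 2" using gL by (simp add: algebra_simps)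
    then have "x / (L + ln 2) \<le> x / (real g * ln 2)"
      using xp gpos ln2 L1 by (intro divide_left_mono mult_pos_pos) auto
    then have "(1 + \<epsilon> / 4) * (x / (L + ln 2)) \<le> (1 + \<epsilon> / 4) * (x / (real g * ln 2))"
      using \<epsilon> by (intro mult_left_mono) auto
    also have "\<dots> = (1 + \<epsilon> / 4) / ln 2 * (x / real g)" by simp
    also have "\<dots> \<le> real a / real b * (x / real g)" using ab(1) xp by (intro mult_right_mono) auto
    finally show ?thesis using q_ge x1 by (simp add: L_def)
  qed
  have xL1: "1 \<le> x / L" using x4 by (simp add: L_def)
  have "1 * 1 \<le> (1 + \<epsilon> / 8) * (x / L)" using xL1 \<epsilon> by (intro mult_mono) auto
  then have q1: "1 \<le> real q" using q_low by linarith
  then show "1 \<le> q" by simp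
  have r_low: "x / (2 * real c * L) \<le> real r"
  proof -
    have "x / (3 / 2 * L + 1) \<le> x / real g" using gL' xp gpos by (intro divide_left_mono) auto
    then have "x / (2 * L) + real c \<le> x / real g" using x2 by (simp add: L_def)
    then have "(x / (2 * L) + real c) / real c \<le> x / real g / real c" using cpos by (intro divide_right_mono) auto
    then have "x / (2 * real c * L) + 1 \<le> x / (real c * real g)"
      using cpos by (simp add: add_divide_distrib mult_ac)
    then show ?thesis using r_ge by linarith
  qed
  then have r1: "1 \<le> real r" using x3 by (simp add: L_def)
  then show "1 \<le> r" by simp
  \<comment> \<open>One factor \<open>x + 1\<close> is for the possible culprits, one for
    \<open>q + 1\<close> in \<rho>, and \<open>x\<close> for the share \<rho> / \<Delta>; the third
    \<open>x + 1\<close> is slack.\<close>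
  define E where "E = (x + 1) ^ 3 * x"
  have E0: "0 < E" using xp by (simp add: E_def)
  have F1: "2 ^ l * exp (- (real q * exp (- real \<Delta> / real q)) / 2) \<le> exp (- 20) / E"
  proof -
    have e8: "0 < 1 + \<epsilon> / 8" using \<epsilon> by simp
    have "x / real q \<le> L / (1 + \<epsilon> / 8)"
    proof -
      have "x * (1 + \<epsilon> / 8) \<le> real q * L"
        using q_low L1 by (simp add: field_simps)
      then show ?thesis using e8 q1 by (simp add: field_simps)
    qed
    then have "- L / (1 + \<epsilon> / 8) \<le> - real \<Delta> / real q" by (simp add: x)
    then have ex: "exp (- L / (1 + \<epsilon> / 8)) \<le> exp (- real \<Delta> / real q)" by simp
    \<comment> \<open>Inserting the lower bound for \<open>q\<close> into
      \<open>q * exp (- x / q)\<close>, the estimate of the mean number of untaken colors, leaves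
      \<open>x powr \<theta> / L\<close>; this is the origin of \<theta>.\<close>
    have "x powr \<theta> = exp (\<theta> * L)" using xp by (simp add: powr_def L_def)
    also have "\<theta> * L = L + - L / (1 + \<epsilon> / 8)" unfolding \<theta> by (simp add: left_diff_distrib)
    also have "exp \<dots> = x * exp (- L / (1 + \<epsilon> / 8))" using xp by (simp only: exp_add L_def exp_ln)
    finally have "x powr \<theta> / L = (x / L) * exp (- L / (1 + \<epsilon> / 8))" by simp
    also have "\<dots> \<le> real q * exp (- real \<Delta> / real q)"
    proof (intro mult_mono ex)
      have "1 * (x / L) \<le> (1 + \<epsilon> / 8) * (x / L)" using xL \<epsilon> by (intro mult_right_mono) auto
      then show "x / L \<le> real q" using q_low by linarith
    qed auto
    finally have low: "x powr \<theta> / (2 * L) \<le> real q * exp (- real \<Delta> / real q) / 2" by simp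
    have "(2::real) ^ l = exp (real l * ln 2)" by (simp add: exp_of_nat_mult)
    also have "\<dots> \<le> exp (6 * real c * (3 / 2 * L + 1))"
    proof -
      have "real l * ln 2 \<le> real l * 1" using ln2' by (intro mult_left_mono) auto
      also have "\<dots> = 6 * real c * real g" by (simp add: l)
      also have "\<dots> \<le> 6 * real c * (3 / 2 * L + 1)" using gL' by (intro mult_left_mono) auto
      finally show ?thesis by simp
    qed
    finally have "2 ^ l * exp (- (real q * exp (- real \<Delta> / real q)) / 2) \<le>
        exp (6 * real c * (3 / 2 * L + 1)) * exp (- (x powr \<theta> / (2 * L)))"
      using low by (intro mult_mono) auto
    also have "\<dots> = exp (6 * real c * (3 / 2 * L + 1) - x powr \<theta> / (2 * L))" by (simp add: exp_add[symmetric])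
    also have "\<dots> \<le> exp (- 20) / E"
      using x6 E0 by (simp add: E_def L_def field_simps)
    finally show ?thesis .
  qed
  have F2: "(1 / 2) ^ r * exp (real \<Delta> / (real l + 1)) \<le> exp (- 20) / E"
  proof -
    \<comment> \<open>The factor 6 in \<open>l\<close> is made for this: the exponent is at most
      \<open>r / 3\<close>, half of the gain of at least \<open>r * 2 / 3\<close> from
      \<open>(1 / 2) ^ r\<close>.\<close>
    have "real \<Delta> / (real l + 1) \<le> x / (6 * (real c * real g))"
      unfolding x using bg by (intro divide_left_mono) (auto simp: l)
    also have "\<dots> = x / (real c * real g) / 6" by simp
    also have "\<dots> \<le> real r / 3" using r_ge r1 by simp
    finally have 1: "real \<Delta> / (real l + 1) \<le> real r / 3" .
    have "(1 / 2 :: real) ^ r = exp (- (real r * ln 2))"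
      by (simp add: exp_minus exp_of_nat_mult power_one_over inverse_eq_divide)
    also have "\<dots> \<le> exp (- (real r * (2 / 3)))" using mult_left_mono[OF ln2, of "real r"] by simp
    finally have "(1 / 2) ^ r * exp (real \<Delta> / (real l + 1)) \<le> exp (- (real r * (2 / 3))) * exp (real r / 3)"
      using 1 by (intro mult_mono) auto
    also have "\<dots> = exp (- (real r / 3))" by (simp add: exp_add[symmetric])
    also have "\<dots> \<le> exp (- (x / (2 * real c * L)) / 3)"
    proof -
      have "exp (- (u / 3)) \<le> exp (- v / 3)" if "v \<le> u" for u v :: real using that by simp
      then show ?thesis using r_low .
    qed
    also have "\<dots> \<le> exp (- 20) / E" using x7 E0 by (simp add: E_def L_def field_simps)
    finally show ?thesis .
  qed
  have fb: "recolor.flaw_bound \<Delta> q r l \<le> 2 * (exp (- 20) / E)"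
    unfolding recolor.flaw_bound_def using F1 F2 by linarith
  have fb0: "0 \<le> recolor.flaw_bound \<Delta> q r l" unfolding recolor.flaw_bound_def by simp
  have pow: "(1 + 1 / x) ^ (\<Delta> + 1) \<le> exp 2"
  proof -
    have "(1 + 1 / x) ^ (\<Delta> + 1) \<le> exp (1 / x) ^ (\<Delta> + 1)"
      using xp by (intro power_mono exp_ge_add_one_self) auto
    also have "\<dots> = exp (real (\<Delta> + 1) * (1 / x))" by (simp only: exp_of_nat_mult)
    also have "real (\<Delta> + 1) * (1 / x) = (x + 1) / x" by (simp add: x)
    also have "exp ((x + 1) / x) \<le> exp 2" using xp by (simp add: field_simps)
    finally show ?thesis .
  qed
  have "(x + 1) * (exp 1 * recolor.flaw_bound \<Delta> q r l * (1 + 1 / x) ^ (\<Delta> + 1)) \<le>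
      (x + 1) * (exp 1 * (2 * (exp (- 20) / E)) * exp 2)"
    using fb fb0 pow xp E0 by (intro mult_left_mono mult_mono) auto
  \<comment> \<open>Three units of \<open>exp (- 20)\<close> are used up by \<open>exp 1\<close> for
    rounding and \<open>exp 2\<close> for the worklist weights; the rest covers the constants in
    \<rho>.\<close>
  also have "\<dots> = 2 * exp (- 17) / ((x + 1) ^ 2 * x)"
  proof -
    have "exp 1 * exp (- 20) * exp 2 = exp (- 17 :: real)" by (simp only: exp_add[symmetric]) simp
    moreover have "(x + 1) / E = 1 / ((x + 1) ^ 2 * x)"
      using xp by (simp add: E_def power3_eq_cube power2_eq_square)
    moreover have "(x + 1) * (exp 1 * (2 * (exp (- 20) / E)) * exp 2) =
        2 * (exp 1 * exp (- 20) * exp 2) * ((x + 1) / E)" by simp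
    ultimately show ?thesis by simp
  qed
  also have "\<dots> \<le> exp (- 4) / (4 * (x + 1)) / x"
  proof -
    have "8 * exp (- 17) \<le> exp (- 4 :: real)"
    proof -
      have "(8::real) \<le> exp 13" using exp_ge_add_one_self[of "13::real"] by linarith
      then have "8 * exp (- 17) \<le> exp 13 * exp (- 17 :: real)" by (intro mult_right_mono) auto
      also have "\<dots> = exp (- 4)" by (simp add: exp_add[symmetric])
      finally show ?thesis .
    qed
    moreover have "exp (- 4) * 1 \<le> exp (- 4) * (x + 1)" using xp by (intro mult_left_mono) auto
    ultimately have "8 * exp (- 17) \<le> exp (- 4) * (x + 1)" by linarith
    then have "8 * exp (- 17) / (4 * ((x + 1)\<^sup>2 * x)) \<le> exp (- 4) * (x + 1) / (4 * ((x + 1)\<^sup>2 * x))"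
      by (rule divide_right_mono) (use xp in simp)
    also have "\<dots> = exp (- 4) / (4 * (x + 1)) / x"
      using xp by (simp add: power2_eq_square)
    finally show ?thesis by (simp add: mult.commute)
  qed
  also have "\<dots> \<le> \<rho> / x"
  proof -
    have "4 * (real q + 1) \<le> 4 * (x + 1)" using qr\<Delta> by (simp add: x)
    then have "exp (- 4) / (4 * (x + 1)) \<le> exp (- 4) / (4 * (real q + 1))"
      using xp by (intro divide_left_mono) auto
    then show ?thesis unfolding \<rho> using xp by (intro divide_right_mono) auto
  qed
  finally show "(real \<Delta> + 1) * (exp 1 * recolor.flaw_bound \<Delta> q r l * (1 + 1 / real \<Delta>) ^ (\<Delta> + 1)) \<le> \<rho> / real \<Delta>"
    by (simp add: x)
qed

text \<open>Program constants are natural numbers, so a real factor has to be approximated by a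
  fraction.\<close>

lemma exists_ratio_between:
  fixes x y :: real
  assumes "0 \<le> x" "x < y"
  shows "\<exists>(a::nat) (b::nat). 1 \<le> b \<and> x \<le> real a / real b \<and> real a / real b \<le> y"
proof -
  obtain z where z: "z \<in> \<rat>" "x < z" "z < y" using Rats_dense_in_real[OF assms(2)] by blast
  obtain a b :: nat where "b \<noteq> 0" "\<bar>z\<bar> = real a / real b" using z(1) by (rule Rats_abs_nat_div_natE)
  then show ?thesis using z assms(1) by (intro exI[of _ a] exI[of _ b]) auto
qed

theorem theorem3p1:
  fixes \<epsilon> :: real
  assumes "0 < \<epsilon>" and "\<epsilon> < 1"
  shows "\<exists>(\<Delta>\<^sub>0 :: nat) (alg :: algorithm) (C :: real) (d :: nat).
    word_factor alg \<ge> 1 \<and> d \<ge> 1 \<and>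
    (\<forall>n \<Delta> :: nat. n \<ge> 1 \<longrightarrow> \<Delta> \<ge> \<Delta>\<^sub>0 \<longrightarrow>
      (\<forall>adv T. legal_adversary alg n \<Delta> adv T \<longrightarrow>
         maintains_coloring alg n \<Delta> adv T ((1 + \<epsilon>) * (real \<Delta> / ln (real \<Delta>)))) \<and>
      (\<forall>adv T. legal_adversary alg n \<Delta> adv T \<and> T \<ge> n \<longrightarrow>
         prob_amortized_time_le alg n \<Delta> adv T (C * (real \<Delta> ^ 2 * ln (real n)))
           \<ge> 1 - 1 / real n ^ d) \<and>
      (\<forall>us. valid_updates n \<Delta> us \<and> length us \<ge> n \<longrightarrow>
         prob_amortized_time_le alg n \<Delta> (oblivious us) (length us) (C * real \<Delta> ^ 2)
           \<ge> 1 - 1 / real n ^ d))"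
proof -
  \<comment> \<open>\<open>1 / ln 2\<close> converts binary digits to natural logarithms; the gap
    between the two bounds leaves room for a rational factor.\<close>
  have "(1 + \<epsilon> / 4) / ln 2 < (1 + \<epsilon> / 2) / ln 2" using assms by (simp add: divide_strict_right_mono)
  moreover have "0 \<le> (1 + \<epsilon> / 4) / ln 2" using assms by simp
  ultimately obtain a b :: nat where ab: "1 \<le> b" "(1 + \<epsilon> / 4) / ln 2 \<le> real a / real b"
    "real a / real b \<le> (1 + \<epsilon> / 2) / ln 2"
    using exists_ratio_between by blast
  \<comment> \<open>Chosen so that the secondary palette takes at most
    \<open>\<epsilon> / 4 * \<Delta> / ln \<Delta>\<close> colors.\<close>
  define c where "c = nat \<lceil>4 * ln 2 / \<epsilon>\<rceil> + 1"
  have c: "1 \<le> c" "ln 2 / real c \<le> \<epsilon> / 4"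
  proof -
    have "4 * ln 2 / \<epsilon> \<le> real c" unfolding c_def by linarith
    moreover have "0 < real c" by (simp add: c_def)
    ultimately show "ln 2 / real c \<le> \<epsilon> / 4" using assms by (simp add: field_simps)
  qed (simp add: c_def)
  define \<theta> where "\<theta> = 1 - 1 / (1 + \<epsilon> / 8)"
  have \<theta>: "0 < \<theta>" using assms by (simp add: \<theta>_def field_simps)
  have "0 < real c" using c by simp
  \<comment> \<open>From this threshold on, all constants in the programs are small enough for the
    word size.\<close>
  from eventually_parameters[OF assms(1) this \<theta>, of "real (a + b + 6 * c + 16)"]
  obtain x0 where x0: "\<And>x. x0 \<le> x \<Longrightarrow>
    (1 + \<epsilon> / 8) * (x / ln x) \<le> (1 + \<epsilon> / 4) * (x / (ln x + ln 2)) - 1 \<and>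
    x / (2 * ln x) + real c \<le> x / (3 / 2 * ln x + 1) \<and> 1 \<le> x / (2 * real c * ln x) \<and> 1 \<le> x / ln x \<and>
    (1 + \<epsilon>) * (x / ln x) + 2 \<le> x \<and>
    (x + 1) ^ 3 * x * exp (6 * real c * (3 / 2 * ln x + 1) - x powr \<theta> / (2 * ln x)) \<le> exp (- 20) \<and>
    (x + 1) ^ 3 * x * exp (- (x / (2 * real c * ln x)) / 3) \<le> exp (- 20) \<and>
    real (a + b + 6 * c + 16) \<le> x \<and> exp 1 \<le> x"
    unfolding eventually_at_top_linorder by blast
  define \<Delta>\<^sub>0 where "\<Delta>\<^sub>0 = nat \<lceil>x0\<rceil>"
  let ?alg = "coloring_alg a b c"
  have main: "(\<forall>adv T. legal_adversary ?alg n \<Delta> adv T \<longrightarrow>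
         maintains_coloring ?alg n \<Delta> adv T ((1 + \<epsilon>) * (real \<Delta> / ln (real \<Delta>)))) \<and>
      (\<forall>adv T. legal_adversary ?alg n \<Delta> adv T \<and> T \<ge> n \<longrightarrow>
         prob_amortized_time_le ?alg n \<Delta> adv T (2000 * (real \<Delta> ^ 2 * ln (real n)))
           \<ge> 1 - 1 / real n ^ 1) \<and>
      (\<forall>us. valid_updates n \<Delta> us \<and> length us \<ge> n \<longrightarrow>
         prob_amortized_time_le ?alg n \<Delta> (oblivious us) (length us) (2000 * real \<Delta> ^ 2)
           \<ge> 1 - 1 / real n ^ 1)"
    if n: "1 \<le> n" and \<Delta>: "\<Delta>\<^sub>0 \<le> \<Delta>" for n \<Delta> :: nat
  proof -
    have "x0 \<le> real \<Delta>" using \<Delta> unfolding \<Delta>\<^sub>0_def by linarith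
    note x = x0[OF this]
    note x' = x[THEN conjunct1] x[THEN conjunct2, THEN conjunct1] x[THEN conjunct2, THEN conjunct2, THEN conjunct1]
      x[THEN conjunct2, THEN conjunct2, THEN conjunct2, THEN conjunct1]
      x[THEN conjunct2, THEN conjunct2, THEN conjunct2, THEN conjunct2, THEN conjunct1]
      x[THEN conjunct2, THEN conjunct2, THEN conjunct2, THEN conjunct2, THEN conjunct2, THEN conjunct1]
      x[THEN conjunct2, THEN conjunct2, THEN conjunct2, THEN conjunct2, THEN conjunct2, THEN conjunct2, THEN conjunct1]
      x[THEN conjunct2, THEN conjunct2, THEN conjunct2, THEN conjunct2, THEN conjunct2, THEN conjunct2, THEN conjunct2, THEN conjunct2]
    define g where "g = floorlog 2 \<Delta>"
    define q where "q = (a * \<Delta>) div (b * g)"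
    define r where "r = \<Delta> div (c * g)"
    define l where "l = 6 * (c * g)"
    define \<rho> where "\<rho> = exp (- 4) / (4 * (real q + 1))"
    define w where "w = word_size ?alg n \<Delta>"
    define N where "N = n + \<Delta> + 8"
    define X where "X = n + \<Delta> + 1"
    have P: "1 \<le> q" "1 \<le> r" "real (q + r) \<le> (1 + \<epsilon>) * (real \<Delta> / ln (real \<Delta>))" "q + r + 2 \<le> \<Delta>" "g \<le> \<Delta>"
      "(real \<Delta> + 1) * (exp 1 * recolor.flaw_bound \<Delta> q r l * (1 + 1 / real \<Delta>) ^ (\<Delta> + 1)) \<le> \<rho> / real \<Delta>"
      by (rule parameter_bounds[OF assms(1) c ab \<theta>_def refl x' g_def q_def r_def l_def \<rho>_def])+
    have "real (a + b + 6 * c + 16) \<le> real \<Delta>" using x by blast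
    then have K: "a + b + 6 * c + 16 \<le> \<Delta>" by linarith
    \<comment> \<open>The word factor 4 makes room for \<open>2 * (X * X)\<close>, the common bound
      for addresses and intermediate products.\<close>
    have X4: "X ^ 4 \<le> 2 ^ w"
    proof -
      have "X \<le> 2 ^ ceillog2 X" by (rule le_two_power_ceillog2)
      then have "X ^ 4 \<le> (2 ^ ceillog2 X) ^ 4" by (intro power_mono) auto
      also have "\<dots> = 2 ^ w" by (simp add: w_def word_size_def coloring_alg_def X_def power_mult[symmetric] mult.commute)
      finally show ?thesis .
    qed
    have X17: "17 \<le> X" using K by (simp add: X_def)
    have XX: "2 * (X * X) < 2 ^ w"
    proof -
      have "2 * (X * X) < (X * X) * (X * X)" using X17 by (intro mult_strict_right_mono) (auto intro: less_le_trans[OF _ mult_le_mono[OF X17 X17]])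
      also have "\<dots> = X ^ 4" by (simp add: power4_eq_xxxx)
      finally show ?thesis using X4 by linarith
    qed
    have prod: "u * v < 2 ^ w" if "u \<le> X" "v \<le> X" for u v
      using mult_le_mono[OF that] XX by linarith
    have one: "u < 2 ^ w" if "u \<le> X" for u using prod[OF that, of 1] X17 by simp
    have gX: "g \<le> X" "\<Delta> \<le> X" using P(5) by (auto simp: X_def)
    have small: "a \<le> X" "b \<le> X" "c \<le> X" "6 * c \<le> X" using K by (auto simp: X_def)
    \<comment> \<open>The constant sequence is a placeholder for \<omega>; the facts used below
      concern the measure on all sequences.\<close>
    interpret recolor_bounds n \<Delta> q r l w N "\<lambda>_. 0" a b c \<rho>
    proof
      show "N = n + \<Delta> + 8" by (rule N_def)
      have "(n + 2) * N \<le> X * (2 * X)" using K unfolding N_def X_def by (intro mult_le_mono) auto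
      then show "(n + 2) * N < 2 ^ w" using XX by simp
      show "1 \<le> r" "1 \<le> q" by (rule P)+
      show "r + q + 2 \<le> N" using P(4) by (simp add: N_def)
      show "l < 2 ^ w" using prod[OF small(4) gX(1)] by (simp add: l_def mult.assoc)
      show "q = (a * \<Delta>) div (b * floorlog 2 \<Delta>)" "r = \<Delta> div (c * floorlog 2 \<Delta>)" "l = 6 * (c * floorlog 2 \<Delta>)"
        by (simp_all add: q_def r_def l_def g_def)
      show "q \<le> \<Delta>" "r \<le> \<Delta>" using P(4) by auto
      show "w = word_size ?alg n \<Delta>" by (rule w_def)
      show "a * \<Delta> < 2 ^ w" "b * floorlog 2 \<Delta> < 2 ^ w" "c * floorlog 2 \<Delta> < 2 ^ w"
        using prod[OF small(1) gX(2)] prod[OF small(2) gX(1)] prod[OF small(3) gX(1)] by (simp_all add: g_def)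
      show "a < 2 ^ w" "b < 2 ^ w" "c < 2 ^ w" using one small by auto
      show "1 \<le> \<Delta>" using K by simp
      have "q + 1 \<le> X" using P(4) by (simp add: X_def)
      then show "\<Delta> * (q + 1) \<le> 2 ^ w" by (rule less_imp_le[OF prod[OF gX(2)]])
      show "0 < \<rho>" by (simp add: \<rho>_def)
      show "4 * (real q + 1) * \<rho> \<le> exp (- 4)" by (simp add: \<rho>_def)
      show "(real \<Delta> + 1) * (exp 1 * recolor.flaw_bound \<Delta> q r l * (1 + 1 / real \<Delta>) ^ (\<Delta> + 1)) \<le> \<rho> / real \<Delta>"
        by (rule P)
    qed
    show ?thesis
    proof (intro conjI allI impI)
      show "maintains_coloring ?alg n \<Delta> adv T ((1 + \<epsilon>) * (real \<Delta> / ln (real \<Delta>)))"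
        if "legal_adversary ?alg n \<Delta> adv T" for adv T
        by (rule maintains[OF that P(3)])
      show "prob_amortized_time_le ?alg n \<Delta> adv T (2000 * (real \<Delta> ^ 2 * ln (real n))) \<ge> 1 - 1 / real n ^ 1"
        if "legal_adversary ?alg n \<Delta> adv T \<and> T \<ge> n" for adv T
      \<comment> \<open>Since \<open>ln 1 = 0\<close>, the time bound is 0 for \<open>n = 1\<close>,
        but the required probability is then \<open>1 - 1 / 1 = 0\<close>.\<close>
      proof (cases "n = 1")
        case True
        then show ?thesis by (simp add: prob_amortized_time_le_def)
      next
        case False
        then show ?thesis using adaptive_time[of adv T] that n by simp
      qed
      show "prob_amortized_time_le ?alg n \<Delta> (oblivious us) (length us) (2000 * real \<Delta> ^ 2) \<ge> 1 - 1 / real n ^ 1"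
        if "valid_updates n \<Delta> us \<and> length us \<ge> n" for us
        using oblivious_time[of us] that n by simp
    qed
  qed
  have "word_factor ?alg \<ge> 1" by (simp add: coloring_alg_def)
  then show ?thesis using main
    by (intro exI[of _ \<Delta>\<^sub>0] exI[of _ ?alg] exI[of _ 2000] exI[of _ 1]) blast
qed

end
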